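(* Let $X_1,X_2\in\mathbb{C}[x_1,x_2]$ with $X_1\not\equiv 0$, let $\mathscr{X}=X_1\delta_1+X_2\delta_2$ and $X=\mathscr{X}y=X_1\delta_1y+X_2\delta_2y\in K\{y\}$. Then either $0\le \mathrm{ord}(\mathscr{X})\le 3$ or $\mathrm{ord}(\mathscr{X})=\infty$. Furthermore, when $0\le\mathrm{ord}(\mathscr{X})\le 3$, there is an essential expansion $\Lambda$ of $\mathscr{X}$ of the form $\Lambda=\{X,A\}$ with $A\in K\{y\}$ as follows: (1) if $\mathrm{ord}(\mathscr{X})=0$, then $A=y-a$ for some $a\in K\setminus\mathbb{C}$; (2) if $\mathrm{ord}(\mathscr{X})=1$, then $A=(\delta_2y)^n-a$ for some $n\in\mathbb{N}$ (positive) and $a\in K$; (3) if $\mathrm{ord}(\mathscr{X})=2$, then $A=\delta_2^2y-a\,\delta_2y$ for some $a\in K$; (4) if $\mathrm{ord}(\mathscr{X})=3$, then $A=2(\delta_2y)(\delta_2^3y)-3(\delta_2^2y)^2-a(\delta_2y)^2$ for some $a\in K$.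
   Context: Let $K=\mathbb{C}(x_1,x_2)$ with the derivations $\delta_i=\partial/\partial x_i$ ($i=1,2$). $K\{y\}$ is the ring of differential polynomials in one differential indeterminate $y$, i.e. the polynomial ring over $K$ in the symbols $\delta_1^{i_1}\delta_2^{i_2}y$ ($i_1,i_2\ge 0$), with $\delta_1,\delta_2$ extended as commuting derivations in the obvious way. A differential ideal is an ideal closed under $\delta_1,\delta_2$. For $\Sigma\subseteq K\{y\}$, $\{\Sigma\}$ denotes the smallest differential ideal containing $\Sigma$ (no radical is taken). Rank. $\delta_1^{j_1}\delta_2^{j_2}y$ is higher than $\delta_1^{i_1}\delta_2^{i_2}y$ if $j_1>i_1$, or $j_1=i_1$ and $j_2>i_2$. The leader of a differential polynomial that effectively involves $y$ or its derivatives is the highest derivative of $y$ occurring in it. $A_2$ has higher rank than $A_1$ if $A_2$ has a higher leader, or they have the same leader and $A_2$ has larger degree in it; a differential polynomial effectively involving $y$ or its derivatives has higher rank than any element of $K$. Expansions. An expansion of $\mathscr{X}$ is a differential ideal $\Lambda\subseteq K\{y\}$ properly containing $\{X\}$. Let $A$ be a nonzero element of $\Lambda$ of lowest rank. Then either the leader of $A$ is $\delta_2^r y$ for some $r\ge 0$, and one puts $\mathrm{ord}(\Lambda)=r$, or $A\in K$ (so $\Lambda=K\{y\}$), and one puts $\mathrm{ord}(\Lambda)=\infty$. Nontriviality. For $A\in K\{y\}$ and an analytic function $u$ on an open set $\Omega\subseteq\mathbb{C}^2$, $\mathscr{D}_Au$ is the function obtained by substituting $y=u$ in $A$; it is defined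 on $\Omega\setminus S(\mathscr{D}_A)$, where $S(\mathscr{D}_A)$ is the set of singular points (poles) of the coefficients of $A$. An expansion $\Lambda$ is nontrivial if there are a nonempty connected open set $\Omega\subseteq\mathbb{C}^2$ and a non-constant analytic function $\omega$ on $\Omega$ with $\mathscr{D}_A\omega=0$ on $\Omega\setminus S(\mathscr{D}_A)$ for all $A\in\Lambda$; by convention the unit ideal $K\{y\}$ (of order $\infty$) is also admitted. Order of the operator. An essential expansion of $\mathscr{X}$ is a nontrivial expansion of lowest possible order, and $\mathrm{ord}(\mathscr{X})$ is this lowest order. Thus $\mathrm{ord}(\mathscr{X})=\infty$ exactly when no nontrivial expansion has finite order. *)

theory Defs
  imports
    "HOL-Analysis.Analysis"
    "HOL-Computational_Algebra.Computational_Algebra"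
    "HOL-Computational_Algebra.Field_as_Ring"
    "HOL-Library.Poly_Mapping"
    "HOL-Library.Extended_Nat"
begin

text \<open>
  A bivariate polynomial is a polynomial in \<open>x\<^sub>2\<close> (outer variable) whose coefficients are
  polynomials in \<open>x\<^sub>1\<close> (inner variable).
\<close>

type_synonym bipoly = "complex poly poly"
type_synonym ratfun = "bipoly fract"

definition bipoly_d1 :: "bipoly \<Rightarrow> bipoly" where
  "bipoly_d1 = map_poly pderiv"

definition bipoly_d2 :: "bipoly \<Rightarrow> bipoly" where
  "bipoly_d2 = pderiv"

definition bipoly_eval :: "bipoly \<Rightarrow> complex \<times> complex \<Rightarrow> complex" where
  "bipoly_eval p z = poly (poly p [:snd z:]) (fst z)"

text \<open>
  \<open>quot_of_fract\<close> yields numerator and denominator in lowest terms; for the quotient rule any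
  other representation would do as well, but for the poles it matters.
\<close>

definition quotient_rule :: "(bipoly \<Rightarrow> bipoly) \<Rightarrow> ratfun \<Rightarrow> ratfun" where
  "quotient_rule d f = (case quot_of_fract f of (p, q) \<Rightarrow> Fract (d p * q - p * d q) (q ^ 2))"

definition ratfun_d1 :: "ratfun \<Rightarrow> ratfun" where
  "ratfun_d1 = quotient_rule bipoly_d1"

definition ratfun_d2 :: "ratfun \<Rightarrow> ratfun" where
  "ratfun_d2 = quotient_rule bipoly_d2"

definition ratfun_const :: "complex \<Rightarrow> ratfun" where
  "ratfun_const c = to_fract [:[:c:]:]"

definition ratfun_poles :: "ratfun \<Rightarrow> (complex \<times> complex) set" where
  "ratfun_poles f = {z. bipoly_eval (snd (quot_of_fract f)) z = 0}"

definition ratfun_eval :: "ratfun \<Rightarrow> complex \<times> complex \<Rightarrow> complex" where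
  "ratfun_eval f z =
     bipoly_eval (fst (quot_of_fract f)) z / bipoly_eval (snd (quot_of_fract f)) z"

text \<open>
  The pair \<open>(i\<^sub>1, i\<^sub>2)\<close> stands for the derivative \<open>\<delta>\<^sub>1\<^bsup>i\<^sub>1\<^esup> \<delta>\<^sub>2\<^bsup>i\<^sub>2\<^esup> y\<close>. A monomial is a finitely supported
  exponent function on these derivatives, and a differential polynomial is a finitely supported
  function from monomials to coefficients. The multiplication of \<open>HOL-Library.Poly_Mapping\<close> is
  convolution, so this is the polynomial ring in these infinitely many symbols.
\<close>

type_synonym deriv_index = "nat \<times> nat"
type_synonym dmonom = "deriv_index \<Rightarrow>\<^sub>0 nat"
type_synonym dpoly = "dmonom \<Rightarrow>\<^sub>0 ratfun"

definition dp_const :: "ratfun \<Rightarrow> dpoly" where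
  "dp_const a = Poly_Mapping.single 0 a"

definition dp_y :: "nat \<Rightarrow> nat \<Rightarrow> dpoly" where
  "dp_y i j = Poly_Mapping.single (Poly_Mapping.single (i, j) 1) 1"

text \<open>
  The derivation of the polynomial ring that extends the derivation \<open>d\<close> of the coefficients and
  maps the symbol with index \<open>v\<close> to the one with index \<open>s v\<close>: a term \<open>c * m\<close> is mapped to
  \<open>d c * m + (\<Sum>v. c * e\<^sub>v * (m / v) * s v)\<close>, with \<open>e\<^sub>v\<close> the exponent of \<open>v\<close> in \<open>m\<close>.
\<close>

definition dp_derivation ::
    "(ratfun \<Rightarrow> ratfun) \<Rightarrow> (deriv_index \<Rightarrow> deriv_index) \<Rightarrow> dpoly \<Rightarrow> dpoly" where
  "dp_derivation d s A =
     (\<Sum>m \<in> Poly_Mapping.keys A.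
        Poly_Mapping.single m (d (Poly_Mapping.lookup A m)) +
        (\<Sum>v \<in> Poly_Mapping.keys m.
           Poly_Mapping.single
             (m - Poly_Mapping.single v 1 + Poly_Mapping.single (s v) 1)
             (of_nat (Poly_Mapping.lookup m v) * Poly_Mapping.lookup A m)))"

definition dp_d1 :: "dpoly \<Rightarrow> dpoly" where
  "dp_d1 = dp_derivation ratfun_d1 (\<lambda>(i, j). (Suc i, j))"

definition dp_d2 :: "dpoly \<Rightarrow> dpoly" where
  "dp_d2 = dp_derivation ratfun_d2 (\<lambda>(i, j). (i, Suc j))"

definition differential_ideal :: "dpoly set \<Rightarrow> bool" where
  "differential_ideal I \<longleftrightarrow>
     0 \<in> I \<and> (\<forall>A\<in>I. \<forall>B\<in>I. A + B \<in> I) \<and> (\<forall>A\<in>I. \<forall>C. C * A \<in> I) \<and>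
     (\<forall>A\<in>I. dp_d1 A \<in> I \<and> dp_d2 A \<in> I)"

abbreviation diff_ideal_gen :: "dpoly set \<Rightarrow> dpoly set" where
  "diff_ideal_gen S \<equiv> differential_ideal hull S"

definition higher_deriv :: "deriv_index \<Rightarrow> deriv_index \<Rightarrow> bool" where
  "higher_deriv v w \<longleftrightarrow> fst v > fst w \<or> fst v = fst w \<and> snd v > snd w"

definition derivs_in :: "dpoly \<Rightarrow> deriv_index set" where
  "derivs_in A = (\<Union>m \<in> Poly_Mapping.keys A. Poly_Mapping.keys m)"

definition leader :: "dpoly \<Rightarrow> deriv_index" where
  "leader A = (THE v. v \<in> derivs_in A \<and> (\<forall>w \<in> derivs_in A. w \<noteq> v \<longrightarrow> higher_deriv v w))"

definition deg_in :: "deriv_index \<Rightarrow> dpoly \<Rightarrow> nat" where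
  "deg_in v A = Max ((\<lambda>m. Poly_Mapping.lookup m v) ` Poly_Mapping.keys A)"

definition higher_rank :: "dpoly \<Rightarrow> dpoly \<Rightarrow> bool" where
  "higher_rank A B \<longleftrightarrow>
     derivs_in A \<noteq> {} \<and>
     (derivs_in B = {} \<or>
      higher_deriv (leader A) (leader B) \<or>
      leader A = leader B \<and> deg_in (leader A) A > deg_in (leader B) B)"

definition lowest_rank_in :: "dpoly set \<Rightarrow> dpoly \<Rightarrow> bool" where
  "lowest_rank_in \<Lambda> A \<longleftrightarrow> A \<in> \<Lambda> \<and> A \<noteq> 0 \<and> (\<forall>B\<in>\<Lambda>. B \<noteq> 0 \<longrightarrow> \<not> higher_rank A B)"

text \<open>
  As for the library predicate \<open>analytic_on\<close> in one variable, analyticity on an open set is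
  expressed by complex differentiability, i.e. by a complex-linear total derivative at every point.
\<close>

definition analytic2_on :: "(complex \<times> complex \<Rightarrow> complex) \<Rightarrow> (complex \<times> complex) set \<Rightarrow> bool" where
  "analytic2_on u \<Omega> \<longleftrightarrow>
     (\<forall>z\<in>\<Omega>. \<exists>a b. (u has_derivative (\<lambda>h. a * fst h + b * snd h)) (at z))"

definition partial1 :: "(complex \<times> complex \<Rightarrow> complex) \<Rightarrow> complex \<times> complex \<Rightarrow> complex" where
  "partial1 u z = deriv (\<lambda>t. u (t, snd z)) (fst z)"

definition partial2 :: "(complex \<times> complex \<Rightarrow> complex) \<Rightarrow> complex \<times> complex \<Rightarrow> complex" where
  "partial2 u z = deriv (\<lambda>t. u (fst z, t)) (snd z)"

definition dp_subst :: "dpoly \<Rightarrow> (complex \<times> complex \<Rightarrow> complex) \<Rightarrow> complex \<times> complex \<Rightarrow> complex" where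
  "dp_subst A u z =
     (\<Sum>m \<in> Poly_Mapping.keys A.
        ratfun_eval (Poly_Mapping.lookup A m) z *
        (\<Prod>(i, j) \<in> Poly_Mapping.keys m.
           ((partial1 ^^ i) ((partial2 ^^ j) u) z) ^ Poly_Mapping.lookup m (i, j)))"

definition dp_sing :: "dpoly \<Rightarrow> (complex \<times> complex) set" where
  "dp_sing A = (\<Union>m \<in> Poly_Mapping.keys A. ratfun_poles (Poly_Mapping.lookup A m))"

definition vf_dpoly :: "bipoly \<Rightarrow> bipoly \<Rightarrow> dpoly" where
  "vf_dpoly X1 X2 = dp_const (to_fract X1) * dp_y 1 0 + dp_const (to_fract X2) * dp_y 0 1"

definition is_expansion :: "bipoly \<Rightarrow> bipoly \<Rightarrow> dpoly set \<Rightarrow> bool" where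
  "is_expansion X1 X2 \<Lambda> \<longleftrightarrow> differential_ideal \<Lambda> \<and> diff_ideal_gen {vf_dpoly X1 X2} \<subset> \<Lambda>"

text \<open>
  The order of an expansion does not depend on the choice of the element of lowest rank. If
  \<open>X1 \<noteq> 0\<close> and that element is not in the coefficient field, then its leader is of the form
  \<open>(0, r)\<close>, and \<open>r\<close> is the order.
\<close>

definition expansion_ord :: "dpoly set \<Rightarrow> enat" where
  "expansion_ord \<Lambda> =
     (let A = (SOME A. lowest_rank_in \<Lambda> A)
      in if derivs_in A = {} then \<infinity> else enat (snd (leader A)))"

definition nontrivial :: "dpoly set \<Rightarrow> bool" where
  "nontrivial \<Lambda> \<longleftrightarrow>
     \<Lambda> = UNIV \<or>
     (\<exists>\<Omega> \<omega>. open \<Omega> \<and> connected \<Omega> \<and> \<Omega> \<noteq> {} \<and>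
        analytic2_on \<omega> \<Omega> \<and> \<not> \<omega> constant_on \<Omega> \<and>
        (\<forall>A\<in>\<Lambda>. \<forall>z \<in> \<Omega> - dp_sing A. dp_subst A \<omega> z = 0))"

definition operator_ord :: "bipoly \<Rightarrow> bipoly \<Rightarrow> enat" where
  "operator_ord X1 X2 = Inf (expansion_ord ` {\<Lambda>. is_expansion X1 X2 \<Lambda> \<and> nontrivial \<Lambda>})"

definition essential_expansion :: "bipoly \<Rightarrow> bipoly \<Rightarrow> dpoly set \<Rightarrow> bool" where
  "essential_expansion X1 X2 \<Lambda> \<longleftrightarrow>
     is_expansion X1 X2 \<Lambda> \<and> nontrivial \<Lambda> \<and> expansion_ord \<Lambda> = operator_ord X1 X2"

end

theory Submission
  imports Defs "HOL-Complex_Analysis.Complex_Analysis"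
begin

text \<open>
  Let \<open>b = X\<^sub>2 / X\<^sub>1\<close>, \<open>Y = \<delta>\<^sub>1 + b \<delta>\<^sub>2\<close> and \<open>y\<^sub>k = \<delta>\<^sub>2\<^bsup>k\<^esup> y\<close>. Modulo \<open>{X}\<close> every differential polynomial is
  a polynomial in the \<open>y\<^sub>k\<close>, on which \<open>Y\<close> acts as the derivation
  \<open>E = Y + (\<Sum>j. (\<delta>\<^sub>2\<^bsup>j+1\<^esup> b) N\<^sub>j)\<close>, with \<open>Y\<close> applied to the coefficients and
  \<open>N\<^sub>j y\<^sub>k = - (k choose (j + 1)) y\<^bsub>k-j\<^esub>\<close>. If \<open>y\<^sub>k\<close> has weight \<open>k\<close>, then \<open>N\<^sub>j\<close> lowers weights by \<open>j\<close>, so that a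
  suitable element \<open>P\<close> of least weight \<open>w\<close> in an expansion satisfies \<open>E P = - w (\<delta>\<^sub>2 b) P\<close>. In
  weight \<open>w\<close> this says that the coefficients are first integrals: either one of them is not
  constant and the order is \<open>0\<close>, or the top part \<open>Q\<close> of \<open>P\<close> has constant coefficients. At the next
  weight \<open>w - j\<close> that occurs, a coefficient \<open>q\<close> of \<open>P\<close> satisfies
  \<open>Y q + j (\<delta>\<^sub>2 b) q + c (\<delta>\<^sub>2\<^bsup>j+1\<^esup> b) = 0\<close> with \<open>c\<close> a coefficient of \<open>N\<^sub>j Q\<close>. If \<open>N\<^sub>j Q = 0\<close>, this is the
  condition for an equation \<open>y\<^sub>1\<^bsup>j\<^esup> = q\<close>. Otherwise \<open>j\<close> is \<open>1\<close> or \<open>2\<close>, because \<open>[N\<^sub>1, N\<^sub>j]\<close> is a nonzero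
  multiple of \<open>N\<^bsub>j+1\<^esub>\<close> for \<open>j \<ge> 2\<close>, and this is the condition for the equation of order \<open>2\<close> or \<open>3\<close>. If
  no lower weight occurs, then \<open>P = y\<^sub>1\<^bsup>w\<^esup> f(y\<^sub>0)\<close> with constant coefficients, which only constants
  annihilate.

  Conversely, each of these conditions is the integrability condition of a linear system of two
  equations in two variables, which Picard iteration solves on a bidisc.
\<close>

subsection \<open>Derivations and evaluation of rational functions\<close>

text \<open>The derivatives of \<open>b\<close> in \<open>E\<close> come from Leibniz' rule:
  differentiating the relation for \<open>y\<close> k times along x2 expresses \<open>Y\<close>
  applied to the k-th derivative through derivatives of order at most k, with binomial coefficients.
  Minimality of weight replaces it: \<open>P\<close> is found using only linear operations over K
  and the stability of the ideal under \<open>E\<close>. Orders cannot grow in the passage to a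
  normal form: everything happens among polynomials of order at most that of an element of lowest
  rank, and a nonzero \<open>N_j Q\<close> needs a derivative of order above \<open>j\<close>. An
  expansion attaining the least order therefore yields a normal form of at most that order, and
  minimality makes them equal. That a normal form \<open>A\<close> generates a proper nontrivial
  expansion is shown analytically: a nonconstant common zero of \<open>X\<close> and
  \<open>A\<close> keeps the ideal from being the unit ideal, and a zero of \<open>X\<close> that is
  no zero of \<open>A\<close> keeps \<open>A\<close> out of \<open>{X}\<close>.\<close>

locale ring_derivation =
  fixes d :: "'a::comm_ring_1 \<Rightarrow> 'a"
  assumes add: "d (a + b) = d a + d b"
    and mult: "d (a * b) = d a * b + a * d b"
begin

lemma zero [simp]: "d 0 = 0"
  using add[of 0 0] by simp

lemma one [simp]: "d 1 = 0"
  using mult[of 1 1] by simp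

lemma uminus: "d (- a) = - d a"
  using add[of a "- a"] by (simp add: eq_neg_iff_add_eq_0 add.commute)

lemma diff: "d (a - b) = d a - d b"
  using add[of a "- b"] by (simp add: uminus)

lemma sum: "d (sum f A) = (\<Sum>x\<in>A. d (f x))"
  by (induction A rule: infinite_finite_induct) (auto simp: add)

lemma of_nat [simp]: "d (of_nat n) = 0"
  by (induction n) (auto simp: add)

lemma numeral [simp]: "d (numeral n) = 0"
  using of_nat[of "numeral n"] by simp

end

lemma ring_derivation_bipoly_d1: "ring_derivation bipoly_d1"
proof
  show add: "bipoly_d1 (a + b) = bipoly_d1 a + bipoly_d1 b" for a b
    by (rule poly_eqI) (simp add: bipoly_d1_def coeff_map_poly pderiv_add)
  have smult: "bipoly_d1 (smult c q) = smult (pderiv c) q + smult c (bipoly_d1 q)" for c q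
    by (rule poly_eqI) (simp add: bipoly_d1_def coeff_map_poly pderiv_mult mult.commute add.commute)
  have pCons: "bipoly_d1 (pCons c q) = pCons (pderiv c) (bipoly_d1 q)" for c q
    by (rule poly_eqI) (auto simp: bipoly_d1_def coeff_map_poly coeff_pCons split: nat.splits)
  show "bipoly_d1 (a * b) = bipoly_d1 a * b + a * bipoly_d1 b" for a b
    by (induction a) (simp_all add: bipoly_d1_def[of] add[unfolded bipoly_d1_def]
        smult[unfolded bipoly_d1_def] pCons[unfolded bipoly_d1_def] algebra_simps)
qed

lemma bipoly_d1_pCons: "bipoly_d1 (pCons c q) = pCons (pderiv c) (bipoly_d1 q)"
  by (rule poly_eqI) (auto simp: bipoly_d1_def coeff_map_poly coeff_pCons split: nat.splits)

lemma ring_derivation_bipoly_d2: "ring_derivation bipoly_d2"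
  by unfold_locales (simp_all add: bipoly_d2_def pderiv_add pderiv_mult algebra_simps)

context
  fixes d :: "bipoly \<Rightarrow> bipoly"
  assumes d: "ring_derivation d"
begin

interpretation d: ring_derivation d by (fact d)

text \<open>Differentiating the relation \<open>n * q = p * m\<close> between the representation in
  lowest terms and an arbitrary one shows that both give the same value.\<close>

lemma quotient_rule_Fract:
  assumes q: "q \<noteq> 0"
  shows "quotient_rule d (Fract p q) = Fract (d p * q - p * d q) (q ^ 2)"
proof -
  obtain n m where nm: "quot_of_fract (Fract p q) = (n, m)" by fastforce
  have m: "m \<noteq> 0" by (metis nm snd_conv snd_quot_of_fract_nonzero)
  have "Fract n m = Fract p q" by (metis Fract_quot_of_fract nm fst_conv snd_conv)
  hence eq: "n * q = p * m" using m q by (simp add: eq_fract)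
  have deq: "d n * q + n * d q = d p * m + p * d m" using arg_cong[OF eq, of d] by (simp add: d.mult)
  have "(d n * m - n * d m) * q ^ 2 = (d p * q - p * d q) * m ^ 2"
  proof -
    have "(dn * m - n * dm) * q ^ 2 - (dp * q - p * dq) * m ^ 2
        = m * q * (dn * q + n * dq - (dp * m + p * dm)) - (n * q - p * m) * (dm * q + m * dq)"
      for n m p q dn dm dp dq :: "'c::comm_ring_1"
      by (simp add: algebra_simps power2_eq_square)
    from this[of "d n" m n "d m" q "d p" p "d q"]
    show ?thesis using eq deq by simp
  qed
  thus ?thesis using m q nm by (simp add: quotient_rule_def eq_fract)
qed

lemma ring_derivation_quotient_rule: "ring_derivation (quotient_rule d)"
proof
  fix a b :: ratfun
  obtain p q where a: "a = Fract p q" "q \<noteq> 0" by (cases a) auto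
  obtain r s where b: "b = Fract r s" "s \<noteq> 0" by (cases b) auto
  have add: "(x * s + p * y + (z * q + r * w)) * (q * s) - (p * s + r * q) * (w * s + q * y)
      = (x * q - p * w) * s ^ 2 + (z * s - r * y) * q ^ 2" for p q r s x y z w :: "'c::comm_ring_1"
    by (simp add: algebra_simps power2_eq_square)
  show "quotient_rule d (a + b) = quotient_rule d a + quotient_rule d b"
    using a b by (simp add: quotient_rule_Fract d.add d.mult add power_mult_distrib)
  have mult: "(x * r + p * z) * (q * s) - p * r * (w * s + q * y)
      = (x * q - p * w) * (r * s) + p * q * (z * s - r * y)" for p q r s x y z w :: "'c::comm_ring_1"
    by (simp add: algebra_simps)
  have "quotient_rule d a * b = Fract ((d p * q - p * d q) * (r * s)) ((q * s) ^ 2)"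
    using a b by (simp add: quotient_rule_Fract eq_fract power2_eq_square)
  moreover have "a * quotient_rule d b = Fract (p * q * (d r * s - r * d s)) ((q * s) ^ 2)"
    using a b by (simp add: quotient_rule_Fract eq_fract power2_eq_square)
  moreover have "Fract u v + Fract w v = Fract (u + w) v" if "v \<noteq> 0" for u v w :: bipoly
    using that by (simp add: eq_fract distrib_right)
  ultimately show "quotient_rule d (a * b) = quotient_rule d a * b + a * quotient_rule d b"
    using a b by (simp add: quotient_rule_Fract d.mult mult del: add_fract)
qed

lemma quotient_rule_const: "d c = 0 \<Longrightarrow> quotient_rule d (to_fract c) = 0"
  by (simp add: to_fract_def quotient_rule_Fract Zero_fract_def eq_fract)

end

lemma ring_derivation_ratfun_d1: "ring_derivation ratfun_d1"
  unfolding ratfun_d1_def by (intro ring_derivation_quotient_rule ring_derivation_bipoly_d1)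

lemma ring_derivation_ratfun_d2: "ring_derivation ratfun_d2"
  unfolding ratfun_d2_def by (intro ring_derivation_quotient_rule ring_derivation_bipoly_d2)

interpretation d1: ring_derivation ratfun_d1 by (fact ring_derivation_ratfun_d1)
interpretation d2: ring_derivation ratfun_d2 by (fact ring_derivation_ratfun_d2)

lemma ratfun_d1_const [simp]: "ratfun_d1 (ratfun_const c) = 0"
  unfolding ratfun_d1_def ratfun_const_def
  by (rule quotient_rule_const[OF ring_derivation_bipoly_d1]) (simp add: bipoly_d1_pCons, simp add: bipoly_d1_def)

lemma ratfun_d2_const [simp]: "ratfun_d2 (ratfun_const c) = 0"
  unfolding ratfun_d2_def ratfun_const_def
  by (rule quotient_rule_const[OF ring_derivation_bipoly_d2]) (simp add: bipoly_d2_def pderiv_pCons)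

lemma ratfun_const_add: "ratfun_const (a + b) = ratfun_const a + ratfun_const b"
  by (simp add: ratfun_const_def to_fract_def)

lemma ratfun_const_mult: "ratfun_const (a * b) = ratfun_const a * ratfun_const b"
  by (simp add: ratfun_const_def to_fract_def)

lemma ratfun_const_0 [simp]: "ratfun_const 0 = 0"
  by (simp add: ratfun_const_def)

lemma ratfun_const_1 [simp]: "ratfun_const 1 = 1"
  by (simp add: ratfun_const_def to_fract_def One_fract_def one_pCons)

lemma ratfun_const_of_nat: "ratfun_const (of_nat n) = of_nat n"
  by (induction n) (simp_all add: ratfun_const_add)

lemma ratfun_const_uminus: "ratfun_const (- a) = - ratfun_const a"
  using ratfun_const_add[of a "- a"] by (simp add: eq_neg_iff_add_eq_0 add.commute)

lemma ratfun_const_eq_0_iff [simp]: "ratfun_const a = 0 \<longleftrightarrow> a = 0"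
  by (simp add: ratfun_const_def)

lemma of_nat_ratfun_eq_0_iff [simp]: "(of_nat n :: ratfun) = 0 \<longleftrightarrow> n = 0"
  by (metis ratfun_const_of_nat ratfun_const_eq_0_iff of_nat_eq_0_iff)

lemma numeral_ratfun_neq_0 [simp]: "(numeral n :: ratfun) \<noteq> 0"
  by (metis of_nat_ratfun_eq_0_iff of_nat_numeral zero_neq_numeral)

section \<open>Evaluation of rational functions away from their poles\<close>

lemma bipoly_eval_simps [simp]:
  "bipoly_eval 0 z = 0" "bipoly_eval 1 z = 1"
  "bipoly_eval (p + q) z = bipoly_eval p z + bipoly_eval q z"
  "bipoly_eval (p - q) z = bipoly_eval p z - bipoly_eval q z"
  "bipoly_eval (p * q) z = bipoly_eval p z * bipoly_eval q z"
  "bipoly_eval (p ^ n) z = bipoly_eval p z ^ n"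
  "bipoly_eval (- p) z = - bipoly_eval p z"
  by (simp_all add: bipoly_eval_def)

lemma bipoly_eval_pCons: "bipoly_eval (pCons c p) z = poly c (fst z) + snd z * bipoly_eval p z"
  by (simp add: bipoly_eval_def)

definition regular_at :: "complex \<times> complex \<Rightarrow> ratfun \<Rightarrow> bool" where
  "regular_at z f \<longleftrightarrow> bipoly_eval (snd (quot_of_fract f)) z \<noteq> 0"

text \<open>By coprimality the denominator in lowest terms divides every other denominator. One
  representation whose denominator does not vanish at \<open>z\<close> thus certifies regularity
  there.\<close>

lemma Fract_eval:
  assumes "bipoly_eval q z \<noteq> 0"
  shows "regular_at z (Fract p q)" "ratfun_eval (Fract p q) z = bipoly_eval p z / bipoly_eval q z"
proof -
  obtain n m where nm: "quot_of_fract (Fract p q) = (n, m)" by fastforce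
  have m: "m \<noteq> 0" by (metis nm snd_conv snd_quot_of_fract_nonzero)
  have q: "q \<noteq> 0" using assms by auto
  have "Fract n m = Fract p q" by (metis Fract_quot_of_fract nm fst_conv snd_conv)
  hence eq: "n * q = p * m" using m q by (simp add: eq_fract)
  have "coprime n m" by (metis nm coprime_quot_of_fract fst_conv snd_conv)
  hence "m dvd q" using eq by (metis coprime_commute coprime_dvd_mult_right_iff dvd_triv_right)
  then obtain k where "q = m * k" by auto
  hence mz: "bipoly_eval m z \<noteq> 0" using assms by auto
  thus "regular_at z (Fract p q)" by (simp add: regular_at_def nm)
  have "bipoly_eval n z * bipoly_eval q z = bipoly_eval p z * bipoly_eval m z"
    using arg_cong[OF eq, of "\<lambda>p. bipoly_eval p z"] by simp
  thus "ratfun_eval (Fract p q) z = bipoly_eval p z / bipoly_eval q z"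
    using mz assms by (simp add: ratfun_eval_def nm field_simps)
qed

lemma regular_atE:
  assumes "regular_at z f"
  obtains p q where "f = Fract p q" "bipoly_eval q z \<noteq> 0" "q \<noteq> 0"
  using assms Fract_quot_of_fract[of f] unfolding regular_at_def by (metis snd_quot_of_fract_nonzero)

lemma ratfun_eval_add:
  assumes "regular_at z f" "regular_at z g"
  shows "regular_at z (f + g)" "ratfun_eval (f + g) z = ratfun_eval f z + ratfun_eval g z"
proof -
  from assms obtain p q r s where f: "f = Fract p q" "bipoly_eval q z \<noteq> 0" "q \<noteq> 0"
    and g: "g = Fract r s" "bipoly_eval s z \<noteq> 0" "s \<noteq> 0"
    by (elim regular_atE)
  have "f + g = Fract (p * s + r * q) (q * s)" using f g by simp
  thus "regular_at z (f + g)" "ratfun_eval (f + g) z = ratfun_eval f z + ratfun_eval g z"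
    using f g Fract_eval[of "q * s" z "p * s + r * q"] by (simp_all add: Fract_eval add_frac_eq)
qed

lemma ratfun_eval_mult:
  assumes "regular_at z f" "regular_at z g"
  shows "regular_at z (f * g)" "ratfun_eval (f * g) z = ratfun_eval f z * ratfun_eval g z"
proof -
  from assms obtain p q r s where f: "f = Fract p q" "bipoly_eval q z \<noteq> 0"
    and g: "g = Fract r s" "bipoly_eval s z \<noteq> 0"
    by (elim regular_atE)
  have "f * g = Fract (p * r) (q * s)" using f g by simp
  thus "regular_at z (f * g)" "ratfun_eval (f * g) z = ratfun_eval f z * ratfun_eval g z"
    using f g Fract_eval[of "q * s" z "p * r"] by (simp_all add: Fract_eval)
qed

lemma ratfun_eval_to_fract [simp]: "regular_at z (to_fract p)" "ratfun_eval (to_fract p) z = bipoly_eval p z"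
  by (simp_all add: to_fract_def Fract_eval)

lemma ratfun_eval_const [simp]: "regular_at z (ratfun_const c)" "ratfun_eval (ratfun_const c) z = c"
  by (simp_all add: ratfun_const_def bipoly_eval_pCons)

lemma ratfun_eval_of_nat [simp]:
  fixes z :: "complex \<times> complex" and n :: nat
  shows "regular_at z (of_nat n)" "ratfun_eval (of_nat n) z = of_nat n"
  by (simp_all flip: ratfun_const_of_nat)

lemma ratfun_eval_numeral [simp]:
  fixes z :: "complex \<times> complex" and n :: num
  shows "regular_at z (numeral n)" "ratfun_eval (numeral n) z = numeral n"
  using ratfun_eval_of_nat[where n = "numeral n"] by simp_all

lemma ratfun_eval_0 [simp]: "regular_at z 0" "ratfun_eval 0 z = 0"
  and ratfun_eval_1 [simp]: "regular_at z 1" "ratfun_eval 1 z = 1"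
  using ratfun_eval_of_nat[where n = 0] ratfun_eval_of_nat[where n = 1] by simp_all

lemma regular_at_uminus [simp]: "regular_at z f \<Longrightarrow> regular_at z (- f)"
  and ratfun_eval_uminus: "regular_at z f \<Longrightarrow> ratfun_eval (- f) z = - ratfun_eval f z"
  using ratfun_eval_mult[OF ratfun_eval_const(1)[where c = "- 1"], of z f]
    ratfun_eval_const(2)[of "- 1" z]
  unfolding ratfun_const_uminus ratfun_const_1 by simp_all


lemma ratfun_eval_divide:
  assumes "regular_at z f" "regular_at z g" "ratfun_eval g z \<noteq> 0"
  shows "regular_at z (f / g)" "ratfun_eval (f / g) z = ratfun_eval f z / ratfun_eval g z"
proof -
  from assms obtain p q r s where f: "f = Fract p q" "bipoly_eval q z \<noteq> 0"
    and g: "g = Fract r s" "bipoly_eval s z \<noteq> 0"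
    by (elim regular_atE)
  have "f / g = Fract (p * s) (q * r)" using f g by simp
  moreover have "bipoly_eval r z \<noteq> 0" using assms(3) g by (simp add: Fract_eval)
  ultimately show "regular_at z (f / g)" "ratfun_eval (f / g) z = ratfun_eval f z / ratfun_eval g z"
    using f g Fract_eval[of "q * r" z "p * s"] by (simp_all add: Fract_eval)
qed

text \<open>Over the domain of polynomials in x1 only finitely many constants \<open>[:t:]\<close>
  are roots of \<open>p\<close>; for any other \<open>t\<close>, \<open>poly p [:t:]\<close> is a
  nonzero polynomial in one variable and has finitely many roots.\<close>

lemma bipoly_eval_nonzero_infinite:
  assumes "p \<noteq> 0" "infinite A" "infinite B"
  obtains s t where "s \<in> A" "t \<in> B" "bipoly_eval p (s, t) \<noteq> 0"
proof -
  have "finite {t. poly p [:t:] = 0}"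
    using finite_vimageI[OF poly_roots_finite[OF assms(1)], of "\<lambda>t. [:t:]"]
    by (simp add: vimage_def inj_def)
  then obtain t where t: "t \<in> B" "poly p [:t:] \<noteq> 0"
    using assms(3) by (metis (mono_tags, lifting) finite_subset mem_Collect_eq subsetI)
  then obtain s where "s \<in> A" "poly (poly p [:t:]) s \<noteq> 0"
    using assms(2) poly_roots_finite[OF t(2)] by (metis (mono_tags, lifting) finite_subset mem_Collect_eq subsetI)
  thus ?thesis using that t by (simp add: bipoly_eval_def)
qed

text \<open>An open set contains a product of two infinite sets. This density argument serves for
  identities that are known only off the zero set of a polynomial.\<close>

lemma bipoly_eval_nonzero_open:
  assumes "p \<noteq> 0" "open U" "U \<noteq> {}"
  obtains z where "z \<in> U" "bipoly_eval p z \<noteq> 0"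
proof -
  obtain w where w: "w \<in> U" using assms by auto
  obtain A B where AB: "open A" "open B" "w \<in> A \<times> B" "A \<times> B \<subseteq> U"
    using assms(2) w by (metis open_prod_elim)
  have "infinite C" if "open C" "c \<in> C" for C and c :: complex
    using that finite_imp_not_open by blast
  hence "infinite A" "infinite B" using AB by auto
  thus ?thesis using bipoly_eval_nonzero_infinite[OF assms(1)] that AB by (metis mem_Sigma_iff subsetD)
qed

subsection \<open>Analytic functions of two variables\<close>

text \<open>Total complex differentiability and the values of both partial derivatives in one
  predicate, so that the rules of calculus transport existence and values together.\<close>

definition has_partials ::
  "(complex \<times> complex \<Rightarrow> complex) \<Rightarrow> complex \<Rightarrow> complex \<Rightarrow> complex \<times> complex \<Rightarrow> bool" where
  "has_partials u a b z \<longleftrightarrow> (u has_derivative (\<lambda>h. a * fst h + b * snd h)) (at z)"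

lemma has_partials_slice1:
  assumes "has_partials u a b z"
  shows "((\<lambda>t. u (t, snd z)) has_field_derivative a) (at (fst z))"
proof -
  have "((\<lambda>t. (t, snd z)) has_derivative (\<lambda>h. (h, 0))) (at (fst z))"
    by (auto intro!: derivative_eq_intros)
  from has_derivative_compose[OF this, of u "\<lambda>h. a * fst h + b * snd h"] assms
  show ?thesis by (simp add: has_partials_def has_field_derivative_def)
qed

lemma has_partials_slice2:
  assumes "has_partials u a b z"
  shows "((\<lambda>t. u (fst z, t)) has_field_derivative b) (at (snd z))"
proof -
  have "((\<lambda>t. (fst z, t)) has_derivative (\<lambda>h. (0, h))) (at (snd z))"
    by (auto intro!: derivative_eq_intros)
  from has_derivative_compose[OF this, of u "\<lambda>h. a * fst h + b * snd h"] assms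
  show ?thesis by (simp add: has_partials_def has_field_derivative_def)
qed

lemma has_partials_unique:
  assumes "has_partials u a b z"
  shows "partial1 u z = a" "partial2 u z = b"
  using has_partials_slice1[OF assms] has_partials_slice2[OF assms]
  by (simp_all add: partial1_def partial2_def DERIV_imp_deriv)

lemma analytic2_on_has_partials:
  "analytic2_on u \<Omega> \<longleftrightarrow> (\<forall>z\<in>\<Omega>. has_partials u (partial1 u z) (partial2 u z) z)"
  unfolding analytic2_on_def by (metis has_partials_def has_partials_unique)

lemma analytic2_onI: "(\<And>z. z \<in> \<Omega> \<Longrightarrow> has_partials u (a z) (b z) z) \<Longrightarrow> analytic2_on u \<Omega>"
  unfolding analytic2_on_def has_partials_def by blast

lemma analytic2_onD: "analytic2_on u \<Omega> \<Longrightarrow> z \<in> \<Omega> \<Longrightarrow> has_partials u (partial1 u z) (partial2 u z) z"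
  by (simp add: analytic2_on_has_partials)

lemma analytic2_on_subset: "analytic2_on u \<Omega> \<Longrightarrow> U \<subseteq> \<Omega> \<Longrightarrow> analytic2_on u U"
  by (auto simp: analytic2_on_def)

lemma has_partials_continuous: "has_partials u a b z \<Longrightarrow> isCont u z"
  unfolding has_partials_def by (rule has_derivative_continuous)

lemma analytic2_on_continuous: "analytic2_on u \<Omega> \<Longrightarrow> continuous_on \<Omega> u"
  by (meson analytic2_onD continuous_at_imp_continuous_on has_partials_continuous)

lemma has_partials_transform:
  assumes "has_partials u a b z" "open S" "z \<in> S" "\<And>w. w \<in> S \<Longrightarrow> u w = v w"
  shows "has_partials v a b z"
  using assms unfolding has_partials_def
  by (auto intro: has_derivative_transform_within_open)

lemma has_partials_const: "has_partials (\<lambda>_. c) 0 0 z"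
  by (simp add: has_partials_def)

lemma has_partials_fst: "has_partials fst 1 0 z"
  and has_partials_snd: "has_partials snd 0 1 z"
  unfolding has_partials_def by (auto intro!: derivative_eq_intros simp: fun_eq_iff)

lemma has_partials_add:
  "has_partials u a b z \<Longrightarrow> has_partials v c d z \<Longrightarrow> has_partials (\<lambda>w. u w + v w) (a + c) (b + d) z"
  unfolding has_partials_def by (auto intro!: derivative_eq_intros simp: fun_eq_iff algebra_simps)

lemma has_partials_diff:
  "has_partials u a b z \<Longrightarrow> has_partials v c d z \<Longrightarrow> has_partials (\<lambda>w. u w - v w) (a - c) (b - d) z"
  unfolding has_partials_def by (auto intro!: derivative_eq_intros simp: fun_eq_iff algebra_simps)

lemma has_partials_mult:
  "has_partials u a b z \<Longrightarrow> has_partials v c d z \<Longrightarrow>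
   has_partials (\<lambda>w. u w * v w) (a * v z + u z * c) (b * v z + u z * d) z"
  unfolding has_partials_def by (auto intro!: derivative_eq_intros simp: fun_eq_iff algebra_simps)

lemma has_partials_sum:
  "(\<And>i. i \<in> I \<Longrightarrow> has_partials (u i) (a i) (b i) z) \<Longrightarrow>
   has_partials (\<lambda>w. \<Sum>i\<in>I. u i w) (\<Sum>i\<in>I. a i) (\<Sum>i\<in>I. b i) z"
  by (induction I rule: infinite_finite_induct) (auto intro: has_partials_const has_partials_add)

lemma has_partials_compose:
  assumes "has_partials u a b z" "(g has_field_derivative g') (at (u z))"
  shows "has_partials (\<lambda>w. g (u w)) (g' * a) (g' * b) z"
proof -
  have "(g has_derivative (\<lambda>h. g' * h)) (at (u z))"
    using assms(2) by (simp add: has_field_derivative_def)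
  from has_derivative_compose[OF assms(1)[unfolded has_partials_def] this]
  show ?thesis by (simp add: has_partials_def algebra_simps)
qed

lemma has_partials_power:
  "has_partials u a b z \<Longrightarrow>
   has_partials (\<lambda>w. u w ^ n) (of_nat n * u z ^ (n - 1) * a) (of_nat n * u z ^ (n - 1) * b) z"
  by (rule has_partials_compose) (auto intro!: derivative_eq_intros)

lemma has_partials_divide:
  assumes "has_partials u a b z" "has_partials v c d z" "v z \<noteq> 0"
  shows "has_partials (\<lambda>w. u w / v w) ((a * v z - u z * c) / v z ^ 2) ((b * v z - u z * d) / v z ^ 2) z"
proof -
  have "(inverse has_field_derivative (- inverse (v z ^ 2))) (at (v z))"
    using assms(3) by (auto intro!: derivative_eq_intros simp: power2_eq_square)
  from has_partials_mult[OF assms(1) has_partials_compose[OF assms(2) this]]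
  have "has_partials (\<lambda>w. u w * inverse (v w)) (a * inverse (v z) + u z * (- inverse ((v z)\<^sup>2) * c))
    (b * inverse (v z) + u z * (- inverse ((v z)\<^sup>2) * d)) z" .
  moreover have "x * inverse (v z) + u z * (- inverse ((v z)\<^sup>2) * y) = (x * v z - u z * y) / v z ^ 2" for x y
    using assms(3) by (simp add: divide_simps power2_eq_square)
  ultimately show ?thesis by (simp add: divide_inverse)
qed

lemma has_partials_swap:
  assumes "has_partials u a b (prod.swap z)"
  shows "has_partials (\<lambda>w. u (prod.swap w)) b a z"
proof -
  have "(prod.swap has_derivative prod.swap) (at z)"
    unfolding prod.swap_def by (auto intro!: derivative_eq_intros)
  from has_derivative_compose[OF this, of u "\<lambda>h. a * fst h + b * snd h"] assms
  show ?thesis by (simp add: has_partials_def add.commute)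
qed

lemma open_swap: "open S \<Longrightarrow> open (prod.swap -` S)"
  for S :: "('a::topological_space \<times> 'b::topological_space) set"
  unfolding prod.swap_def by (rule open_vimage) (auto intro!: continuous_intros)

lemma partial1_swap: "partial1 (\<lambda>w. u (prod.swap w)) z = partial2 u (prod.swap z)"
  and partial2_swap: "partial2 (\<lambda>w. u (prod.swap w)) z = partial1 u (prod.swap z)"
  by (simp_all add: partial1_def partial2_def)

section \<open>Continuity and analyticity of partial derivatives\<close>

lemma open_bidisc:
  fixes \<Omega> :: "(complex \<times> complex) set"
  assumes "open \<Omega>" "z \<in> \<Omega>"
  obtains r where "r > 0" "cball (fst z) r \<times> cball (snd z) r \<subseteq> \<Omega>"
proof -
  obtain A B where AB: "open A" "open B" "z \<in> A \<times> B" "A \<times> B \<subseteq> \<Omega>"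
    using assms by (metis open_prod_elim)
  obtain r where r: "r > 0" "cball (fst z) r \<subseteq> A" using AB open_contains_cball by (metis mem_Times_iff)
  obtain s where s: "s > 0" "cball (snd z) s \<subseteq> B" using AB open_contains_cball by (metis mem_Times_iff)
  show ?thesis
    by (rule that[of "min r s"]) (use r s AB in \<open>auto simp: subset_iff\<close>)
qed

text \<open>Near \<open>z0\<close> the slices at \<open>x\<close> and at \<open>a\<close> are
  uniformly close, and Cauchy's inequality passes this closeness on to their derivatives at
  \<open>y\<close>. The remaining distance from \<open>y\<close> to \<open>b\<close> is covered by
  the continuity of the derivative of the single slice at \<open>a\<close>.\<close>

lemma continuous_partial2:
  assumes "open \<Omega>" "continuous_on \<Omega> u"
    and hol: "\<And>z. z \<in> \<Omega> \<Longrightarrow> (\<lambda>t. u (fst z, t)) field_differentiable at (snd z)"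
  shows "continuous_on \<Omega> (partial2 u)"
proof (rule continuous_at_imp_continuous_on, rule ballI)
  fix z0 assume z0: "z0 \<in> \<Omega>"
  obtain a b where ab: "z0 = (a, b)" by fastforce
  from open_bidisc[OF assms(1) z0] obtain R where R: "R > 0" "cball a R \<times> cball b R \<subseteq> \<Omega>"
    by (metis ab fst_conv snd_conv)
  \<comment> \<open>Half the radius keeps the circle of radius \<open>r\<close> around any
    \<open>y\<close> within \<open>r\<close> of \<open>b\<close> inside the large disc.\<close>
  define r where "r = R / 2"
  have r: "r > 0" and rR: "r + r = R" using R by (auto simp: r_def)
  define K where "K = cball a R \<times> cball b R"
  have "uniformly_continuous_on K u"
    using R by (intro compact_uniformly_continuous)
      (auto simp: K_def intro: compact_Times continuous_on_subset[OF assms(2)])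
  note uc = this[unfolded uniformly_continuous_on_def, rule_format]
  have holx: "(\<lambda>t. u (x, t)) holomorphic_on ball b R" if "x \<in> cball a R" for x
  proof -
    have "(\<lambda>t. u (x, t)) field_differentiable at t" if "t \<in> ball b R" for t
      using hol[of "(x, t)"] R \<open>x \<in> cball a R\<close> that by (auto simp: subset_iff)
    thus ?thesis by (simp add: holomorphic_on_def field_differentiable_at_within)
  qed
  have contx: "continuous_on (cball b R) (\<lambda>t. u (x, t))" if "x \<in> cball a R" for x
    using that R by (intro continuous_on_compose2[OF assms(2)]) (auto intro!: continuous_intros)
  show "isCont (partial2 u) z0"
    unfolding continuous_at_eps_delta
  proof (intro allI impI)
    fix e :: real assume e: "e > 0"
    define e' where "e' = e * r / 4"
    have e': "e' > 0" using e r by (simp add: e'_def)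
    obtain d where d: "d > 0" "\<And>w w'. w \<in> K \<Longrightarrow> w' \<in> K \<Longrightarrow> dist w' w < d \<Longrightarrow> dist (u w') (u w) < e'"
      using uc[OF e'] by blast
    have "isCont (deriv (\<lambda>t. u (a, t))) b"
      using holx[of a] R(1)
      by (auto intro!: continuous_on_interior[OF holomorphic_on_imp_continuous_on[OF holomorphic_deriv]])
    then obtain d' where d': "d' > 0"
      "\<And>t. dist t b < d' \<Longrightarrow> dist (deriv (\<lambda>t. u (a, t)) t) (deriv (\<lambda>t. u (a, t)) b) < e / 2"
      unfolding continuous_at_eps_delta using e by (metis half_gt_zero)
    show "\<exists>d>0. \<forall>x'. dist x' z0 < d \<longrightarrow> dist (partial2 u x') (partial2 u z0) < e"
    proof (intro exI[of _ "min (min d d') r"] conjI allI impI)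
      show "0 < min (min d d') r" using d d' r by simp
      fix z assume z: "dist z z0 < min (min d d') r"
      obtain x y where xy: "z = (x, y)" by fastforce
      have dx: "dist x a < min (min d d') r" "dist y b < min (min d d') r"
        using z dist_fst_le[of z z0] dist_snd_le[of z z0] by (auto simp: xy ab)
      have xK: "x \<in> cball a R" "a \<in> cball a R" using dx rR r by (auto simp: dist_commute)
      have sub: "cball y r \<subseteq> cball b R"
        using dx rR by (intro cball_subset_cball_iff[THEN iffD2]) (auto simp: dist_commute)
      have sub': "ball y r \<subseteq> ball b R"
        using dx rR by (intro ball_subset_ball_iff[THEN iffD2]) (auto simp: dist_commute)
      have "norm ((deriv ^^ 1) (\<lambda>t. u (x, t) - u (a, t)) y) \<le> fact 1 * e' / r ^ 1"
      proof (rule Cauchy_inequality[OF _ _ r])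
        show "(\<lambda>t. u (x, t) - u (a, t)) holomorphic_on ball y r"
          by (intro holomorphic_on_diff holomorphic_on_subset[OF holx sub'] xK)
        show "continuous_on (cball y r) (\<lambda>t. u (x, t) - u (a, t))"
          by (intro continuous_on_diff continuous_on_subset[OF contx sub] xK)
        fix t assume "norm (y - t) = r"
        hence "t \<in> cball y r" by (simp add: dist_norm)
        hence "t \<in> cball b R" using sub by blast
        hence "dist (u (x, t)) (u (a, t)) < e'"
          using xK dx by (intro d(2)) (auto simp: K_def dist_Pair_Pair)
        thus "norm (u (x, t) - u (a, t)) \<le> e'" by (simp add: dist_norm)
      qed
      moreover have "y \<in> ball b R" using dx rR r by (auto simp: dist_commute)
      hence "deriv (\<lambda>t. u (x, t) - u (a, t)) y = deriv (\<lambda>t. u (x, t)) y - deriv (\<lambda>t. u (a, t)) y"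
        using xK holx by (intro deriv_diff holomorphic_on_imp_differentiable_at[of _ "ball b R"]) auto
      ultimately have "dist (deriv (\<lambda>t. u (x, t)) y) (deriv (\<lambda>t. u (a, t)) y) \<le> e' / r"
        by (simp add: dist_norm)
      moreover have "e' / r < e / 2" using e r by (simp add: e'_def)
      moreover have "dist (deriv (\<lambda>t. u (a, t)) y) (deriv (\<lambda>t. u (a, t)) b) < e / 2"
        using dx by (intro d') auto
      ultimately have "dist (deriv (\<lambda>t. u (x, t)) y) (deriv (\<lambda>t. u (a, t)) b) < e"
        using dist_triangle[of "deriv (\<lambda>t. u (x, t)) y" "deriv (\<lambda>t. u (a, t)) b" "deriv (\<lambda>t. u (a, t)) y"]
        by linarith
      thus "dist (partial2 u z) (partial2 u z0) < e" by (simp add: partial2_def xy ab)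
    qed
  qed
qed

lemma continuous_partial1:
  assumes "open \<Omega>" "continuous_on \<Omega> u"
    and "\<And>z. z \<in> \<Omega> \<Longrightarrow> (\<lambda>t. u (t, snd z)) field_differentiable at (fst z)"
  shows "continuous_on \<Omega> (partial1 u)"
proof -
  have c: "continuous_on A prod.swap" for A :: "(complex \<times> complex) set"
    unfolding prod.swap_def by (auto intro!: continuous_intros)
  have "continuous_on (prod.swap -` \<Omega>) (partial2 (\<lambda>w. u (prod.swap w)))"
  proof (rule continuous_partial2)
    show "open (prod.swap -` \<Omega>)" using assms by (intro open_swap)
    show "continuous_on (prod.swap -` \<Omega>) (\<lambda>w. u (prod.swap w))"
      by (rule continuous_on_compose2[OF assms(2) c]) auto
  qed (use assms(3) in force)
  hence "continuous_on (prod.swap -` \<Omega>) (\<lambda>z. partial1 u (prod.swap z))"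
    by (simp add: partial2_swap)
  from continuous_on_compose2[OF this c, of \<Omega>] show ?thesis by (force simp: subset_iff)
qed

text \<open>Osgood's lemma; the partial derivatives are continuous by Cauchy's inequality.\<close>

lemma analytic2_onI_separate:
  assumes "open \<Omega>" "continuous_on \<Omega> u"
    and h1: "\<And>z. z \<in> \<Omega> \<Longrightarrow> (\<lambda>t. u (t, snd z)) field_differentiable at (fst z)"
    and h2: "\<And>z. z \<in> \<Omega> \<Longrightarrow> (\<lambda>t. u (fst z, t)) field_differentiable at (snd z)"
  shows "analytic2_on u \<Omega>"
proof (rule analytic2_onI)
  fix z assume z: "z \<in> \<Omega>"
  obtain x y where xy: "z = (x, y)" by fastforce
  from open_bidisc[OF assms(1) z] obtain r where r: "r > 0" "cball x r \<times> cball y r \<subseteq> \<Omega>"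
    by (metis xy fst_conv snd_conv)
  define X Y where "X = ball x r" and "Y = ball y r"
  have XY: "X \<times> Y \<subseteq> \<Omega>" using r by (auto simp: X_def Y_def)
  have mem: "x \<in> X" "y \<in> Y" using r by (auto simp: X_def Y_def)
  have "continuous_on \<Omega> (partial2 u)" using assms(1,2) h2 by (rule continuous_partial2)
  hence c: "isCont (partial2 u) z" using z assms(1) continuous_on_eq_continuous_at by blast
  \<comment> \<open>One partial derivative at the point, and the other one continuous as a bounded
    linear map, suffice for total differentiability; \<open>blinfun_mult_right\<close> reads a
    complex number as such a map.\<close>
  have "((\<lambda>(s, t). u (s, t)) has_derivative
      (\<lambda>(s, t). partial1 u z * s + blinfun_mult_right (partial2 u (x, y)) t)) (at (x, y) within X \<times> Y)"
  proof (rule has_derivative_partialsI)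
    have "((\<lambda>s. u (s, y)) has_field_derivative partial1 u z) (at x)"
      using h1[OF z] by (simp add: partial1_def xy field_differentiable_derivI)
    thus "((\<lambda>s. u (s, y)) has_derivative (\<lambda>s. partial1 u z * s)) (at x within X)"
      by (simp add: has_field_derivative_def has_derivative_at_withinI)
    fix s t assume st: "s \<in> X" "t \<in> Y"
    hence "((\<lambda>t. u (s, t)) has_field_derivative partial2 u (s, t)) (at t)"
      using h2[of "(s, t)"] XY by (auto simp: partial2_def field_differentiable_derivI)
    thus "((\<lambda>t. u (s, t)) has_derivative blinfun_apply (blinfun_mult_right (partial2 u (s, t)))) (at t within Y)"
      by (simp add: has_field_derivative_def has_derivative_at_withinI)
  next
    have "isCont (\<lambda>z. blinfun_mult_right (partial2 u z)) (x, y)"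
      using c unfolding xy by (intro bounded_linear.continuous[OF bounded_linear_blinfun_mult_right])
    thus "continuous (at (x, y) within X \<times> Y) (\<lambda>(s, t). blinfun_mult_right (partial2 u (s, t)))"
      by (simp add: case_prod_unfold continuous_at_imp_continuous_within)
  qed (use mem in \<open>auto simp: Y_def\<close>)
  moreover have "at (x, y) within X \<times> Y = at (x, y)"
    using mem by (intro at_within_open) (auto simp: X_def Y_def intro: open_Times)
  ultimately show "has_partials u (partial1 u z) (partial2 u z) z"
    by (simp add: has_partials_def case_prod_unfold xy)
qed


text \<open>The difference quotients of \<open>u\<close> in the first variable are holomorphic in
  the second and converge uniformly to \<open>partial1 u (a, t)\<close>, so by Weierstrass their
  derivatives converge as well. The limit \<open>D\<close> serves twice: for the differentiability
  of \<open>partial1 u\<close> in the second variable and for the symmetry of the mixed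
  derivatives.\<close>

lemma analytic2_on_mixed_limit:
  assumes "open \<Omega>" "analytic2_on u \<Omega>" and z: "(a, b) \<in> \<Omega>"
  obtains D h where "((\<lambda>t. partial1 u (a, t)) has_field_derivative D) (at b)"
    "\<And>n. h n \<noteq> 0" "h \<longlonglongrightarrow> 0" "(\<lambda>n. (partial2 u (a + h n, b) - partial2 u (a, b)) / h n) \<longlonglongrightarrow> D"
proof -
  from open_bidisc[OF assms(1) z] obtain R where R: "R > 0" "cball a R \<times> cball b R \<subseteq> \<Omega>"
    by (metis fst_conv snd_conv)
  define h :: "nat \<Rightarrow> complex" where "h n = of_real (R / of_nat (Suc n))" for n
  have h0: "h n \<noteq> 0" for n using R unfolding h_def of_real_eq_0_iff by simp
  have nh: "norm (h n) \<le> R" for n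
    using R unfolding h_def norm_of_real by (simp add: field_simps)
  have "(\<lambda>n. R / of_nat (Suc n)) \<longlonglongrightarrow> 0"
    using LIMSEQ_Suc[OF lim_const_over_n] .
  from tendsto_of_real[OF this, where 'a = complex] have hlim: "h \<longlonglongrightarrow> 0"
    by (simp add: h_def[abs_def])
  define K where "K = cball a R \<times> cball b R"
  have hp: "has_partials u (partial1 u w) (partial2 u w) w" if "w \<in> K" for w
    using assms(2) R that by (auto simp: K_def intro: analytic2_onD)
  have ah: "a + h n \<in> cball a R" for n using nh by (simp add: dist_norm)
  define f where "f n t = (u (a + h n, t) - u (a, t)) / h n" for n t
  define f' where "f' n t = (partial2 u (a + h n, t) - partial2 u (a, t)) / h n" for n t
  have "continuous_on \<Omega> (partial1 u)"
    using assms(1) analytic2_on_continuous[OF assms(2)]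
    by (rule continuous_partial1)
      (use has_partials_slice1[OF analytic2_onD[OF assms(2)]] in \<open>auto simp: field_differentiable_def\<close>)
  hence uc: "uniformly_continuous_on K (partial1 u)"
    using R by (intro compact_uniformly_continuous)
      (auto simp: K_def intro: compact_Times continuous_on_subset)
  have ul: "uniform_limit (cball b R) f (\<lambda>t. partial1 u (a, t)) sequentially"
    unfolding uniform_limit_iff
  proof (intro allI impI)
    fix e :: real assume e: "e > 0"
    obtain d where d: "d > 0"
      "\<And>w w'. w \<in> K \<Longrightarrow> w' \<in> K \<Longrightarrow> dist w' w < d \<Longrightarrow> dist (partial1 u w') (partial1 u w) < e / 2"
      using uniformly_continuous_onE[OF uc half_gt_zero[OF e]] by metis
    have "eventually (\<lambda>n. dist (h n) 0 < d) sequentially"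
      using hlim d(1) by (rule tendstoD)
    thus "\<forall>\<^sub>F n in sequentially. \<forall>t\<in>cball b R. dist (f n t) (partial1 u (a, t)) < e"
    proof eventually_elim
      case (elim n)
      show ?case
      proof
        fix t assume t: "t \<in> cball b R"
        \<comment> \<open>Subtracting the linear part makes the derivative in \<open>s\<close>
          uniformly small; the mean value inequality then bounds the error of the difference
          quotient.\<close>
        define g where "g s = u (s, t) - s * partial1 u (a, t)" for s
        have "norm (g (a + h n) - g a) \<le> e / 2 * norm (a + h n - a)"
        proof (rule field_differentiable_bound)
          fix s assume s: "s \<in> cball a (norm (h n))"
          have sK: "(s, t) \<in> K" "(a, t) \<in> K" using s nh[of n] t R by (auto simp: K_def)
          show "(g has_field_derivative (partial1 u (s, t) - partial1 u (a, t))) (at s within cball a (norm (h n)))"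
            unfolding g_def
            using DERIV_diff[OF has_partials_slice1[OF hp[OF sK(1)], simplified] DERIV_cmult_right[OF DERIV_ident, of "partial1 u (a, t)"]]
            by (simp add: has_field_derivative_at_within)
          have "dist (s, t) (a, t) < d"
            using s elim by (simp add: dist_Pair_Pair dist_commute)
          from d(2)[OF sK(2,1) this] show "norm (partial1 u (s, t) - partial1 u (a, t)) \<le> e / 2"
            by (simp add: dist_norm)
        qed (auto simp: dist_norm)
        moreover have "f n t - partial1 u (a, t) = (g (a + h n) - g a) / h n"
          using h0[of n] by (simp add: f_def g_def field_simps)
        hence "norm (f n t - partial1 u (a, t)) = norm (g (a + h n) - g a) / norm (h n)"
          by (simp only: norm_divide)
        ultimately have "norm (f n t - partial1 u (a, t)) \<le> e / 2"
          using h0[of n] by (simp add: pos_divide_le_eq)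
        thus "dist (f n t) (partial1 u (a, t)) < e" using e by (simp add: dist_norm)
      qed
    qed
  qed
  have "\<exists>g'. \<forall>t\<in>ball b R. ((\<lambda>t. partial1 u (a, t)) has_field_derivative g' t) (at t) \<and> (\<lambda>n. f' n t) \<longlonglongrightarrow> g' t"
  proof (rule has_complex_derivative_uniform_sequence[where f = f])
    fix n t assume t: "t \<in> ball b R"
    hence "(a + h n, t) \<in> K" "(a, t) \<in> K" using ah R by (auto simp: K_def)
    from DERIV_cdivide[OF DERIV_diff[OF hp[OF this(1), THEN has_partials_slice2, simplified]
        hp[OF this(2), THEN has_partials_slice2, simplified]], of "h n"]
    show "(f n has_field_derivative f' n t) (at t)"
      by (simp add: f_def[abs_def] f'_def)
  next
    fix t assume "t \<in> ball b R"
    then obtain d where "d > 0" "cball t d \<subseteq> ball b R" using open_contains_cball by (metis open_ball)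
    thus "\<exists>d>0. cball t d \<subseteq> ball b R \<and> uniform_limit (cball t d) f (\<lambda>t. partial1 u (a, t)) sequentially"
      using uniform_limit_on_subset[OF ul] by (meson ball_subset_cball subset_trans)
  qed auto
  then obtain g' where "((\<lambda>t. partial1 u (a, t)) has_field_derivative g' b) (at b)" "(\<lambda>n. f' n b) \<longlonglongrightarrow> g' b"
    using R by (metis centre_in_ball)
  with that h0 hlim show ?thesis unfolding f'_def by blast
qed

lemma analytic2_on_partial1:
  assumes "open \<Omega>" "analytic2_on u \<Omega>"
  shows "analytic2_on (partial1 u) \<Omega>"
proof (rule analytic2_onI_separate)
  show "continuous_on \<Omega> (partial1 u)"
    using assms(1) analytic2_on_continuous[OF assms(2)]
    by (rule continuous_partial1)
      (use has_partials_slice1[OF analytic2_onD[OF assms(2)]] in \<open>auto simp: field_differentiable_def\<close>)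
  fix z assume z: "z \<in> \<Omega>"
  obtain a b where ab: "z = (a, b)" by fastforce
  show "(\<lambda>t. partial1 u (fst z, t)) field_differentiable at (snd z)"
    using analytic2_on_mixed_limit[OF assms z[unfolded ab]]
    by (metis ab field_differentiable_def fst_conv snd_conv)
  from open_bidisc[OF assms(1) z] obtain R where R: "R > 0" "cball a R \<times> cball b R \<subseteq> \<Omega>"
    by (metis ab fst_conv snd_conv)
  have "(\<lambda>t. u (t, b)) holomorphic_on ball a R"
    unfolding holomorphic_on_def
  proof
    fix t assume "t \<in> ball a R"
    hence "(t, b) \<in> \<Omega>" using R by (auto simp: subset_iff)
    from has_partials_slice1[OF analytic2_onD[OF assms(2) this]]
    show "(\<lambda>t. u (t, b)) field_differentiable at t within ball a R"
      by (auto simp: field_differentiable_def intro: DERIV_subset)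
  qed
  from holomorphic_deriv[OF this]
  have "deriv (\<lambda>t. u (t, b)) field_differentiable at a"
    using R by (auto intro: holomorphic_on_imp_differentiable_at)
  thus "(\<lambda>t. partial1 u (t, snd z)) field_differentiable at (fst z)"
    by (simp add: partial1_def ab)
qed (fact assms)

lemma analytic2_on_swap:
  assumes "analytic2_on u \<Omega>"
  shows "analytic2_on (\<lambda>w. u (prod.swap w)) (prod.swap -` \<Omega>)"
  by (rule analytic2_onI, rule has_partials_swap, rule analytic2_onD[OF assms]) auto

lemma analytic2_on_partial2:
  assumes "open \<Omega>" "analytic2_on u \<Omega>"
  shows "analytic2_on (partial2 u) \<Omega>"
  using analytic2_on_swap[OF analytic2_on_partial1[OF open_swap analytic2_on_swap], OF assms]
  by (simp add: partial1_swap vimage_def)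

text \<open>Along the sequence \<open>h\<close> the quotients of \<open>partial2 u\<close> tend to
  \<open>D\<close> by \<open>analytic2_on_mixed_limit\<close> and to the iterated derivative by
  definition.\<close>

lemma partial_commute:
  assumes "open \<Omega>" "analytic2_on u \<Omega>" "z \<in> \<Omega>"
  shows "partial2 (partial1 u) z = partial1 (partial2 u) z"
proof -
  obtain a b where ab: "z = (a, b)" by fastforce
  obtain D h where D: "((\<lambda>t. partial1 u (a, t)) has_field_derivative D) (at b)"
    "\<And>n. h n \<noteq> 0" "h \<longlonglongrightarrow> 0" "(\<lambda>n. (partial2 u (a + h n, b) - partial2 u (a, b)) / h n) \<longlonglongrightarrow> D"
    using analytic2_on_mixed_limit[OF assms[unfolded ab]] by blast
  have "((\<lambda>t. partial2 u (t, b)) has_field_derivative partial1 (partial2 u) z) (at a)"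
    using has_partials_slice1[OF analytic2_onD[OF analytic2_on_partial2[OF assms(1,2)] assms(3)]] by (simp add: ab)
  hence "(\<lambda>k. (partial2 u (a + k, b) - partial2 u (a, b)) / k) \<midarrow>0\<rightarrow> partial1 (partial2 u) z"
    by (simp add: DERIV_def)
  hence "(\<lambda>n. (partial2 u (a + h n, b) - partial2 u (a, b)) / h n) \<longlonglongrightarrow> partial1 (partial2 u) z"
    by (rule filterlim_compose) (use D(2,3) in \<open>simp add: filterlim_at\<close>)
  hence "D = partial1 (partial2 u) z" using D(4) LIMSEQ_unique by blast
  thus ?thesis using D(1) by (simp add: partial2_def[of "partial1 u"] ab DERIV_imp_deriv)
qed

subsection \<open>Flat linear systems\<close>

lemma analytic2_on_slice1_holomorphic:
  assumes "analytic2_on u \<Omega>" "\<And>t. t \<in> S \<Longrightarrow> (t, y) \<in> \<Omega>"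
  shows "(\<lambda>t. u (t, y)) holomorphic_on S"
  unfolding holomorphic_on_def field_differentiable_def
  using has_partials_slice1[OF analytic2_onD[OF assms(1) assms(2)]] has_field_derivative_at_within
  by (metis fst_conv snd_conv)

lemma analytic2_on_slice2_holomorphic:
  assumes "analytic2_on u \<Omega>" "\<And>t. t \<in> S \<Longrightarrow> (x, t) \<in> \<Omega>"
  shows "(\<lambda>t. u (x, t)) holomorphic_on S"
  unfolding holomorphic_on_def field_differentiable_def
  using has_partials_slice2[OF analytic2_onD[OF assms(1) assms(2)]] has_field_derivative_at_within
  by (metis fst_conv snd_conv)

text \<open>The primitive in the first variable that vanishes at \<open>fst z = a\<close>.
  Parametrising the segment over the fixed interval makes the dependence on both coordinates that of
  a parameter integral.\<close>

definition prim :: "complex \<Rightarrow> (complex \<times> complex \<Rightarrow> complex) \<Rightarrow> complex \<times> complex \<Rightarrow> complex" where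
  "prim a f z = integral (cbox 0 1) (\<lambda>t::real. f (linepath a (fst z) t, snd z) * (fst z - a))"

text \<open>Regularity is obtained separately: in the first variable the integral is a difference of
  values of a holomorphic primitive on the disc, in the second it may be differentiated under the
  integral sign. With joint continuity this gives analyticity.\<close>

lemma prim:
  fixes f :: "complex \<times> complex \<Rightarrow> complex" and a b :: complex and R :: real
  defines "D \<equiv> ball a R \<times> ball b R"
  assumes f: "analytic2_on f D"
  shows "analytic2_on (prim a f) D" "\<And>z. z \<in> D \<Longrightarrow> partial1 (prim a f) z = f z"
    "prim a f (a, y) = 0"
proof -
  have op: "open D" by (auto simp: D_def intro: open_Times)
  have lp: "linepath a x t \<in> ball a R" if "x \<in> ball a R" "t \<in> {0..1}" for x t
  proof -
    have "closed_segment a x \<subseteq> ball a R"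
      using that by (intro closed_segment_subset) (auto intro: le_less_trans[OF zero_le_dist])
    thus ?thesis using that(2) linepath_in_path by blast
  qed
  have clp: "continuous_on S (\<lambda>w. (linepath a (g w) (h w), k w))"
    if "continuous_on S g" "continuous_on S h" "continuous_on S k" for S :: "'z::topological_space set" and g h k
    using that unfolding linepath_def by (auto intro!: continuous_intros)
  have contf: "continuous_on D f" using f by (rule analytic2_on_continuous)
  have cont2: "continuous_on D (partial2 f)"
    by (rule analytic2_on_continuous[OF analytic2_on_partial2[OF op f]])
  have slice1: "((\<lambda>x. prim a f (x, snd z)) has_field_derivative f z) (at (fst z))" if z: "z \<in> D" for z
  proof -
    obtain x0 y where xy: "z = (x0, y)" by fastforce
    have y: "y \<in> ball b R" and x0: "x0 \<in> ball a R" using z xy by (auto simp: D_def)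
    hence aa: "a \<in> ball a R" by (auto intro: le_less_trans[OF zero_le_dist])
    have "(\<lambda>s. f (s, y)) holomorphic_on ball a R"
      by (rule analytic2_on_slice1_holomorphic[OF f]) (use y in \<open>auto simp: D_def\<close>)
    then obtain g where g: "\<And>x. x \<in> ball a R \<Longrightarrow> (g has_field_derivative f (x, y)) (at x within ball a R)"
      using holomorphic_convex_primitive'[of "ball a R" "\<lambda>s. f (s, y)"] by auto
    have eq: "prim a f (x, y) = g x - g a" if x: "x \<in> ball a R" for x
    proof -
      have "((\<lambda>s. f (s, y)) has_contour_integral (g (pathfinish (linepath a x)) - g (pathstart (linepath a x)))) (linepath a x)"
        using lp[OF x] by (intro contour_integral_primitive[OF g]) (auto simp: path_image_def)
      hence "((\<lambda>t. f (linepath a x t, y) * (x - a)) has_integral (g x - g a)) {0..1}"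
        by (simp add: has_contour_integral_linepath)
      thus ?thesis unfolding prim_def fst_conv snd_conv box_real(2) by (rule integral_unique)
    qed
    have "(g has_field_derivative f (x0, y)) (at x0)"
      using g[OF x0] at_within_open[OF x0 open_ball] by simp
    hence "((\<lambda>x. g x - g a) has_field_derivative f (x0, y)) (at x0)"
      by (auto intro!: derivative_eq_intros)
    hence "((\<lambda>x. prim a f (x, y)) has_field_derivative f (x0, y)) (at x0)"
      by (rule has_field_derivative_transform_within_open[OF _ open_ball x0]) (simp add: eq)
    thus ?thesis by (simp add: xy)
  qed
  have slice2: "(\<lambda>y. prim a f (fst z, y)) field_differentiable at (snd z)" if z: "z \<in> D" for z
  proof -
    obtain x y0 where xy: "z = (x, y0)" by fastforce
    have x: "x \<in> ball a R" and y0: "y0 \<in> ball b R" using z xy by (auto simp: D_def)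
    have "(\<lambda>y. integral (cbox 0 1) (\<lambda>t::real. f (linepath a x t, y) * (x - a))) holomorphic_on ball b R"
    proof (rule leibniz_rule_holomorphic)
      fix y :: complex and t :: real assume yt: "y \<in> ball b R" "t \<in> cbox 0 1"
      hence "(linepath a x t, y) \<in> D" using lp[OF x] by (auto simp: D_def)
      from has_field_derivative_at_within[OF DERIV_cmult_right[OF has_partials_slice2[OF analytic2_onD[OF f this]]]]
      show "((\<lambda>y. f (linepath a x t, y) * (x - a)) has_field_derivative partial2 f (linepath a x t, y) * (x - a)) (at y within ball b R)"
        by simp
    next
      fix y assume y: "y \<in> ball b R"
      show "(\<lambda>t. f (linepath a x t, y) * (x - a)) integrable_on cbox 0 1"
        using lp[OF x] y
        by (intro integrable_continuous continuous_intros continuous_on_compose2[OF contf clp])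
          (auto simp: D_def)
    next
      show "continuous_on (ball b R \<times> cbox 0 1) (\<lambda>(y, t). partial2 f (linepath a x t, y) * (x - a))"
        using lp[OF x] unfolding case_prod_unfold
        by (intro continuous_intros continuous_on_compose2[OF cont2 clp]) (auto simp: D_def)
    qed auto
    thus ?thesis using y0 xy by (auto simp: prim_def[abs_def] intro: holomorphic_on_imp_differentiable_at)
  qed
  have cont: "continuous_on D (prim a f)"
    unfolding prim_def[abs_def]
  proof (rule integral_continuous_on_param)
    show "continuous_on (D \<times> cbox 0 1) (\<lambda>(z, t). f (linepath a (fst z) t, snd z) * (fst z - a))"
      using lp unfolding case_prod_unfold
      by (intro continuous_intros continuous_on_compose2[OF contf clp]) (auto simp: D_def)
  qed
  show an: "analytic2_on (prim a f) D"
    by (rule analytic2_onI_separate[OF op cont])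
      (use slice1 slice2 in \<open>auto simp: field_differentiable_def\<close>)
  show "partial1 (prim a f) z = f z" if "z \<in> D" for z
    using slice1[OF that] by (simp add: partial1_def DERIV_imp_deriv)
  show "prim a f (a, y) = 0" by (simp add: prim_def)
qed

lemma partial1_growth:
  assumes G: "analytic2_on G (ball a R \<times> ball b R)"
    and B: "\<And>z. z \<in> ball a R \<times> ball b R \<Longrightarrow> norm (partial1 G z) \<le> B"
    and z: "z \<in> ball a R \<times> ball b R" and 0: "G (a, snd z) = 0"
  shows "norm (G z) \<le> B * R"
proof -
  obtain x y where xy: "z = (x, y)" by fastforce
  have x: "x \<in> ball a R" and y: "y \<in> ball b R" using z xy by auto
  hence aa: "a \<in> ball a R" by (auto intro: le_less_trans[OF zero_le_dist])
  have B0: "B \<ge> 0" using B[OF z] norm_ge_zero order_trans by blast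
  have "norm (G (x, y) - G (a, y)) \<le> B * norm (x - a)"
  proof (rule field_differentiable_bound)
    fix t assume "t \<in> ball a R"
    hence t: "(t, y) \<in> ball a R \<times> ball b R" using y by auto
    show "((\<lambda>t. G (t, y)) has_field_derivative partial1 G (t, y)) (at t within ball a R)"
      using has_partials_slice1[OF analytic2_onD[OF G t]] by (simp add: has_field_derivative_at_within)
    show "norm (partial1 G (t, y)) \<le> B" using B[OF t] .
  qed (use x aa in auto)
  also have "\<dots> \<le> B * R" using x B0 by (intro mult_left_mono) (auto simp: dist_norm norm_minus_commute)
  finally show ?thesis using 0 xy by simp
qed

lemma analytic2_on_uniform_limit:
  assumes op: "open \<Omega>" and S: "\<And>n. analytic2_on (S n) \<Omega>"
    and ul: "uniform_limit \<Omega> S \<Phi> sequentially"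
  shows "analytic2_on \<Phi> \<Omega>"
proof (rule analytic2_onI_separate[OF op])
  show "continuous_on \<Omega> \<Phi>"
    by (rule uniform_limit_theorem[OF _ ul]) (auto intro!: always_eventually analytic2_on_continuous S)
  fix z assume z: "z \<in> \<Omega>"
  obtain a b where ab: "z = (a, b)" by fastforce
  from open_bidisc[OF op z] obtain r where r: "r > 0" "cball a r \<times> cball b r \<subseteq> \<Omega>"
    by (metis ab fst_conv snd_conv)
  have sub: "(t, b) \<in> \<Omega>" if "t \<in> ball a r" for t using that r by (auto simp: subset_iff)
  have sub': "(a, t) \<in> \<Omega>" if "t \<in> ball b r" for t using that r by (auto simp: subset_iff)
  have "(\<lambda>t. \<Phi> (t, b)) holomorphic_on ball a r"
  proof (rule holomorphic_uniform_sequence[of _ "\<lambda>n t. S n (t, b)"])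
    fix n
    show "(\<lambda>t. S n (t, b)) holomorphic_on ball a r"
      by (rule analytic2_on_slice1_holomorphic[OF S sub])
  next
    fix t assume t: "t \<in> ball a r"
    then obtain d where d: "d > 0" "cball t d \<subseteq> ball a r" using open_contains_cball by (metis open_ball)
    have "uniform_limit (cball t d) (\<lambda>n t. S n (t, b)) (\<lambda>t. \<Phi> (t, b)) sequentially"
      using d(2) sub by (intro uniform_limit_compose'[OF ul]) auto
    thus "\<exists>d>0. cball t d \<subseteq> ball a r \<and> uniform_limit (cball t d) (\<lambda>n t. S n (t, b)) (\<lambda>t. \<Phi> (t, b)) sequentially"
      using d by blast
  qed auto
  thus "(\<lambda>t. \<Phi> (t, snd z)) field_differentiable at (fst z)"
    using r ab by (auto intro: holomorphic_on_imp_differentiable_at)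
  have "(\<lambda>t. \<Phi> (a, t)) holomorphic_on ball b r"
  proof (rule holomorphic_uniform_sequence[of _ "\<lambda>n t. S n (a, t)"])
    fix n
    show "(\<lambda>t. S n (a, t)) holomorphic_on ball b r"
      by (rule analytic2_on_slice2_holomorphic[OF S sub'])
  next
    fix t assume t: "t \<in> ball b r"
    then obtain d where d: "d > 0" "cball t d \<subseteq> ball b r" using open_contains_cball by (metis open_ball)
    have "uniform_limit (cball t d) (\<lambda>n t. S n (a, t)) (\<lambda>t. \<Phi> (a, t)) sequentially"
      using d(2) sub' by (intro uniform_limit_compose'[OF ul]) auto
    thus "\<exists>d>0. cball t d \<subseteq> ball b r \<and> uniform_limit (cball t d) (\<lambda>n t. S n (a, t)) (\<lambda>t. \<Phi> (a, t)) sequentially"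
      using d by blast
  qed auto
  thus "(\<lambda>t. \<Phi> (fst z, t)) field_differentiable at (snd z)"
    using r ab by (auto intro: holomorphic_on_imp_differentiable_at)
qed

section \<open>Picard iteration for two unknown functions, indexed by \<open>bool\<close>\<close>

definition picard ::
  "complex \<Rightarrow> (bool \<Rightarrow> bool \<Rightarrow> complex \<times> complex \<Rightarrow> complex) \<Rightarrow> (bool \<Rightarrow> complex \<times> complex \<Rightarrow> complex) \<Rightarrow>
    (bool \<Rightarrow> complex \<times> complex \<Rightarrow> complex) \<Rightarrow> bool \<Rightarrow> complex \<times> complex \<Rightarrow> complex" where
  "picard a A g \<Phi> i z = g i z + prim a (\<lambda>w. \<Sum>j\<in>UNIV. A i j w * \<Phi> j w) z"

lemma analytic2_on_add:
  "analytic2_on u \<Omega> \<Longrightarrow> analytic2_on v \<Omega> \<Longrightarrow> analytic2_on (\<lambda>z. u z + v z) \<Omega>"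
  by (rule analytic2_onI, rule has_partials_add) (auto dest: analytic2_onD)

lemma analytic2_on_diff:
  "analytic2_on u \<Omega> \<Longrightarrow> analytic2_on v \<Omega> \<Longrightarrow> analytic2_on (\<lambda>z. u z - v z) \<Omega>"
  by (rule analytic2_onI, rule has_partials_diff) (auto dest: analytic2_onD)

lemma analytic2_on_mult:
  "analytic2_on u \<Omega> \<Longrightarrow> analytic2_on v \<Omega> \<Longrightarrow> analytic2_on (\<lambda>z. u z * v z) \<Omega>"
  by (rule analytic2_onI, rule has_partials_mult) (auto dest: analytic2_onD)

lemma analytic2_on_sum:
  "(\<And>i. i \<in> I \<Longrightarrow> analytic2_on (u i) \<Omega>) \<Longrightarrow> analytic2_on (\<lambda>z. \<Sum>i\<in>I. u i z) \<Omega>"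
  by (rule analytic2_onI, rule has_partials_sum, rule analytic2_onD)

lemma analytic2_on_const: "analytic2_on (\<lambda>_. c) \<Omega>"
  by (rule analytic2_onI, rule has_partials_const)

lemma linear_bound:
  fixes x y :: "bool \<Rightarrow> complex"
  assumes "\<And>j. norm (x j) \<le> M" "\<And>j. norm (y j) \<le> C"
  shows "norm (\<Sum>j\<in>UNIV. x j * y j) \<le> 2 * M * C"
proof -
  have M: "0 \<le> M" using norm_ge_zero assms(1) by (rule order_trans)
  have "norm (\<Sum>j\<in>UNIV. x j * y j) \<le> (\<Sum>j\<in>(UNIV::bool set). M * C)"
    using M by (intro sum_norm_le) (auto simp: norm_mult intro!: mult_mono assms)
  thus ?thesis by (simp add: UNIV_bool)
qed

context
  fixes a b :: complex and R M :: real and A :: "bool \<Rightarrow> bool \<Rightarrow> complex \<times> complex \<Rightarrow> complex"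
    and D :: "(complex \<times> complex) set"
  assumes D: "D = ball a R \<times> ball b R" and R: "R > 0"
    and A: "\<And>i j. analytic2_on (A i j) D" and M: "\<And>i j z. z \<in> D \<Longrightarrow> norm (A i j z) \<le> M"
    and RM: "4 * M * R \<le> 1"
begin

text \<open>The smallness condition on \<open>R\<close> accounts for two unknowns, a coefficient
  bound \<open>M\<close> and one integration over length at most \<open>R\<close>, and leaves the
  contraction factor \<open>1 / 2\<close>.\<close>

lemma half_bound:
  assumes "C \<ge> 0"
  shows "2 * M * C * R \<le> C / 2"
  using mult_left_mono[OF RM assms] by (simp add: mult_ac)

text \<open>Only the equation in the first variable is solved; the second variable is a parameter
  and enters through the initial data \<open>g\<close>, which do not depend on the first. The
  iterates converge geometrically in the sup norm on \<open>D\<close>.\<close>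

lemma linear_system_exists:
  assumes g: "\<And>i. analytic2_on (g i) D" and gC: "\<And>i z. z \<in> D \<Longrightarrow> norm (g i z) \<le> C"
    and g1: "\<And>i z. z \<in> D \<Longrightarrow> partial1 (g i) z = 0"
  obtains \<Phi> where "\<And>i. analytic2_on (\<Phi> i) D"
    "\<And>i z. z \<in> D \<Longrightarrow> partial1 (\<Phi> i) z = (\<Sum>j\<in>UNIV. A i j z * \<Phi> j z)"
    "\<And>i y. y \<in> ball b R \<Longrightarrow> \<Phi> i (a, y) = g i (a, y)"
proof -
  have op: "open D" by (simp add: D open_Times)
  have "(a, b) \<in> D" using R by (simp add: D)
  hence C: "C \<ge> 0" using gC norm_ge_zero order_trans by blast
  have AS: "analytic2_on (\<lambda>w. \<Sum>j\<in>UNIV. A i j w * \<Phi> j w) D" if "\<And>j. analytic2_on (\<Phi> j) D" for \<Phi> i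
    by (intro analytic2_on_sum analytic2_on_mult A that)
  have pic: "analytic2_on (picard a A g \<Phi> i) D"
    "\<And>z. z \<in> D \<Longrightarrow> partial1 (picard a A g \<Phi> i) z = (\<Sum>j\<in>UNIV. A i j z * \<Phi> j z)"
    "picard a A g \<Phi> i (a, y) = g i (a, y)"
    if \<Phi>: "\<And>j. analytic2_on (\<Phi> j) D" for \<Phi> i y
  proof -
    note p = prim[OF AS[OF \<Phi>, unfolded D]]
    show an: "analytic2_on (picard a A g \<Phi> i) D"
      unfolding picard_def[abs_def] using p(1) by (intro analytic2_on_add g) (simp add: D)
    show "partial1 (picard a A g \<Phi> i) z = (\<Sum>j\<in>UNIV. A i j z * \<Phi> j z)" if z: "z \<in> D" for z
    proof -
      have "has_partials (picard a A g \<Phi> i)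
         (partial1 (g i) z + partial1 (prim a (\<lambda>w. \<Sum>j\<in>UNIV. A i j w * \<Phi> j w)) z)
         (partial2 (g i) z + partial2 (prim a (\<lambda>w. \<Sum>j\<in>UNIV. A i j w * \<Phi> j w)) z) z"
        unfolding picard_def[abs_def] using p(1) z
        by (intro has_partials_add analytic2_onD[OF g] analytic2_onD[of _ D]) (auto simp: D)
      from has_partials_unique(1)[OF this] show ?thesis using p(2) z g1 by (simp add: D)
    qed
    show "picard a A g \<Phi> i (a, y) = g i (a, y)" using p(3) by (simp add: picard_def)
  qed
  have contr: "norm (picard a A g \<Phi> i z - picard a A g \<Psi> i z) \<le> B / 2"
    if an: "\<And>j. analytic2_on (\<Phi> j) D" "\<And>j. analytic2_on (\<Psi> j) D"
      and B: "\<And>j z. z \<in> D \<Longrightarrow> norm (\<Phi> j z - \<Psi> j z) \<le> B" and z: "z \<in> D" for \<Phi> \<Psi> B i z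
  proof -
    have B0: "B \<ge> 0" using B[OF z] norm_ge_zero order_trans by blast
    have "norm (picard a A g \<Phi> i z - picard a A g \<Psi> i z) \<le> (2 * M * B) * R"
    proof (rule partial1_growth[of "\<lambda>z. picard a A g \<Phi> i z - picard a A g \<Psi> i z" a R b])
      show "analytic2_on (\<lambda>z. picard a A g \<Phi> i z - picard a A g \<Psi> i z) (ball a R \<times> ball b R)"
        using an by (intro analytic2_on_diff pic(1)[unfolded D]) (auto simp: D)
      fix w assume "w \<in> ball a R \<times> ball b R"
      hence w: "w \<in> D" by (simp add: D)
      have "partial1 (\<lambda>z. picard a A g \<Phi> i z - picard a A g \<Psi> i z) w
        = (\<Sum>j\<in>UNIV. A i j w * \<Phi> j w) - (\<Sum>j\<in>UNIV. A i j w * \<Psi> j w)"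
        using has_partials_unique(1)[OF has_partials_diff[OF analytic2_onD[OF pic(1)[OF an(1)] w]
            analytic2_onD[OF pic(1)[OF an(2)] w]]] pic(2)[OF an(1) w] pic(2)[OF an(2) w] by simp
      also have "\<dots> = (\<Sum>j\<in>UNIV. A i j w * (\<Phi> j w - \<Psi> j w))"
        by (simp add: sum_subtractf right_diff_distrib)
      finally show "norm (partial1 (\<lambda>z. picard a A g \<Phi> i z - picard a A g \<Psi> i z) w) \<le> 2 * M * B"
        using linear_bound[of "\<lambda>j. A i j w" M "\<lambda>j. \<Phi> j w - \<Psi> j w" B] M[OF w] B[OF w] by simp
    qed (use z pic(3)[OF an(1)] pic(3)[OF an(2)] in \<open>auto simp: D\<close>)
    with half_bound[OF B0] show ?thesis by simp
  qed
  define S where "S n = (picard a A g ^^ n) g" for n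
  have S0: "S 0 = g" and SS: "S (Suc n) = picard a A g (S n)" for n by (simp_all add: S_def)
  have San: "analytic2_on (S n j) D" for n j
    by (induction n arbitrary: j) (auto simp: S0 SS g intro: pic(1))
  have step: "norm (S (Suc n) j z - S n j z) \<le> 2 * C * (1 / 2) ^ n" if "z \<in> D" for n j z
    using that
  proof (induction n arbitrary: j z)
    case 0
    \<comment> \<open>\<open>g\<close> is itself the Picard image of zero, so the first step is an
      instance of the contraction estimate as well.\<close>
    have "norm (picard a A g g j z - picard a A g (\<lambda>_ _. 0) j z) \<le> C / 2"
      by (rule contr) (use g gC 0 in \<open>auto intro: analytic2_on_const\<close>)
    moreover have "picard a A g (\<lambda>_ _. 0) j z = g j z" by (simp add: picard_def prim_def)
    ultimately show ?case using C by (simp add: SS S0)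
  next
    case (Suc n)
    have "norm (picard a A g (S (Suc n)) j z - picard a A g (S n) j z) \<le> 2 * C * (1 / 2) ^ n / 2"
      by (rule contr) (use San Suc in auto)
    thus ?case by (simp add: SS)
  qed
  define \<Phi> where "\<Phi> j z = g j z + suminf (\<lambda>k. S (Suc k) j z - S k j z)" for j z
  have ul: "uniform_limit D (\<lambda>n. S n j) (\<Phi> j) sequentially" for j
  proof -
    have "uniform_limit D (\<lambda>n z. \<Sum>k<n. S (Suc k) j z - S k j z) (\<lambda>z. suminf (\<lambda>k. S (Suc k) j z - S k j z)) sequentially"
      by (rule Weierstrass_m_test[of _ _ "\<lambda>n. 2 * C * (1 / 2) ^ n"])
        (auto intro!: step summable_mult summable_geometric)
    hence "uniform_limit D (\<lambda>n z. S n j z - S 0 j z) (\<lambda>z. suminf (\<lambda>k. S (Suc k) j z - S k j z)) sequentially"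
      by (simp only: sum_lessThan_telescope[of "\<lambda>k. S k j z" for z])
    hence "uniform_limit D (\<lambda>n z. g j z + (S n j z - S 0 j z)) (\<Phi> j) sequentially"
      unfolding \<Phi>_def[abs_def] by (intro uniform_limit_intros)
    thus ?thesis by (simp add: S0)
  qed
  have \<Phi>an: "analytic2_on (\<Phi> j) D" for j by (rule analytic2_on_uniform_limit[OF op San ul])
  have fixp: "\<Phi> i z = picard a A g \<Phi> i z" if z: "z \<in> D" for i z
  proof -
    have "(\<lambda>n. S (Suc n) i z) \<longlonglongrightarrow> \<Phi> i z"
      using tendsto_uniform_limitI[OF ul z] LIMSEQ_Suc by blast
    moreover have "(\<lambda>n. S (Suc n) i z) \<longlonglongrightarrow> picard a A g \<Phi> i z"
      unfolding tendsto_iff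
    proof (intro allI impI)
      fix e :: real assume e: "e > 0"
      have "\<forall>\<^sub>F n in sequentially. \<forall>j. \<forall>w\<in>D. dist (S n j w) (\<Phi> j w) < e"
        using ul[unfolded uniform_limit_iff] e by (intro eventually_all_finite) auto
      thus "\<forall>\<^sub>F n in sequentially. dist (S (Suc n) i z) (picard a A g \<Phi> i z) < e"
      proof eventually_elim
        case (elim n)
        have "norm (picard a A g (S n) i z - picard a A g \<Phi> i z) \<le> e / 2"
          by (rule contr) (use San \<Phi>an elim z in \<open>auto simp: dist_norm less_imp_le\<close>)
        thus ?case using e by (simp add: SS dist_norm)
      qed
    qed
    ultimately show ?thesis by (rule LIMSEQ_unique)
  qed
  show ?thesis
  proof
    show "analytic2_on (\<Phi> i) D" for i by (rule \<Phi>an)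
    show "partial1 (\<Phi> i) z = (\<Sum>j\<in>UNIV. A i j z * \<Phi> j z)" if z: "z \<in> D" for i z
    proof -
      have "has_partials (\<Phi> i) (partial1 (picard a A g \<Phi> i) z) (partial2 (picard a A g \<Phi> i) z) z"
        by (rule has_partials_transform[OF analytic2_onD[OF pic(1)[OF \<Phi>an] z] op z]) (rule fixp[symmetric])
      from has_partials_unique(1)[OF this] show ?thesis using pic(2)[OF \<Phi>an z] by simp
    qed
    show "\<Phi> i (a, y) = g i (a, y)" if "y \<in> ball b R" for i y
      using fixp[of "(a, y)"] pic(3)[OF \<Phi>an] that R by (simp add: D)
  qed
qed

text \<open>At a maximum \<open>B\<close> of the sum of the norms over the closed disc through
  \<open>x\<close>, each component is at most \<open>B / 4\<close> by the mean value inequality from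
  the centre, where it vanishes. Hence \<open>B \<le> B / 2\<close>.\<close>

lemma linear_system_unique:
  assumes G: "\<And>i. analytic2_on (G i) D"
    and G1: "\<And>i z. z \<in> D \<Longrightarrow> partial1 (G i) z = (\<Sum>j\<in>UNIV. A i j z * G j z)"
    and G0: "\<And>i y. y \<in> ball b R \<Longrightarrow> G i (a, y) = 0"
    and z: "z \<in> D"
  shows "G i z = 0"
proof -
  obtain x y where xy: "z = (x, y)" by fastforce
  have x: "x \<in> ball a R" and y: "y \<in> ball b R" using z xy by (auto simp: D)
  define K where "K = cball a (dist a x)"
  have KD: "(s, y) \<in> D" if "s \<in> K" for s using that x y by (auto simp: D K_def)
  have aK: "a \<in> K" and xK: "x \<in> K" by (auto simp: K_def)
  have M0: "M \<ge> 0" using M[OF z, of i i] norm_ge_zero order_trans by blast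
  define \<phi> where "\<phi> s = (\<Sum>j\<in>UNIV. norm (G j (s, y)))" for s
  have "continuous_on K (\<lambda>s. G j (s, y))" for j
    by (rule holomorphic_on_imp_continuous_on, rule analytic2_on_slice1_holomorphic[OF G KD])
  hence "continuous_on K \<phi>" unfolding \<phi>_def by (intro continuous_intros)
  then obtain s0 where s0: "s0 \<in> K" "\<And>s. s \<in> K \<Longrightarrow> \<phi> s \<le> \<phi> s0"
    using continuous_attains_sup[of K \<phi>] aK by (metis K_def compact_cball empty_iff)
  define B where "B = \<phi> s0"
  have B0: "B \<ge> 0" by (simp add: B_def \<phi>_def sum_nonneg)
  have "norm (G j (s0, y)) \<le> B / 4" for j
  proof -
    have "norm (G j (s0, y) - G j (a, y)) \<le> M * B * norm (s0 - a)"
    proof (rule field_differentiable_bound)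
      fix s assume s: "s \<in> K"
      show "((\<lambda>s. G j (s, y)) has_field_derivative (\<Sum>k\<in>UNIV. A j k (s, y) * G k (s, y))) (at s within K)"
        using has_partials_slice1[OF analytic2_onD[OF G KD[OF s]]] G1[OF KD[OF s]]
        by (simp add: has_field_derivative_at_within)
      have "norm (\<Sum>k\<in>UNIV. A j k (s, y) * G k (s, y)) \<le> (\<Sum>k\<in>UNIV. M * norm (G k (s, y)))"
        by (rule sum_norm_le) (auto simp: norm_mult intro!: mult_right_mono M KD s)
      also have "\<dots> = M * \<phi> s" by (simp add: \<phi>_def sum_distrib_left)
      also have "\<dots> \<le> M * B" using s0(2)[OF s] M0 by (simp add: B_def mult_left_mono)
      finally show "norm (\<Sum>k\<in>UNIV. A j k (s, y) * G k (s, y)) \<le> M * B" .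
    qed (use s0 aK in \<open>auto simp: K_def\<close>)
    also have "\<dots> \<le> M * B * R"
      using s0 x M0 B0 by (intro mult_left_mono) (auto simp: K_def dist_norm norm_minus_commute)
    also have "\<dots> \<le> B / 4" using half_bound[OF B0] by simp
    finally show ?thesis using G0[OF y] by simp
  qed
  from add_mono[OF this[of False] this[of True]]
  have "\<phi> s0 \<le> B / 4 + B / 4" unfolding \<phi>_def UNIV_bool by simp
  hence "B \<le> 0" by (simp add: B_def[symmetric])
  hence "\<phi> x \<le> 0" using s0(2)[OF xK] by (simp add: B_def)
  moreover have "norm (G i (x, y)) \<le> \<phi> x"
    unfolding \<phi>_def by (rule member_le_sum) auto
  ultimately have "norm (G i (x, y)) \<le> 0" by linarith
  thus ?thesis by (simp add: xy)
qed

end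


text \<open>The system is solved in the second variable along \<open>fst z = a\<close>, and then in
  the first variable with these values as initial data. Flatness makes the defect of the second
  equation a solution of the first one; it vanishes on \<open>fst z = a\<close>, so it is zero by
  uniqueness.\<close>

lemma flat_linear_system:
  fixes A1 A2 :: "bool \<Rightarrow> bool \<Rightarrow> complex \<times> complex \<Rightarrow> complex"
  assumes op: "open \<Omega>" and p: "(a, b) \<in> \<Omega>"
    and A1: "\<And>i j. analytic2_on (A1 i j) \<Omega>" and A2: "\<And>i j. analytic2_on (A2 i j) \<Omega>"
    and flat: "\<And>i k z. z \<in> \<Omega> \<Longrightarrow> partial2 (A1 i k) z + (\<Sum>j\<in>UNIV. A1 i j z * A2 j k z) =
      partial1 (A2 i k) z + (\<Sum>j\<in>UNIV. A2 i j z * A1 j k z)"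
  obtains r \<Phi> where "r > 0" "ball a r \<times> ball b r \<subseteq> \<Omega>"
    "\<And>i. analytic2_on (\<Phi> i) (ball a r \<times> ball b r)"
    "\<And>i z. z \<in> ball a r \<times> ball b r \<Longrightarrow> partial1 (\<Phi> i) z = (\<Sum>j\<in>UNIV. A1 i j z * \<Phi> j z)"
    "\<And>i z. z \<in> ball a r \<times> ball b r \<Longrightarrow> partial2 (\<Phi> i) z = (\<Sum>j\<in>UNIV. A2 i j z * \<Phi> j z)"
    "\<And>i. \<Phi> i (a, b) = v i"
proof -
  from open_bidisc[OF op p] obtain R0 where R0: "R0 > 0" "cball a R0 \<times> cball b R0 \<subseteq> \<Omega>"
    by (metis fst_conv snd_conv)
  define K where "K = cball a R0 \<times> cball b R0"
  have K: "compact K" "K \<noteq> {}" "K \<subseteq> \<Omega>" using R0 by (auto simp: K_def compact_Times)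
  have cont: "continuous_on K (A1 i j)" "continuous_on K (A2 i j)" for i j
    by (rule analytic2_on_continuous, rule analytic2_on_subset[OF _ K(3)], rule A1 A2)+
  define N where "N z = (\<Sum>i\<in>UNIV. \<Sum>j\<in>UNIV. norm (A1 i j z) + norm (A2 i j z))" for z
  have "continuous_on K N" unfolding N_def by (intro continuous_intros cont)
  then obtain z0 where z0: "\<And>z. z \<in> K \<Longrightarrow> N z \<le> N z0"
    using continuous_attains_sup[OF K(1,2)] by metis
  define M where "M = N z0"
  have "norm (A1 i j z) + norm (A2 i j z) \<le> N z" for i j z
    unfolding N_def UNIV_bool by (cases i; cases j) (simp_all add: add_increasing add_increasing2)
  hence N': "norm (A1 i j z) + norm (A2 i j z) \<le> M" if "z \<in> K" for i j z
    using z0[OF that] order_trans unfolding M_def by blast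
  have M1: "norm (A1 i j z) \<le> M" and M2: "norm (A2 i j z) \<le> M" if "z \<in> K" for i j z
    using N'[OF that, of i j] norm_ge_zero[of "A1 i j z"] norm_ge_zero[of "A2 i j z"] by linarith+
  have M0: "M \<ge> 0" unfolding M_def N_def by (intro sum_nonneg add_nonneg_nonneg) auto
  define R where "R = min R0 (1 / (4 * M + 1))"
  have R: "R > 0" "R \<le> R0" using R0 M0 by (auto simp: R_def)
  have "4 * M * R \<le> 4 * M * (1 / (4 * M + 1))" using M0 by (intro mult_left_mono) (auto simp: R_def)
  also have "\<dots> \<le> 1" using M0 by (simp add: field_simps)
  finally have RM: "4 * M * R \<le> 1" .
  have aK: "(a, y) \<in> K" if "y \<in> ball b R" for y using that R R0 by (auto simp: K_def)
  \<comment> \<open>The coordinates are exchanged so that the same existence result serves: the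
    first one of the auxiliary system is x2, the second one is a dummy on which the coefficients do
    not depend.\<close>
  define A' where "A' i j z = A2 i j (a, fst z)" for i j and z :: "complex \<times> complex"
  obtain \<phi> where \<phi>: "\<And>i. analytic2_on (\<phi> i) (ball b R \<times> ball a R)"
    "\<And>i z. z \<in> ball b R \<times> ball a R \<Longrightarrow> partial1 (\<phi> i) z = (\<Sum>j\<in>UNIV. A' i j z * \<phi> j z)"
    "\<And>i x. x \<in> ball a R \<Longrightarrow> \<phi> i (b, x) = v i"
  proof (rule linear_system_exists[OF refl R(1) _ _ RM,
        where a = b and b = a and A = A' and g = "\<lambda>i _. v i" and C = "norm (v True) + norm (v False)"])
    show "analytic2_on (A' i j) (ball b R \<times> ball a R)" for i j
    proof (rule analytic2_onI)
      fix z assume z: "z \<in> ball b R \<times> ball a R"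
      hence "(a, fst z) \<in> \<Omega>" using aK[of "fst z"] K(3) by auto
      from has_partials_compose[OF has_partials_fst has_partials_slice2[OF analytic2_onD[OF A2 this], simplified]]
      show "has_partials (A' i j) (partial2 (A2 i j) (a, fst z) * 1) (partial2 (A2 i j) (a, fst z) * 0) z"
        by (simp add: A'_def[abs_def])
    qed
    show "norm (A' i j z) \<le> M" if "z \<in> ball b R \<times> ball a R" for i j z
      using that aK by (auto simp: A'_def intro!: M2)
    show "norm (v i) \<le> norm (v True) + norm (v False)" for i by (cases i) auto
  qed (auto intro: analytic2_on_const simp: has_partials_unique(1)[OF has_partials_const])
  define g where "g i z = \<phi> i (snd z, a)" for i and z :: "complex \<times> complex"
  have gp: "has_partials (g i) 0 (partial1 (\<phi> i) (snd z, a)) z" if "snd z \<in> ball b R" for i z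
  proof -
    have "(snd z, a) \<in> ball b R \<times> ball a R" using that R by auto
    from has_partials_compose[OF has_partials_snd has_partials_slice1[OF analytic2_onD[OF \<phi>(1) this], simplified]]
    show ?thesis by (simp add: g_def[abs_def])
  qed
  \<comment> \<open>On the closed disc of half the radius the initial data are bounded, as the
    existence result requires.\<close>
  define r where "r = R / 2"
  have r: "r > 0" "r < R" using R by (auto simp: r_def)
  have "4 * M * r \<le> 4 * M * R" using r M0 by (intro mult_left_mono) auto
  hence rM: "4 * M * r \<le> 1" using RM by simp
  define D where "D = ball a r \<times> ball b r"
  have DK: "D \<subseteq> K" using r R by (auto simp: D_def K_def)
  have opD: "open D" by (simp add: D_def open_Times)
  have "\<exists>C. \<forall>y\<in>cball b r. norm (\<phi> i (y, a)) \<le> C" for i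
  proof -
    have "continuous_on (cball b r) (\<lambda>y. \<phi> i (y, a))"
      by (rule holomorphic_on_imp_continuous_on, rule analytic2_on_slice1_holomorphic[OF \<phi>(1)])
        (use r R in auto)
    hence "bounded ((\<lambda>y. \<phi> i (y, a)) ` cball b r)"
      using compact_continuous_image compact_cball compact_imp_bounded by blast
    thus ?thesis by (auto simp: bounded_iff)
  qed
  then obtain C where C: "\<And>i y. y \<in> cball b r \<Longrightarrow> norm (\<phi> i (y, a)) \<le> C i" by metis
  have C': "norm (g i z) \<le> max (C True) (C False)" if "z \<in> D" for i z
  proof -
    have "norm (g i z) \<le> C i" using that C[of "snd z" i] by (auto simp: g_def D_def)
    thus ?thesis by (cases i) auto
  qed
  have A1D: "analytic2_on (A1 i j) D" and A2D: "analytic2_on (A2 i j) D" for i j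
    by (rule analytic2_on_subset, rule A1 A2, use DK K(3) in blast)+
  obtain \<Phi> where \<Phi>: "\<And>i. analytic2_on (\<Phi> i) D"
    "\<And>i z. z \<in> D \<Longrightarrow> partial1 (\<Phi> i) z = (\<Sum>j\<in>UNIV. A1 i j z * \<Phi> j z)"
    "\<And>i y. y \<in> ball b r \<Longrightarrow> \<Phi> i (a, y) = g i (a, y)"
  proof (rule linear_system_exists[where A = A1, OF D_def r(1) A1D _ rM, where g = g and C = "max (C True) (C False)"])
    show "norm (A1 i j z) \<le> M" if "z \<in> D" for i j z using M1[OF subsetD[OF DK that]] .
    show "analytic2_on (g i) D" for i
      by (rule analytic2_onI, rule gp) (use r in \<open>auto simp: D_def\<close>)
    show "partial1 (g i) z = 0" if "z \<in> D" for i z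
      by (rule has_partials_unique(1)[OF gp]) (use r that in \<open>auto simp: D_def\<close>)
  qed (use C' in auto)
  define \<Psi> where "\<Psi> i z = partial2 (\<Phi> i) z - (\<Sum>j\<in>UNIV. A2 i j z * \<Phi> j z)" for i z
  have \<Psi>0: "\<Psi> i z = 0" if "z \<in> D" for i z
  proof (rule linear_system_unique[where A = A1, OF D_def r(1) A1D _ rM _ _ _ that])
    show "norm (A1 i j z) \<le> M" if "z \<in> D" for i j z using M1[OF subsetD[OF DK that]] .
    show "analytic2_on (\<Psi> i) D" for i
      unfolding \<Psi>_def[abs_def]
      by (intro analytic2_on_diff analytic2_on_sum analytic2_on_mult analytic2_on_partial2 opD \<Phi>(1) A2D)
    show "\<Psi> i (a, y) = 0" if y: "y \<in> ball b r" for i y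
    proof -
      have yD: "(a, y) \<in> D" using y r by (auto simp: D_def)
      have d1: "((\<lambda>t. \<Phi> i (a, t)) has_field_derivative partial2 (\<Phi> i) (a, y)) (at y)"
        using has_partials_slice2[OF analytic2_onD[OF \<Phi>(1) yD]] by simp
      have "((\<lambda>t. \<phi> i (t, a)) has_field_derivative partial1 (\<phi> i) (y, a)) (at y)"
        using has_partials_slice1[OF analytic2_onD[OF \<phi>(1)], of "(y, a)"] y r R by simp
      hence "((\<lambda>t. \<Phi> i (a, t)) has_field_derivative partial1 (\<phi> i) (y, a)) (at y)"
        by (rule has_field_derivative_transform_within_open[OF _ open_ball y]) (simp add: \<Phi>(3) g_def)
      hence "partial2 (\<Phi> i) (a, y) = partial1 (\<phi> i) (y, a)" by (rule DERIV_unique[OF d1])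
      also have "\<dots> = (\<Sum>j\<in>UNIV. A2 i j (a, y) * \<Phi> j (a, y))"
        using y r R by (subst \<phi>(2)) (auto simp: A'_def \<Phi>(3) g_def)
      finally show ?thesis by (simp add: \<Psi>_def)
    qed
    \<comment> \<open>Commuting the two derivatives of \<open>\<Phi>\<close> and inserting flatness
      leaves exactly the terms of \<open>A1\<close> applied to the defect.\<close>
    show "partial1 (\<Psi> i) z = (\<Sum>j\<in>UNIV. A1 i j z * \<Psi> j z)" if z: "z \<in> D" for i z
    proof -
      note h\<Phi> = analytic2_onD[OF \<Phi>(1) z]
      have "partial1 (\<Psi> i) z = partial1 (partial2 (\<Phi> i)) z
          - (\<Sum>j\<in>UNIV. partial1 (A2 i j) z * \<Phi> j z + A2 i j z * partial1 (\<Phi> j) z)"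
        unfolding \<Psi>_def[abs_def]
        by (rule has_partials_unique(1), rule has_partials_diff, rule analytic2_onD[OF _ z],
            rule analytic2_on_partial2[OF opD \<Phi>(1)], rule has_partials_sum,
            rule has_partials_mult[OF analytic2_onD[OF A2D z] h\<Phi>])
      also have "partial1 (partial2 (\<Phi> i)) z = partial2 (partial1 (\<Phi> i)) z"
        by (rule partial_commute[OF opD \<Phi>(1) z, symmetric])
      also have "\<dots> = (\<Sum>j\<in>UNIV. partial2 (A1 i j) z * \<Phi> j z + A1 i j z * partial2 (\<Phi> j) z)"
      proof (rule has_partials_unique(2), rule has_partials_transform[OF _ opD z])
        show "has_partials (\<lambda>z. \<Sum>j\<in>UNIV. A1 i j z * \<Phi> j z)
            (\<Sum>j\<in>UNIV. partial1 (A1 i j) z * \<Phi> j z + A1 i j z * partial1 (\<Phi> j) z)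
            (\<Sum>j\<in>UNIV. partial2 (A1 i j) z * \<Phi> j z + A1 i j z * partial2 (\<Phi> j) z) z"
          by (rule has_partials_sum, rule has_partials_mult[OF analytic2_onD[OF A1D z] h\<Phi>])
      qed (simp add: \<Phi>(2))
      finally have eq: "partial1 (\<Psi> i) z =
         (\<Sum>j\<in>UNIV. partial2 (A1 i j) z * \<Phi> j z + A1 i j z * partial2 (\<Phi> j) z)
          - (\<Sum>j\<in>UNIV. partial1 (A2 i j) z * \<Phi> j z + A2 i j z * partial1 (\<Phi> j) z)" .
      have fl: "partial1 (A2 i k) z = partial2 (A1 i k) z + (\<Sum>j\<in>UNIV. A1 i j z * A2 j k z)
          - (\<Sum>j\<in>UNIV. A2 i j z * A1 j k z)" for k
        using flat[of z i k] subsetD[OF K(3) subsetD[OF DK z]] by simp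
      show ?thesis
        unfolding eq fl \<Psi>_def \<Phi>(2)[OF z] UNIV_bool by (simp add: algebra_simps)
    qed
  qed
  show ?thesis
  proof (rule that)
    show "partial2 (\<Phi> i) z = (\<Sum>j\<in>UNIV. A2 i j z * \<Phi> j z)" if "z \<in> ball a r \<times> ball b r" for i z
      using \<Psi>0[of z i] that by (simp add: \<Psi>_def D_def)
    show "\<Phi> i (a, b) = v i" for i using \<Phi>(3)[of b i] \<phi>(3)[of a i] r R by (simp add: g_def)
  qed (use r \<Phi> DK K in \<open>auto simp: D_def\<close>)
qed

subsection \<open>First integrals of order two and three\<close>

lemma has_partials_uminus: "has_partials u a b z \<Longrightarrow> has_partials (\<lambda>w. - u w) (- a) (- b) z"
  using has_partials_diff[OF has_partials_const[of 0]] by simp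

lemma partial_cong:
  assumes "open D" "z \<in> D" "\<And>w. w \<in> D \<Longrightarrow> u w = v w" "has_partials v a b z"
  shows "partial1 u z = a" "partial2 u z = b"
  using has_partials_unique[OF has_partials_transform[OF assms(4,1,2)]] assms(3) by auto

text \<open>The flat system for the pair \<open>(\<omega>, \<partial>\<^sub>2 \<omega>)\<close>.\<close>

lemma affine_solution:
  fixes \<alpha> \<beta> :: "complex \<times> complex \<Rightarrow> complex" and c :: complex
  assumes op: "open \<Omega>" and p: "(a, b) \<in> \<Omega>" and \<alpha>: "analytic2_on \<alpha> \<Omega>" and \<beta>: "analytic2_on \<beta> \<Omega>"
    and pde: "\<And>z. z \<in> \<Omega> \<Longrightarrow>
      partial1 \<alpha> z + \<beta> z * partial2 \<alpha> z + \<alpha> z * partial2 \<beta> z + partial2 (partial2 \<beta>) z = 0"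
  obtains r \<omega> where "r > 0" "ball a r \<times> ball b r \<subseteq> \<Omega>" "analytic2_on \<omega> (ball a r \<times> ball b r)"
    "\<And>z. z \<in> ball a r \<times> ball b r \<Longrightarrow> partial1 \<omega> z = - \<beta> z * partial2 \<omega> z"
    "\<And>z. z \<in> ball a r \<times> ball b r \<Longrightarrow> partial2 (partial2 \<omega>) z = \<alpha> z * partial2 \<omega> z"
    "partial2 \<omega> (a, b) = c"
proof -
  \<comment> \<open>\<open>False\<close> indexes \<omega> and \<open>True\<close> stands for
    \<open>partial2 \<omega>\<close>. The row of \<open>True\<close> in \<open>A1\<close> results
    from differentiating the prescribed \<open>partial1 \<omega>\<close> along x2. The flatness
    entry at \<open>True\<close>, \<open>True\<close> is the assumed equation; the other entries
    hold identically.\<close>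
  define A1 where "A1 i j = (if j then if i then (\<lambda>z. - (\<alpha> z * \<beta> z + partial2 \<beta> z)) else (\<lambda>z. - \<beta> z)
     else (\<lambda>_. 0))" for i j
  define A2 where "A2 i j = (if j then if i then \<alpha> else (\<lambda>_. 1) else (\<lambda>_. 0))" for i j
  have d\<beta>: "analytic2_on (partial2 \<beta>) \<Omega>" by (rule analytic2_on_partial2[OF op \<beta>])
  have h1: "has_partials (A1 True True)
      (- (partial1 \<alpha> z * \<beta> z + \<alpha> z * partial1 \<beta> z + partial1 (partial2 \<beta>) z))
      (- (partial2 \<alpha> z * \<beta> z + \<alpha> z * partial2 \<beta> z + partial2 (partial2 \<beta>) z)) z" if "z \<in> \<Omega>" for z
    unfolding A1_def if_True
    by (intro has_partials_uminus has_partials_add has_partials_mult analytic2_onD[OF _ that] \<alpha> \<beta> d\<beta>)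
  have h2: "has_partials (A1 False True) (- partial1 \<beta> z) (- partial2 \<beta> z) z" if "z \<in> \<Omega>" for z
    unfolding A1_def using that \<beta> by (auto intro!: has_partials_uminus analytic2_onD)
  have h0: "has_partials (A1 i False) 0 0 z" for i z unfolding A1_def by (simp add: has_partials_const)
  have z2: "has_partials (A2 i False) 0 0 z" "has_partials (A2 False True) 0 0 z" for i z
    unfolding A2_def by (simp_all add: has_partials_const)
  have A1: "analytic2_on (A1 i j) \<Omega>" for i j
    using analytic2_onI[OF h1] analytic2_onI[OF h2] analytic2_onI[OF h0] by (cases i; cases j) auto
  have A2: "analytic2_on (A2 i j) \<Omega>" for i j
    using \<alpha> by (cases i; cases j) (auto simp: A2_def intro: analytic2_on_const)
  have flat: "partial2 (A1 i k) z + (\<Sum>j\<in>UNIV. A1 i j z * A2 j k z) =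
      partial1 (A2 i k) z + (\<Sum>j\<in>UNIV. A2 i j z * A1 j k z)" if z: "z \<in> \<Omega>" for i k z
  proof (cases k)
    case False
    hence [simp]: "k = False" by simp
    show ?thesis
      using has_partials_unique[OF h0] has_partials_unique[OF z2(1)]
      by (simp add: A1_def A2_def UNIV_bool)
  next
    case True
    have pd: "partial1 \<alpha> z = - (\<beta> z * partial2 \<alpha> z + \<alpha> z * partial2 \<beta> z + partial2 (partial2 \<beta>) z)"
      using pde[OF z] by (simp add: add_eq_0_iff algebra_simps)
    have A2TT: "A2 True True = \<alpha>" by (simp add: A2_def)
    show ?thesis
    proof (cases i)
      case i: True
      show ?thesis unfolding \<open>k\<close>[THEN eqTrueI] i[THEN eqTrueI] has_partials_unique(2)[OF h1[OF z]] A2TT pd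
        by (simp add: A1_def A2_def UNIV_bool algebra_simps)
    next
      case i: False
      hence [simp]: "i = False" by simp
      show ?thesis using \<open>k\<close> has_partials_unique(2)[OF h2[OF z]] has_partials_unique(1)[OF z2(2)]
        by (simp add: A1_def A2_def UNIV_bool algebra_simps)
    qed
  qed
  obtain r \<Phi> where r: "r > 0" "ball a r \<times> ball b r \<subseteq> \<Omega>"
    and \<Phi>: "\<And>i. analytic2_on (\<Phi> i) (ball a r \<times> ball b r)"
    and \<Phi>1: "\<And>i z. z \<in> ball a r \<times> ball b r \<Longrightarrow> partial1 (\<Phi> i) z = (\<Sum>j\<in>UNIV. A1 i j z * \<Phi> j z)"
    and \<Phi>2: "\<And>i z. z \<in> ball a r \<times> ball b r \<Longrightarrow> partial2 (\<Phi> i) z = (\<Sum>j\<in>UNIV. A2 i j z * \<Phi> j z)"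
    and \<Phi>0: "\<And>i. \<Phi> i (a, b) = of_bool i * c"
    using flat_linear_system[OF op p A1 A2 flat, where v = "\<lambda>i. of_bool i * c"] by blast
  have e2: "partial2 (\<Phi> False) z = \<Phi> True z" if "z \<in> ball a r \<times> ball b r" for z
    using \<Phi>2[OF that] by (simp add: A2_def UNIV_bool)
  show ?thesis
  proof (rule that[OF r \<Phi>])
    fix z assume z: "z \<in> ball a r \<times> ball b r"
    show "partial1 (\<Phi> False) z = - \<beta> z * partial2 (\<Phi> False) z"
      using \<Phi>1[OF z] e2[OF z] by (simp add: A1_def UNIV_bool)
    have "partial2 (partial2 (\<Phi> False)) z = partial2 (\<Phi> True) z"
      by (rule partial_cong(2)[OF _ z e2 analytic2_onD[OF \<Phi> z]]) (auto intro: open_Times)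
    thus "partial2 (partial2 (\<Phi> False)) z = \<alpha> z * partial2 (\<Phi> False) z"
      using \<Phi>2[OF z] e2[OF z] by (simp add: A2_def UNIV_bool)
  next
    show "partial2 (\<Phi> False) (a, b) = c" using e2 \<Phi>0 r by simp
  qed
qed

text \<open>As for the classical Schwarzian equation, \<open>\<omega>\<close> is the quotient of two solutions \<open>\<phi>\<close> of
  \<open>\<partial>\<^sub>2\<^bsup>2\<^esup> \<phi> = - \<alpha> \<phi> / 4\<close>, for which \<open>\<partial>\<^sub>1 \<phi> = \<partial>\<^sub>2 \<beta> \<phi> / 2 - \<beta> \<partial>\<^sub>2 \<phi>\<close> makes the system for
  \<open>(\<phi>, \<partial>\<^sub>2 \<phi>)\<close> flat.\<close>

lemma schwarz_solution:
  fixes \<alpha> \<beta> :: "complex \<times> complex \<Rightarrow> complex"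
  assumes op: "open \<Omega>" and p: "(a, b) \<in> \<Omega>" and \<alpha>: "analytic2_on \<alpha> \<Omega>" and \<beta>: "analytic2_on \<beta> \<Omega>"
    and pde: "\<And>z. z \<in> \<Omega> \<Longrightarrow> partial1 \<alpha> z + \<beta> z * partial2 \<alpha> z + 2 * \<alpha> z * partial2 \<beta> z
      + 2 * partial2 (partial2 (partial2 \<beta>)) z = 0"
  obtains r \<omega> where "r > 0" "ball a r \<times> ball b r \<subseteq> \<Omega>" "analytic2_on \<omega> (ball a r \<times> ball b r)"
    "\<And>z. z \<in> ball a r \<times> ball b r \<Longrightarrow> partial1 \<omega> z = - \<beta> z * partial2 \<omega> z"
    "\<And>z. z \<in> ball a r \<times> ball b r \<Longrightarrow> 2 * partial2 \<omega> z * partial2 (partial2 (partial2 \<omega>)) z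
       - 3 * (partial2 (partial2 \<omega>) z) ^ 2 - \<alpha> z * (partial2 \<omega> z) ^ 2 = 0"
    "partial2 \<omega> (a, b) \<noteq> 0"
proof -
  let ?b2 = "partial2 \<beta>" and ?b22 = "partial2 (partial2 \<beta>)"
  \<comment> \<open>The row of \<open>True\<close> is the x2-derivative of the prescribed
    \<open>partial1 \<phi>\<close>, with the second x2-derivative of \<phi> replaced. Origin of the
    factor 1/4: divided by \<open>2 * partial2 \<omega> ^ 2\<close>, the equation sets the
    Schwarzian derivative of \<omega> in x2 to \<open>\<alpha> / 2\<close>, and quotients of
    solutions of \<phi>'' = - q \<phi> have Schwarzian derivative 2 q.\<close>
  define A1 where "A1 i j = (if i then if j then (\<lambda>z. - (1 / 2) * ?b2 z) else (\<lambda>z. 1 / 2 * ?b22 z + 1 / 4 * (\<alpha> z * \<beta> z))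
     else if j then (\<lambda>z. - 1 * \<beta> z) else (\<lambda>z. 1 / 2 * ?b2 z))" for i j
  define A2 where "A2 i j = (if i then if j then (\<lambda>_. 0) else (\<lambda>z. - (1 / 4) * \<alpha> z) else
      if j then (\<lambda>_. 1) else (\<lambda>_. 0))" for i j
  have b2: "analytic2_on ?b2 \<Omega>" by (rule analytic2_on_partial2[OF op \<beta>])
  have b22: "analytic2_on ?b22 \<Omega>" by (rule analytic2_on_partial2[OF op b2])
  have A1: "analytic2_on (A1 i j) \<Omega>" for i j
    by (cases i; cases j) (simp_all only: A1_def if_True if_False,
      (intro analytic2_on_add analytic2_on_mult analytic2_on_const b2 b22 \<alpha> \<beta>)+)
  have A2: "analytic2_on (A2 i j) \<Omega>" for i j
    by (cases i; cases j) (simp_all only: A2_def if_True if_False,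
      (intro analytic2_on_mult analytic2_on_const \<alpha>)+)
  have flat: "partial2 (A1 i k) z + (\<Sum>j\<in>UNIV. A1 i j z * A2 j k z) =
      partial1 (A2 i k) z + (\<Sum>j\<in>UNIV. A2 i j z * A1 j k z)" if z: "z \<in> \<Omega>" for i k z
  proof -
    note hc = has_partials_mult[OF has_partials_const]
    note hz = analytic2_onD[OF \<alpha> z] analytic2_onD[OF \<beta> z] analytic2_onD[OF b2 z] analytic2_onD[OF b22 z]
    have 1: "partial2 (A1 True True) z = - (1 / 2) * ?b22 z"
      unfolding A1_def if_True if_False by (subst has_partials_unique(2)[OF hc[OF hz(3)]]) simp
    have 2: "partial2 (A1 True False) z =
        1 / 2 * partial2 ?b22 z + 1 / 4 * (partial2 \<alpha> z * \<beta> z + \<alpha> z * ?b2 z)"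
      unfolding A1_def if_True if_False by (subst has_partials_unique(2)[OF has_partials_add[OF hc[OF hz(4)] hc[OF has_partials_mult[OF hz(1,2)]]]]) simp
    have 3: "partial2 (A1 False True) z = - ?b2 z"
      unfolding A1_def if_True if_False by (subst has_partials_unique(2)[OF hc[OF hz(2)]]) simp
    have 4: "partial2 (A1 False False) z = 1 / 2 * ?b22 z"
      unfolding A1_def if_True if_False by (subst has_partials_unique(2)[OF hc[OF hz(3)]]) simp
    have 5: "partial1 (A2 True False) z = - (1 / 4) * partial1 \<alpha> z"
      unfolding A2_def if_True if_False by (subst has_partials_unique(1)[OF hc[OF hz(1)]]) simp
    have 6: "partial1 (A2 True True) z = 0" "partial1 (A2 False i) z = 0" for i
      using has_partials_unique(1)[OF has_partials_const] by (simp_all add: A2_def)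
    have pd: "partial1 \<alpha> z = - (\<beta> z * partial2 \<alpha> z + 2 * \<alpha> z * ?b2 z + 2 * partial2 ?b22 z)"
      using pde[OF z] by (simp add: add_eq_0_iff algebra_simps)
    let ?flat = "\<lambda>i k. partial2 (A1 i k) z + (\<Sum>j\<in>UNIV. A1 i j z * A2 j k z) =
      partial1 (A2 i k) z + (\<Sum>j\<in>UNIV. A2 i j z * A1 j k z)"
    have TT: "?flat True True" unfolding 1 6 UNIV_bool by (simp add: A1_def A2_def)
    have TF: "?flat True False" unfolding 2 5 pd UNIV_bool by (simp add: A1_def A2_def algebra_simps)
    have FT: "?flat False True" unfolding 3 6 UNIV_bool by (simp add: A1_def A2_def)
    have FF: "?flat False False" unfolding 4 6 UNIV_bool by (simp add: A1_def A2_def)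
    show ?thesis by (cases i; cases k) (use TT TF FT FF in auto)
  qed
  obtain r \<Phi> where r: "r > 0" "ball a r \<times> ball b r \<subseteq> \<Omega>"
    and \<Phi>: "\<And>i. analytic2_on (\<Phi> i) (ball a r \<times> ball b r)"
    and \<Phi>1: "\<And>i z. z \<in> ball a r \<times> ball b r \<Longrightarrow> partial1 (\<Phi> i) z = (\<Sum>j\<in>UNIV. A1 i j z * \<Phi> j z)"
    and \<Phi>2: "\<And>i z. z \<in> ball a r \<times> ball b r \<Longrightarrow> partial2 (\<Phi> i) z = (\<Sum>j\<in>UNIV. A2 i j z * \<Phi> j z)"
    and \<Phi>0: "\<And>i. \<Phi> i (a, b) = of_bool (\<not> i)"
    using flat_linear_system[OF op p A1 A2 flat, where v = "\<lambda>i. of_bool (\<not> i)"] by blast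
  obtain s \<Psi> where s: "s > 0" "ball a s \<times> ball b s \<subseteq> \<Omega>"
    and \<Psi>: "\<And>i. analytic2_on (\<Psi> i) (ball a s \<times> ball b s)"
    and \<Psi>1: "\<And>i z. z \<in> ball a s \<times> ball b s \<Longrightarrow> partial1 (\<Psi> i) z = (\<Sum>j\<in>UNIV. A1 i j z * \<Psi> j z)"
    and \<Psi>2: "\<And>i z. z \<in> ball a s \<times> ball b s \<Longrightarrow> partial2 (\<Psi> i) z = (\<Sum>j\<in>UNIV. A2 i j z * \<Psi> j z)"
    and \<Psi>0: "\<And>i. \<Psi> i (a, b) = of_bool i"
    using flat_linear_system[OF op p A1 A2 flat, where v = "\<lambda>i. of_bool i"] by blast
  define \<phi> \<eta> \<psi> \<xi> where "\<phi> = \<Phi> False" and "\<eta> = \<Phi> True" and "\<psi> = \<Psi> False" and "\<xi> = \<Psi> True"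
  define U where "U = {z \<in> ball a (min r s) \<times> ball b (min r s). \<phi> z \<noteq> 0}"
  have sub: "ball a (min r s) \<times> ball b (min r s) \<subseteq> ball a r \<times> ball b r"
    "ball a (min r s) \<times> ball b (min r s) \<subseteq> ball a s \<times> ball b s" by auto
  have "open U"
    unfolding U_def
    by (rule continuous_open_preimage[of _ \<phi> "- {0}", unfolded vimage_def, simplified Int_def mem_Collect_eq Compl_iff singleton_iff])
      (auto simp: \<phi>_def intro: open_Times analytic2_on_continuous[OF analytic2_on_subset[OF \<Phi> sub(1)]])
  moreover have "(a, b) \<in> U" using r s \<Phi>0[of False] by (simp add: U_def \<phi>_def)
  ultimately obtain t where t: "t > 0" "cball a t \<times> cball b t \<subseteq> U"
    using open_bidisc[of U "(a, b)"] by auto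
  define D where "D = ball a t \<times> ball b t"
  have opD: "open D" by (simp add: D_def open_Times)
  have DU: "D \<subseteq> U" using t by (auto simp: D_def)
  have Dr: "z \<in> ball a r \<times> ball b r" and Ds: "z \<in> ball a s \<times> ball b s" and \<phi>n: "\<phi> z \<noteq> 0" if "z \<in> D" for z
    using subsetD[OF DU that] by (auto simp: U_def)
  have h\<phi>: "has_partials \<phi> (1 / 2 * ?b2 z * \<phi> z - \<beta> z * \<eta> z) (\<eta> z) z"
    and h\<eta>: "has_partials \<eta> (partial1 \<eta> z) (- (1 / 4) * \<alpha> z * \<phi> z) z" if "z \<in> D" for z
    using analytic2_onD[OF \<Phi> Dr[OF that], of False] \<Phi>1[OF Dr[OF that], of False] \<Phi>2[OF Dr[OF that], of False]
      analytic2_onD[OF \<Phi> Dr[OF that], of True] \<Phi>2[OF Dr[OF that], of True]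
    by (simp_all add: \<phi>_def \<eta>_def A1_def A2_def UNIV_bool)
  have h\<psi>: "has_partials \<psi> (1 / 2 * ?b2 z * \<psi> z - \<beta> z * \<xi> z) (\<xi> z) z"
    and h\<xi>: "has_partials \<xi> (partial1 \<xi> z) (- (1 / 4) * \<alpha> z * \<psi> z) z" if "z \<in> D" for z
    using analytic2_onD[OF \<Psi> Ds[OF that], of False] \<Psi>1[OF Ds[OF that], of False] \<Psi>2[OF Ds[OF that], of False]
      analytic2_onD[OF \<Psi> Ds[OF that], of True] \<Psi>2[OF Ds[OF that], of True]
    by (simp_all add: \<psi>_def \<xi>_def A1_def A2_def UNIV_bool)
  \<comment> \<open>The Wronskian. It does not depend on x2 because the equation in x2 has no
    first-order term, and it is 1 at the base point, which keeps \<open>partial2 \<omega>\<close>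
    from vanishing there.\<close>
  define W where "W z = \<xi> z * \<phi> z - \<psi> z * \<eta> z" for z
  have hW: "has_partials W (partial1 W z) 0 z" if z: "z \<in> D" for z
  proof -
    from has_partials_diff[OF has_partials_mult[OF h\<xi>[OF z] h\<phi>[OF z]] has_partials_mult[OF h\<psi>[OF z] h\<eta>[OF z]]]
    obtain w where "has_partials W w 0 z" by (simp add: W_def[abs_def] mult_ac)
    thus ?thesis using has_partials_unique(1) by metis
  qed
  define \<omega> where "\<omega> z = \<psi> z / \<phi> z" for z
  have h\<omega>: "has_partials \<omega> (- \<beta> z * (W z / \<phi> z ^ 2)) (W z / \<phi> z ^ 2) z" if z: "z \<in> D" for z
  proof -
    \<comment> \<open>The terms with half the derivative of \<beta> cancel in the quotient, so
      \<omega> is a first integral.\<close>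
    have "((1 / 2 * ?b2 z * \<psi> z - \<beta> z * \<xi> z) * \<phi> z - \<psi> z * (1 / 2 * ?b2 z * \<phi> z - \<beta> z * \<eta> z)) = - \<beta> z * W z"
      by (simp add: W_def algebra_simps)
    with has_partials_divide[OF h\<psi>[OF z] h\<phi>[OF z] \<phi>n[OF z]] show ?thesis
      by (simp add: \<omega>_def[abs_def] W_def)
  qed
  have \<omega>2: "partial2 \<omega> z = W z / \<phi> z ^ 2" if "z \<in> D" for z
    using has_partials_unique(2)[OF h\<omega>[OF that]] .
  have h2: "has_partials (\<lambda>z. W z / \<phi> z ^ 2) (partial1 (\<lambda>z. W z / \<phi> z ^ 2) z) (- 2 * W z * \<eta> z / \<phi> z ^ 3) z"
    if z: "z \<in> D" for z
  proof -
    have "(0 * \<phi> z ^ 2 - W z * (of_nat 2 * \<phi> z ^ (2 - 1) * \<eta> z)) / (\<phi> z ^ 2) ^ 2 = - 2 * W z * \<eta> z / \<phi> z ^ 3"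
      using \<phi>n[OF z] by (simp add: divide_simps power2_eq_square power3_eq_cube)
    with has_partials_divide[OF hW[OF z] has_partials_power[OF h\<phi>[OF z], of 2]] \<phi>n[OF z]
    obtain w where "has_partials (\<lambda>z. W z / \<phi> z ^ 2) w (- 2 * W z * \<eta> z / \<phi> z ^ 3) z" by auto
    thus ?thesis using has_partials_unique(1) by metis
  qed
  have \<omega>22: "partial2 (partial2 \<omega>) z = - 2 * W z * \<eta> z / \<phi> z ^ 3" if "z \<in> D" for z
    by (rule partial_cong(2)[OF opD that \<omega>2 h2[OF that]])
  have \<omega>222: "partial2 (partial2 (partial2 \<omega>)) z = W z * (\<alpha> z / 2 / \<phi> z ^ 2 + 6 * \<eta> z ^ 2 / \<phi> z ^ 4)" if z: "z \<in> D" for z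
  proof (rule trans)
    have "has_partials (\<lambda>z. - 2 * W z * \<eta> z) ((0 * W z + - 2 * partial1 W z) * \<eta> z + - 2 * W z * partial1 \<eta> z)
        ((0 * W z + - 2 * 0) * \<eta> z + - 2 * W z * (- (1 / 4) * \<alpha> z * \<phi> z)) z"
      by (rule has_partials_mult[OF has_partials_mult[OF has_partials_const hW[OF z]] h\<eta>[OF z]])
    from has_partials_divide[OF this has_partials_power[OF h\<phi>[OF z], of 3]] \<phi>n[OF z]
    show "partial2 (partial2 (partial2 \<omega>)) z =
      (((0 * W z + - 2 * 0) * \<eta> z + - 2 * W z * (- (1 / 4) * \<alpha> z * \<phi> z)) * \<phi> z ^ 3 -
        - 2 * W z * \<eta> z * (of_nat 3 * \<phi> z ^ (3 - 1) * \<eta> z)) / (\<phi> z ^ 3) ^ 2"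
      by (intro partial_cong(2)[OF opD z \<omega>22]) auto
    show "\<dots> = W z * (\<alpha> z / 2 / \<phi> z ^ 2 + 6 * \<eta> z ^ 2 / \<phi> z ^ 4)"
      using \<phi>n[OF z] by (simp add: divide_simps) (simp add: algebra_simps eval_nat_numeral)
  qed
  show ?thesis
  proof (rule that[OF t(1)])
    show "ball a t \<times> ball b t \<subseteq> \<Omega>" using Dr r by (auto simp: D_def)
    show "analytic2_on \<omega> (ball a t \<times> ball b t)" by (rule analytic2_onI, rule h\<omega>) (simp add: D_def)
    fix z assume "z \<in> ball a t \<times> ball b t"
    hence z: "z \<in> D" by (simp add: D_def)
    show "partial1 \<omega> z = - \<beta> z * partial2 \<omega> z" using has_partials_unique[OF h\<omega>[OF z]] by simp
    show "2 * partial2 \<omega> z * partial2 (partial2 (partial2 \<omega>)) z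
       - 3 * (partial2 (partial2 \<omega>) z) ^ 2 - \<alpha> z * (partial2 \<omega> z) ^ 2 = 0"
      unfolding \<omega>2[OF z] \<omega>22[OF z] \<omega>222[OF z] using \<phi>n[OF z]
      by (simp add: divide_simps) (simp add: algebra_simps eval_nat_numeral)
  next
    have ab: "(a, b) \<in> D" using t by (simp add: D_def)
    show "partial2 \<omega> (a, b) \<noteq> 0"
      unfolding \<omega>2[OF ab] using \<Phi>0 \<Psi>0 by (simp add: W_def \<phi>_def \<eta>_def \<psi>_def \<xi>_def)
  qed
qed

subsection \<open>Derivations of differential polynomials\<close>

abbreviation "lookup \<equiv> Poly_Mapping.lookup"
abbreviation "keys \<equiv> Poly_Mapping.keys"
abbreviation "single \<equiv> Poly_Mapping.single"

text \<open>The contribution of one term to the derivation that extends \<open>d\<close> and sends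
  the symbol \<open>v\<close> to an arbitrary differential polynomial \<open>g v\<close>. This
  generality covers the two given derivations, the derivation of the coefficients alone and the
  lowering derivations.\<close>

definition pterm ::
  "(ratfun \<Rightarrow> ratfun) \<Rightarrow> (deriv_index \<Rightarrow> dpoly) \<Rightarrow> dmonom \<Rightarrow> ratfun \<Rightarrow> dpoly" where
  "pterm d g m c = single m (d c) +
     (\<Sum>v\<in>keys m. single (m - single v 1) (of_nat (lookup m v) * c) * g v)"

definition pder :: "(ratfun \<Rightarrow> ratfun) \<Rightarrow> (deriv_index \<Rightarrow> dpoly) \<Rightarrow> dpoly \<Rightarrow> dpoly" where
  "pder d g A = (\<Sum>m\<in>keys A. pterm d g m (lookup A m))"

lemma poly_mapping_sum_single: "(\<Sum>m\<in>keys A. single m (lookup A m)) = A"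
proof (rule poly_mapping_eqI)
  fix k
  have "(\<Sum>m\<in>keys A. lookup A m when m = k) = (\<Sum>m\<in>keys A. if m = k then lookup A m else 0)"
    by (intro sum.cong) (auto simp: when_def)
  thus "lookup (\<Sum>m\<in>keys A. single m (lookup A m)) k = lookup A k"
    by (simp add: lookup_sum lookup_single in_keys_iff)
qed

lemma dp_derivation_pder: "dp_derivation d s = pder d (\<lambda>v. single (single (s v) 1) 1)"
  by (rule ext) (simp add: dp_derivation_def pder_def pterm_def mult_single)

context
  fixes d :: "ratfun \<Rightarrow> ratfun" and g :: "deriv_index \<Rightarrow> dpoly"
  assumes d: "ring_derivation d"
begin

interpretation d: ring_derivation d by (fact d)

lemma pterm_0: "pterm d g m 0 = 0"
  by (simp add: pterm_def)

lemma pterm_add: "pterm d g m (a + b) = pterm d g m a + pterm d g m b"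
  by (simp add: pterm_def d.add single_add distrib_left distrib_right sum.distrib add_ac)

lemma pder_superset:
  assumes "finite M" "keys A \<subseteq> M"
  shows "pder d g A = (\<Sum>m\<in>M. pterm d g m (lookup A m))"
  unfolding pder_def using assms
  by (intro sum.mono_neutral_left) (auto simp: pterm_0 in_keys_iff)

lemma pder_add: "pder d g (A + B) = pder d g A + pder d g B"
  using pder_superset[of "keys A \<union> keys B" A] pder_superset[of "keys A \<union> keys B" B]
    pder_superset[of "keys A \<union> keys B" "A + B"] Poly_Mapping.keys_add[of A B]
  by (simp add: lookup_add pterm_add sum.distrib)

lemma pder_single: "pder d g (single m c) = pterm d g m c"
  using pder_superset[of "{m}" "single m c"] by simp

lemma pder_sum: "pder d g (sum f S) = (\<Sum>x\<in>S. pder d g (f x))"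
proof (induction S rule: infinite_finite_induct)
  case empty
  show ?case using pder_superset[of "{}" 0] by simp
next
  case (infinite S)
  show ?case using pder_superset[of "{}" 0] infinite by simp
qed (simp add: pder_add)

text \<open>Leibniz' rule for two terms; additivity extends it to all products. Symbols outside one
  factor contribute with exponent 0, which also makes the truncated subtraction of exponents
  harmless.\<close>

lemma pterm_mult: "pterm d g (m + n) (a * b) = pterm d g m a * single n b + single m a * pterm d g n b"
proof -
  have keys: "keys (m + n) = keys m \<union> keys n"
    by (auto simp: in_keys_iff lookup_add)
  have sup: "(\<Sum>v\<in>keys k. single (k - single v 1) (of_nat (lookup k v) * c) * g v)
      = (\<Sum>v\<in>keys m \<union> keys n. single (k - single v 1) (of_nat (lookup k v) * c) * g v)"
    if "keys k \<subseteq> keys m \<union> keys n" for k c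
    using that by (intro sum.mono_neutral_left) (auto simp: in_keys_iff)
  have mn: "single (m + n - single v 1) (of_nat (lookup m v) * a * b)
      = single (m - single v 1) (of_nat (lookup m v) * a) * single n b" for v m n a b
  proof (cases "lookup m v = 0")
    case False
    hence "m + n - single v 1 = (m - single v 1) + n"
      by (intro poly_mapping_eqI) (auto simp: lookup_add lookup_minus lookup_single when_def)
    thus ?thesis by (simp add: mult_single)
  qed simp
  have "single (m + n - single v 1) (of_nat (lookup (m + n) v) * (a * b)) * g v
     = (single (m - single v 1) (of_nat (lookup m v) * a) * g v) * single n b
      + single m a * (single (n - single v 1) (of_nat (lookup n v) * b) * g v)" for v
    using mn[of m n v a b] mn[of n m v b a]
    by (simp add: lookup_add distrib_left distrib_right single_add mult_ac add.commute)
  thus ?thesis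
    unfolding pterm_def keys sup[OF Un_upper1] sup[OF Un_upper2] d.mult single_add
    by (simp add: mult_single sum.distrib sum_distrib_left sum_distrib_right distrib_left distrib_right add_ac)
qed

lemma ring_derivation_pder: "ring_derivation (pder d g)"
proof
  fix A B :: dpoly
  show "pder d g (A + B) = pder d g A + pder d g B" by (rule pder_add)
  have AB: "A * B = (\<Sum>m\<in>keys A. \<Sum>n\<in>keys B. single (m + n) (lookup A m * lookup B n))"
    by (subst (1 2) poly_mapping_sum_single[symmetric]) (simp add: sum_product mult_single)
  have "pder d g (A * B) = (\<Sum>m\<in>keys A. \<Sum>n\<in>keys B.
      pterm d g m (lookup A m) * single n (lookup B n) + single m (lookup A m) * pterm d g n (lookup B n))"
    by (simp add: AB pder_sum pder_single pterm_mult)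
  also have "\<dots> = pder d g A * (\<Sum>n\<in>keys B. single n (lookup B n))
      + (\<Sum>m\<in>keys A. single m (lookup A m)) * pder d g B"
    by (simp add: pder_def sum.distrib sum_product)
  finally show "pder d g (A * B) = pder d g A * B + A * pder d g B"
    by (simp add: poly_mapping_sum_single)
qed

lemma pder_const: "pder d g (dp_const c) = dp_const (d c)"
  by (simp add: dp_const_def pder_single pterm_def)

lemma pder_var: "pder d g (single (single v 1) 1) = g v"
  by (simp add: pder_single pterm_def)

end

lemma dp_const_simps [simp]:
  "dp_const 0 = 0" "dp_const 1 = 1"
  by (simp_all add: dp_const_def)

lemma dp_const_add: "dp_const (a + b) = dp_const a + dp_const b"
  and dp_const_mult: "dp_const (a * b) = dp_const a * dp_const b"
  by (simp_all add: dp_const_def single_add mult_single)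

lemma dp_const_uminus: "dp_const (- a) = - dp_const a"
  by (simp add: dp_const_def single_uminus)

lemma lookup_dp_const_mult: "lookup (dp_const c * A) m = c * lookup A m"
  by (simp add: dp_const_def mult_map_scale_conv_mult[symmetric] Poly_Mapping.map.rep_eq when_def)

section \<open>Polynomials in a prescribed set of derivatives\<close>

definition polys_in :: "deriv_index set \<Rightarrow> dpoly set" where
  "polys_in V = {A. derivs_in A \<subseteq> V}"

lemma polys_in_iff: "A \<in> polys_in V \<longleftrightarrow> (\<forall>m\<in>keys A. keys m \<subseteq> V)"
  by (auto simp: polys_in_def derivs_in_def)

lemma polys_in_0 [simp]: "0 \<in> polys_in V"
  by (simp add: polys_in_iff)

lemma polys_in_single: "keys m \<subseteq> V \<Longrightarrow> single m c \<in> polys_in V"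
  by (auto simp: polys_in_iff)

lemma polys_in_const [simp]: "dp_const c \<in> polys_in V"
  by (simp add: dp_const_def polys_in_single)

lemma polys_in_y: "(i, j) \<in> V \<Longrightarrow> dp_y i j \<in> polys_in V"
  by (simp add: dp_y_def polys_in_single)

lemma polys_in_add: "A \<in> polys_in V \<Longrightarrow> B \<in> polys_in V \<Longrightarrow> A + B \<in> polys_in V"
  using Poly_Mapping.keys_add[of A B] unfolding polys_in_iff by blast

lemma keys_add_monom: "keys (m + n) = keys m \<union> keys n" for m n :: dmonom
  by (auto simp: in_keys_iff lookup_add)

lemma polys_in_mult:
  assumes "A \<in> polys_in V" "B \<in> polys_in V"
  shows "A * B \<in> polys_in V"
  unfolding polys_in_iff
proof
  note * = assms[unfolded polys_in_iff]
  fix k assume "k \<in> keys (A * B)"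
  then obtain m n where "k = m + n" "m \<in> keys A" "n \<in> keys B"
    using subsetD[OF Poly_Mapping.keys_mult[of A B]] by blast
  thus "keys k \<subseteq> V" using * by (simp add: keys_add_monom)
qed

lemma polys_in_uminus: "A \<in> polys_in V \<Longrightarrow> - A \<in> polys_in V"
  by (simp add: polys_in_iff)

lemma polys_in_diff: "A \<in> polys_in V \<Longrightarrow> B \<in> polys_in V \<Longrightarrow> A - B \<in> polys_in V"
  using polys_in_add[OF _ polys_in_uminus, of A V B] by simp

lemma polys_in_sum: "(\<And>x. x \<in> S \<Longrightarrow> f x \<in> polys_in V) \<Longrightarrow> sum f S \<in> polys_in V"
  by (induction S rule: infinite_finite_induct) (auto intro: polys_in_add)

lemma polys_in_pder:
  assumes "A \<in> polys_in V" "\<And>v. v \<in> V \<Longrightarrow> g v \<in> polys_in V"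
  shows "pder d g A \<in> polys_in V"
  unfolding pder_def pterm_def
proof (intro polys_in_sum polys_in_add polys_in_mult polys_in_single)
  fix m assume m: "m \<in> keys A"
  thus mV: "keys m \<subseteq> V" using assms(1) by (simp add: polys_in_iff)
  show "keys (m - single v 1) \<subseteq> V" for v
    using mV by (auto simp: in_keys_iff lookup_minus)
  show "v \<in> keys m \<Longrightarrow> g v \<in> polys_in V" for v using mV assms(2) by blast
qed

lemma single_induct:
  assumes "P (dp_const c)" "\<And>B v. v \<in> keys m \<Longrightarrow> P B \<Longrightarrow> P (B * dp_y (fst v) (snd v))"
  shows "P (single m c)"
  using assms(2)
proof (induction m rule: Poly_Mapping.update_induct)
  case const
  show ?case using assms(1) by (simp add: dp_const_def)
next
  case (update m v k)
  have eq: "Poly_Mapping.update v k m = m + single v k"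
    using update(1) by (intro poly_mapping_eqI)
      (auto simp: lookup_update lookup_add lookup_single when_def in_keys_iff)
  have kv: "keys (m + single v k) = insert v (keys m)"
    using update(2) by (auto simp: keys_add_monom)
  have "P (single (m + single v n) c)" for n
  proof (induction n)
    case 0
    show ?case using update(3,4) by (simp add: eq kv)
  next
    case (Suc n)
    have "single (m + single v (Suc n)) c = single (m + single v n) c * dp_y (fst v) (snd v)"
      by (simp add: dp_y_def mult_single single_add[symmetric] add.assoc)
    thus ?case using update(4)[of v "single (m + single v n) c"] Suc by (simp add: eq kv)
  qed
  thus ?case by (simp add: eq)
qed

text \<open>Every element is a sum of terms, and every term a product of a coefficient and symbols
  from \<open>V\<close>. Statements about derivations thus need to be checked on generators
  only.\<close>

lemma polys_in_induct [consumes 1, case_names const var add mult]: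
  assumes "A \<in> polys_in V" "\<And>c. P (dp_const c)" "\<And>i j. (i, j) \<in> V \<Longrightarrow> P (dp_y i j)"
    "\<And>A B. P A \<Longrightarrow> P B \<Longrightarrow> P (A + B)" "\<And>A B. P A \<Longrightarrow> P B \<Longrightarrow> P (A * B)"
  shows "P A"
proof -
  have mono: "P (single m (lookup A m))" if "m \<in> keys A" for m
  proof (rule single_induct)
    show "P (B * dp_y (fst v) (snd v))" if "v \<in> keys m" "P B" for B v
      using that \<open>m \<in> keys A\<close> assms(1) by (intro assms(3,5)) (auto simp: polys_in_iff)
  qed (rule assms(2))
  have "P (\<Sum>m\<in>M. single m (lookup A m))" if "M \<subseteq> keys A" "finite M" for M
    using that(2,1)
  proof induction
    case empty
    show ?case using assms(2)[of 0] by simp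
  qed (simp add: assms(4) mono)
  from this[OF order_refl finite_keys] show ?thesis by (simp only: poly_mapping_sum_single)
qed

lemma ring_derivation_zero: "ring_derivation (\<lambda>_. 0)"
  by unfold_locales simp_all

lemma ring_derivation_plus:
  "ring_derivation d \<Longrightarrow> ring_derivation e \<Longrightarrow> ring_derivation (\<lambda>x. d x + e x)"
  by (auto simp: ring_derivation_def algebra_simps)

lemma ring_derivation_scale: "ring_derivation d \<Longrightarrow> ring_derivation (\<lambda>x. c * d x)"
  by (auto simp: ring_derivation_def algebra_simps)

lemma ring_derivation_sum:
  "(\<And>i. i \<in> I \<Longrightarrow> ring_derivation (d i)) \<Longrightarrow> ring_derivation (\<lambda>x. \<Sum>i\<in>I. d i x)"
  by (induction I rule: infinite_finite_induct) (simp_all add: ring_derivation_zero ring_derivation_plus)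

lemma ring_derivation_dp_d1: "ring_derivation dp_d1"
  and ring_derivation_dp_d2: "ring_derivation dp_d2"
  unfolding dp_d1_def dp_d2_def dp_derivation_pder
  by (intro ring_derivation_pder ring_derivation_ratfun_d1 ring_derivation_ratfun_d2)+

interpretation D1: ring_derivation dp_d1 by (fact ring_derivation_dp_d1)
interpretation D2: ring_derivation dp_d2 by (fact ring_derivation_dp_d2)

lemma dp_d1_simps [simp]:
  "dp_d1 (dp_const c) = dp_const (ratfun_d1 c)" "dp_d1 (dp_y i j) = dp_y (Suc i) j"
  unfolding dp_d1_def dp_derivation_pder dp_y_def
  by (simp_all only: pder_const pder_var ring_derivation_ratfun_d1 case_prod_conv)

lemma dp_d2_simps [simp]:
  "dp_d2 (dp_const c) = dp_const (ratfun_d2 c)" "dp_d2 (dp_y i j) = dp_y i (Suc j)"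
  unfolding dp_d2_def dp_derivation_pder dp_y_def
  by (simp_all only: pder_const pder_var ring_derivation_ratfun_d2 case_prod_conv)

subsection \<open>Weights\<close>

definition wt :: "dmonom \<Rightarrow> nat" where
  "wt m = (\<Sum>v\<in>keys m. lookup m v * snd v)"

lemma wt_superset: "finite M \<Longrightarrow> keys m \<subseteq> M \<Longrightarrow> wt m = (\<Sum>v\<in>M. lookup m v * snd v)"
  unfolding wt_def by (intro sum.mono_neutral_left) (auto simp: in_keys_iff)

lemma wt_add: "wt (m + n) = wt m + wt n"
  using wt_superset[of "keys m \<union> keys n" m] wt_superset[of "keys m \<union> keys n" n]
    wt_superset[of "keys m \<union> keys n" "m + n"]
  by (simp add: keys_add_monom lookup_add sum.distrib distrib_right)

lemma wt_single [simp]: "wt (single v k) = k * snd v"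
  using wt_superset[of "{v}" "single v k"] by simp

text \<open>\<open>lower j\<close> is the prolongation to jets of the vector field \<open>- t\<^bsup>j+1\<^esup> \<partial>\<^sub>t / (j + 1)!\<close> on the
  source. The truncated subtraction is harmless, because the binomial coefficient vanishes.\<close>

definition lower :: "nat \<Rightarrow> dpoly \<Rightarrow> dpoly" where
  "lower j = pder (\<lambda>_. 0)
     (\<lambda>v. single (single (fst v, snd v - j) 1) (- of_nat (snd v choose Suc j)))"

lemma ring_derivation_lower: "ring_derivation (lower j)"
  unfolding lower_def by (intro ring_derivation_pder ring_derivation_zero)

lemma lower_const [simp]: "lower j (dp_const c) = 0"
  unfolding lower_def by (simp add: pder_const ring_derivation_zero)

lemma lower_y: "lower j (dp_y i k) = dp_const (- of_nat (k choose Suc j)) * dp_y i (k - j)"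
  unfolding lower_def dp_y_def dp_const_def
  by (simp only: pder_var ring_derivation_zero mult_single fst_conv snd_conv) simp

lemma lower_single:
  "lower j (single m c) = (\<Sum>v\<in>keys m. single (m - single v 1 + single (fst v, snd v - j) 1)
     (- of_nat (snd v choose Suc j) * of_nat (lookup m v) * c))"
  unfolding lower_def
  by (simp add: pder_single ring_derivation_zero pterm_def mult_single mult_ac)

lemma monom_diff_add: "v \<in> keys m \<Longrightarrow> m - single v 1 + single v 1 = m" for m :: dmonom
  by (intro poly_mapping_eqI) (auto simp: lookup_add lookup_minus lookup_single when_def in_keys_iff)

lemma in_keys_sum: "m \<in> keys (sum f I) \<Longrightarrow> \<exists>i\<in>I. m \<in> keys (f i)"
  using subsetD[OF Poly_Mapping.keys_sum, of m f I] by simp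

text \<open>A surviving term has a nonzero binomial coefficient, so \<open>j < snd v\<close> and the
  truncated index \<open>snd v - j\<close> is an honest difference.\<close>

lemma wt_lower:
  assumes "m \<in> keys (lower j A)"
  obtains n where "n \<in> keys A" "wt n = wt m + j"
proof -
  have "lower j A = (\<Sum>n\<in>keys A. lower j (single n (lookup A n)))"
    using ring_derivation.sum[OF ring_derivation_lower, of j "\<lambda>n. single n (lookup A n)" "keys A"]
    by (simp only: poly_mapping_sum_single)
  hence "m \<in> keys (\<Sum>n\<in>keys A. lower j (single n (lookup A n)))" using assms by simp
  from in_keys_sum[OF this] obtain n where n: "n \<in> keys A" "m \<in> keys (lower j (single n (lookup A n)))"
    by blast
  from in_keys_sum[OF n(2)[unfolded lower_single]] obtain v where v: "v \<in> keys n" "m \<in> keys (single (n - single v 1 + single (fst v, snd v - j) 1)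
     (- of_nat (snd v choose Suc j) * of_nat (lookup n v) * lookup A n))"
    by blast
  hence "snd v choose Suc j \<noteq> 0" and m: "m = n - single v 1 + single (fst v, snd v - j) 1"
    by (auto split: if_splits)
  hence "Suc j \<le> snd v" by (metis binomial_eq_0 not_le)
  moreover have "wt n = wt (n - single v 1) + snd v"
    using monom_diff_add[OF v(1)] wt_add[of "n - single v 1" "single v 1"] by simp
  ultimately have "wt n = wt m + j" by (simp add: m wt_add)
  thus ?thesis using that n by blast
qed

text \<open>With \<open>j = 0\<close> the binomial coefficient is \<open>snd v\<close>: the
  derivation is minus the Euler operator of the weight grading, hence diagonal on monomials.\<close>

lemma lookup_lower_0: "lookup (lower 0 A) m = - of_nat (wt m) * lookup A m"
proof -
  have "lower 0 (single n c) = single n (- of_nat (wt n) * c)" for n c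
  proof -
    have "lower 0 (single n c) = (\<Sum>v\<in>keys n. single n (- of_nat (snd v) * of_nat (lookup n v) * c))"
      unfolding lower_single by (intro sum.cong refl) (simp add: monom_diff_add[simplified])
    also have "\<dots> = single n (\<Sum>v\<in>keys n. - of_nat (snd v) * of_nat (lookup n v) * c)"
      by (rule poly_mapping_eqI) (simp add: lookup_sum lookup_single when_def sum.neutral)
    also have "(\<Sum>v\<in>keys n. - of_nat (snd v) * of_nat (lookup n v) * c) = - of_nat (wt n) * c"
      by (simp add: wt_def sum_distrib_left sum_distrib_right sum_negf mult_ac)
    finally show ?thesis .
  qed
  hence "lower 0 A = (\<Sum>n\<in>keys A. single n (- of_nat (wt n) * lookup A n))"
    using poly_mapping_sum_single[of A] ring_derivation.sum[OF ring_derivation_lower, of 0 "\<lambda>n. single n (lookup A n)" "keys A"]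
    by simp
  thus ?thesis by (simp add: lookup_sum lookup_single when_def in_keys_iff)
qed

lemma dp_const_of_nat: "dp_const (of_nat n) = of_nat n"
  by (simp add: dp_const_def)

subsection \<open>Differential ideals containing the vector field\<close>

context
  fixes I :: "dpoly set"
  assumes I: "differential_ideal I"
begin

lemma diff_ideal_0: "0 \<in> I"
  and diff_ideal_add: "A \<in> I \<Longrightarrow> B \<in> I \<Longrightarrow> A + B \<in> I"
  and diff_ideal_mult: "A \<in> I \<Longrightarrow> C * A \<in> I"
  and diff_ideal_d1: "A \<in> I \<Longrightarrow> dp_d1 A \<in> I"
  and diff_ideal_d2: "A \<in> I \<Longrightarrow> dp_d2 A \<in> I"
  using I by (auto simp: differential_ideal_def)

lemma diff_ideal_mult_right: "A \<in> I \<Longrightarrow> A * C \<in> I"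
  using diff_ideal_mult[of A C] by (simp add: mult.commute)

lemma diff_ideal_uminus: "A \<in> I \<Longrightarrow> - A \<in> I"
  using diff_ideal_mult[of A "- 1"] by simp

lemma diff_ideal_diff: "A \<in> I \<Longrightarrow> B \<in> I \<Longrightarrow> A - B \<in> I"
  using diff_ideal_add[OF _ diff_ideal_uminus, of A B] by simp

lemma diff_ideal_const_UNIV:
  assumes "dp_const c \<in> I" "c \<noteq> 0"
  shows "I = UNIV"
proof -
  have "A \<in> I" for A
  proof -
    have "A * dp_const (inverse c) * dp_const c \<in> I" using assms diff_ideal_mult by blast
    moreover have "A * dp_const (inverse c) * dp_const c = A * dp_const (inverse c * c)"
      by (simp only: dp_const_mult mult.assoc)
    ultimately show ?thesis using assms(2) by simp
  qed
  thus ?thesis by auto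
qed

end

lemma differential_ideal_hull: "differential_ideal (diff_ideal_gen S)"
proof -
  have int: "differential_ideal (\<Inter>T)" if "\<forall>J\<in>T. differential_ideal J" for T
    using that unfolding differential_ideal_def by auto
  show ?thesis by (rule hull_in[of differential_ideal S]) (rule int)
qed

definition yder :: "ratfun \<Rightarrow> ratfun \<Rightarrow> ratfun" where
  "yder b f = ratfun_d1 f + b * ratfun_d2 f"

text \<open>Modulo the vector field, the derivation \<open>dyder b\<close>, which is \<open>(X\<^sub>1 \<delta>\<^sub>1 + X\<^sub>2 \<delta>\<^sub>2) / X\<^sub>1\<close> for
  \<open>b = X\<^sub>2 / X\<^sub>1\<close>, acts on polynomials in \<open>y, \<delta>\<^sub>2 y, \<dots>, \<delta>\<^sub>2\<^bsup>s\<^esup> y\<close> as the derivation \<open>eder b s\<close>.\<close>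

definition dyder :: "ratfun \<Rightarrow> dpoly \<Rightarrow> dpoly" where
  "dyder b A = dp_d1 A + dp_const b * dp_d2 A"

definition eder :: "ratfun \<Rightarrow> nat \<Rightarrow> dpoly \<Rightarrow> dpoly" where
  "eder b s A = pder (yder b) (\<lambda>_. 0) A + (\<Sum>j\<le>s. dp_const ((ratfun_d2 ^^ Suc j) b) * lower j A)"

lemma ring_derivation_yder: "ring_derivation (yder b)"
  unfolding yder_def[abs_def]
  by (intro ring_derivation_plus ring_derivation_scale ring_derivation_ratfun_d1 ring_derivation_ratfun_d2)

lemma ring_derivation_dyder: "ring_derivation (dyder b)"
  unfolding dyder_def[abs_def]
  by (intro ring_derivation_plus ring_derivation_scale ring_derivation_dp_d1 ring_derivation_dp_d2)

lemma ring_derivation_eder: "ring_derivation (eder b s)"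
  unfolding eder_def[abs_def]
  by (intro ring_derivation_plus ring_derivation_sum ring_derivation_scale ring_derivation_lower
      ring_derivation_pder ring_derivation_yder)

interpretation yder: ring_derivation "yder b" for b by (fact ring_derivation_yder)
interpretation dyder: ring_derivation "dyder b" for b by (fact ring_derivation_dyder)
interpretation eder: ring_derivation "eder b s" for b s by (fact ring_derivation_eder)
interpretation lower: ring_derivation "lower j" for j by (fact ring_derivation_lower)

lemma yder_const [simp]: "yder b (ratfun_const c) = 0"
  by (simp add: yder_def)

abbreviation ords :: "nat \<Rightarrow> deriv_index set" where
  "ords s \<equiv> {0} \<times> {..s}"

abbreviation "d2n j b \<equiv> (ratfun_d2 ^^ j) b"

text \<open>The element \<open>\<delta>\<^sub>2\<^bsup>k\<^esup> (\<delta>\<^sub>1 y + b \<delta>\<^sub>2 y)\<close>.\<close>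

definition vf_deriv :: "ratfun \<Rightarrow> nat \<Rightarrow> dpoly" where
  "vf_deriv b k = dp_y 1 k + (\<Sum>j\<le>k. dp_const (of_nat (k choose j) * d2n j b) * dp_y 0 (Suc k - j))"

lemma d2_vf_deriv: "dp_d2 (vf_deriv b k) = vf_deriv b (Suc k)"
proof -
  define f where "f j = dp_const (of_nat (k choose j) * d2n j b) * dp_y 0 (Suc (Suc k) - j)" for j
  define h where "h j = dp_const (of_nat (k choose j) * d2n (Suc j) b) * dp_y 0 (Suc k - j)" for j
  have "dp_d2 (dp_const (of_nat (k choose j) * d2n j b) * dp_y 0 (Suc k - j)) = h j + f j" if "j \<le> k" for j
    using that by (simp add: f_def h_def D2.mult d2.mult Suc_diff_le)
  hence "dp_d2 (vf_deriv b k) = dp_y 1 (Suc k) + (\<Sum>j\<le>k. h j + f j)"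
    by (simp add: vf_deriv_def D2.add D2.sum)
  also have "(\<Sum>j\<le>k. h j + f j) = (\<Sum>j\<le>Suc k. f j) + (\<Sum>j\<le>k. h j)"
    by (simp add: sum.distrib f_def binomial_eq_0)
  also have "(\<Sum>j\<le>Suc k. f j) = f 0 + (\<Sum>j\<le>k. f (Suc j))"
    by (rule sum.atMost_Suc_shift)
  also have "f 0 + (\<Sum>j\<le>k. f (Suc j)) + (\<Sum>j\<le>k. h j) = f 0 + (\<Sum>j\<le>k. f (Suc j) + h j)"
    by (simp add: sum.distrib)
  also have "\<dots> = (\<Sum>j\<le>Suc k. dp_const (of_nat (Suc k choose j) * d2n j b) * dp_y 0 (Suc (Suc k) - j))"
    unfolding sum.atMost_Suc_shift
    by (simp add: f_def h_def dp_const_add distrib_right distrib_left add.commute)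
  finally show ?thesis by (simp add: vf_deriv_def)
qed

text \<open>In the Leibniz expansion \<open>vf_deriv b k\<close> the term with the undifferentiated
  \<open>b\<close> belongs to \<open>dyder\<close>; the remaining ones, shifted by one, form minus
  \<open>eder\<close>. Cutting the sum in \<open>eder\<close> at \<open>s\<close> loses nothing,
  since \<open>k choose Suc j\<close> vanishes for \<open>j \<ge> k\<close>.\<close>

lemma dyder_minus_eder_y:
  assumes "k \<le> s"
  shows "dyder b (dp_y 0 k) - eder b s (dp_y 0 k) = vf_deriv b k"
proof -
  define f where "f j = dp_const (of_nat (k choose j) * d2n j b) * dp_y 0 (Suc k - j)" for j
  have p: "pder (yder b) (\<lambda>_. 0) (dp_y 0 k) = 0"
    unfolding dp_y_def by (rule pder_var[OF ring_derivation_yder])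
  have "eder b s (dp_y 0 k) = (\<Sum>j\<le>s. - f (Suc j))"
    unfolding eder_def p by (simp add: lower_y f_def dp_const_uminus dp_const_mult mult_ac)
  also have "\<dots> = (\<Sum>j<k. - f (Suc j))"
    using assms by (intro sum.mono_neutral_right) (auto simp: f_def binomial_eq_0)
  finally have "dyder b (dp_y 0 k) - eder b s (dp_y 0 k) = dp_y 1 k + (f 0 + (\<Sum>j<k. f (Suc j)))"
    by (simp add: dyder_def f_def sum_negf)
  also have "f 0 + (\<Sum>j<k. f (Suc j)) = (\<Sum>j\<le>k. f j)"
    by (cases k) (simp_all only: lessThan_Suc_atMost sum.atMost_Suc_shift, simp)
  finally show ?thesis by (simp add: vf_deriv_def f_def)
qed

lemma pder_yder_const: "eder b s (dp_const c) = dp_const (yder b c)"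
  by (simp add: eder_def pder_const ring_derivation_yder)

context
  fixes I :: "dpoly set" and b :: ratfun
  assumes I: "differential_ideal I" and b: "dp_y 1 0 + dp_const b * dp_y 0 1 \<in> I"
begin

lemma vf_deriv_in: "vf_deriv b k \<in> I"
proof (induction k)
  case 0
  show ?case using b by (simp add: vf_deriv_def)
next
  case (Suc k)
  thus ?case using diff_ideal_d2[OF I] d2_vf_deriv by metis
qed

text \<open>Two derivations that agree modulo an ideal on generators agree modulo it on all
  polynomials in them, since the defect of a product is a combination of the defects of its
  factors.\<close>

lemma dyder_minus_eder:
  assumes "A \<in> polys_in (ords s)"
  shows "dyder b A - eder b s A \<in> I"
  using assms
proof (induction A rule: polys_in_induct)
  case (const c)
  have "dyder b (dp_const c) - eder b s (dp_const c) = 0"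
    by (simp add: pder_yder_const dyder_def yder_def dp_const_add dp_const_mult)
  thus ?case using diff_ideal_0[OF I] by simp
next
  case (var i j)
  thus ?case using dyder_minus_eder_y[of j s b] vf_deriv_in[of j] by auto
next
  case (add A B)
  have "dyder b (A + B) - eder b s (A + B) = (dyder b A - eder b s A) + (dyder b B - eder b s B)"
    by (simp add: dyder.add eder.add)
  thus ?case using add diff_ideal_add[OF I] by simp
next
  case (mult A B)
  have "dyder b (A * B) - eder b s (A * B) = (dyder b A - eder b s A) * B + A * (dyder b B - eder b s B)"
    by (simp add: dyder.mult eder.mult algebra_simps)
  thus ?case using mult diff_ideal_add[OF I] diff_ideal_mult[OF I] diff_ideal_mult_right[OF I] by simp
qed

lemma eder_in:
  assumes "A \<in> I" "A \<in> polys_in (ords s)"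
  shows "eder b s A \<in> I"
proof -
  have "dyder b A \<in> I"
    unfolding dyder_def by (intro diff_ideal_add[OF I] diff_ideal_mult[OF I] diff_ideal_d1[OF I] diff_ideal_d2[OF I] assms)
  from diff_ideal_diff[OF I this dyder_minus_eder[OF assms(2)]] show ?thesis by simp
qed

end

lemma polys_in_mono: "A \<in> polys_in V \<Longrightarrow> V \<subseteq> W \<Longrightarrow> A \<in> polys_in W"
  by (auto simp: polys_in_def)

lemma finite_derivs_in [simp]: "finite (derivs_in A)"
  by (simp add: derivs_in_def)

lemma polys_in_ordsE:
  assumes "A \<in> polys_in ({0} \<times> UNIV)"
  obtains s where "A \<in> polys_in (ords s)"
proof
  show "A \<in> polys_in (ords (Max (insert 0 (snd ` derivs_in A))))"
    using assms by (auto simp: polys_in_def intro!: Max_ge image_eqI[where x = "(0, _)"])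
qed

lemma polys_in_lower: "A \<in> polys_in (ords s) \<Longrightarrow> lower j A \<in> polys_in (ords s)"
  unfolding lower_def by (rule polys_in_pder) (auto intro!: polys_in_single)

lemma polys_in_eder: "A \<in> polys_in (ords s) \<Longrightarrow> eder b s A \<in> polys_in (ords s)"
  unfolding eder_def
  by (intro polys_in_add polys_in_sum polys_in_mult polys_in_const polys_in_lower polys_in_pder) auto

text \<open>On polynomials in the pure x2-derivatives, differentiation along x1 is congruent to
  \<open>eder b s\<close> minus \<open>b\<close> times differentiation along x2, and neither leaves
  this ring. Induction on the number of x1-derivatives removes them all.\<close>

lemma reduce_to_ords:
  assumes I: "differential_ideal I" and b: "dp_y 1 0 + dp_const b * dp_y 0 1 \<in> I"
  shows "\<exists>B'\<in>polys_in ({0} \<times> UNIV). B - B' \<in> I"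
proof -
  have "B \<in> polys_in UNIV" by (simp add: polys_in_def)
  thus ?thesis
  proof (induction B rule: polys_in_induct)
    case (const c)
    show ?case by (rule bexI[of _ "dp_const c"]) (simp_all add: diff_ideal_0[OF I])
  next
    case (var i j)
    show ?case
    proof (induction i)
      case 0
      show ?case by (rule bexI[of _ "dp_y 0 j"]) (simp_all add: diff_ideal_0[OF I] polys_in_y)
    next
      case (Suc i)
      then obtain B where B: "B \<in> polys_in ({0} \<times> UNIV)" "dp_y i j - B \<in> I" by blast
      then obtain s where s: "B \<in> polys_in (ords s)" using polys_in_ordsE by blast
      define B' where "B' = eder b s B - dp_const b * dp_d2 B"
      have "dp_d2 B \<in> polys_in ({0} \<times> UNIV)"
        unfolding dp_d2_def dp_derivation_pder by (rule polys_in_pder[OF B(1)]) (auto intro!: polys_in_single)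
      hence "B' \<in> polys_in ({0} \<times> UNIV)"
        unfolding B'_def using polys_in_eder[OF s]
        by (intro polys_in_diff polys_in_mult polys_in_const) (auto intro: polys_in_mono)
      moreover have "dp_y (Suc i) j - B' = dp_d1 (dp_y i j - B) + (dyder b B - eder b s B)"
        by (simp add: B'_def dyder_def D1.diff)
      hence "dp_y (Suc i) j - B' \<in> I"
        using diff_ideal_add[OF I diff_ideal_d1[OF I B(2)] dyder_minus_eder[OF I b s]] by simp
      ultimately show ?case by blast
    qed
  next
    case (add A B)
    then obtain A' B' where *: "A' \<in> polys_in ({0} \<times> UNIV)" "A - A' \<in> I" "B' \<in> polys_in ({0} \<times> UNIV)" "B - B' \<in> I"
      by blast
    have "A + B - (A' + B') = (A - A') + (B - B')" by simp
    hence "A + B - (A' + B') \<in> I" using diff_ideal_add[OF I *(2,4)] by (simp only:)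
    thus ?case using polys_in_add[OF *(1,3)] by blast
  next
    case (mult A B)
    then obtain A' B' where *: "A' \<in> polys_in ({0} \<times> UNIV)" "A - A' \<in> I" "B' \<in> polys_in ({0} \<times> UNIV)" "B - B' \<in> I"
      by blast
    have "A * B - A' * B' = (A - A') * B + A' * (B - B')" by (simp add: algebra_simps)
    hence "A * B - A' * B' \<in> I"
      using diff_ideal_add[OF I diff_ideal_mult_right[OF I *(2)] diff_ideal_mult[OF I *(4)]] by simp
    thus ?case using polys_in_mult[OF *(1,3)] by blast
  qed
qed

subsection \<open>Semi-invariants\<close>

lemma lookup_pder_0:
  assumes "ring_derivation d"
  shows "lookup (pder d (\<lambda>_. 0) A) m = d (lookup A m)"
  using ring_derivation.zero[OF assms]
  by (simp add: pder_def pterm_def lookup_sum lookup_single when_def in_keys_iff)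

lemma lookup_eder:
  "lookup (eder b s A) m = yder b (lookup A m) + (\<Sum>j\<le>s. d2n (Suc j) b * lookup (lower j A) m)"
  by (simp add: eder_def lookup_add lookup_sum lookup_dp_const_mult lookup_pder_0 ring_derivation_yder del: funpow.simps)

lemma lookup_lower_eq_0:
  assumes "\<And>n. n \<in> keys A \<Longrightarrow> wt n \<noteq> wt m + j"
  shows "lookup (lower j A) m = 0"
  using wt_lower[of m j A] assms by (auto simp: in_keys_iff)

text \<open>Contributions of positive \<open>j\<close> to a monomial of weight at least
  \<open>w\<close> would have to come from weights above \<open>w\<close>, where there is
  nothing.\<close>

lemma lookup_eder_top:
  assumes "\<And>n. n \<in> keys A \<Longrightarrow> wt n \<le> w" "w \<le> wt m"
  shows "lookup (eder b s A) m = yder b (lookup A m) - of_nat (wt m) * ratfun_d2 b * lookup A m"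
proof -
  have "(\<Sum>j\<le>s. d2n (Suc j) b * lookup (lower j A) m) = (\<Sum>j\<in>{0}. d2n (Suc j) b * lookup (lower j A) m)"
    using assms by (intro sum.mono_neutral_right) (auto intro!: lookup_lower_eq_0 dest: assms(1))
  thus ?thesis by (simp add: lookup_eder lookup_lower_0)
qed

text \<open>Among the elements of least weight one with the fewest terms of top weight is chosen and made
  monic at one of them; then \<open>eder b s P + w (\<delta>\<^sub>2 b) P\<close> would be smaller if it were nonzero.\<close>

lemma semi_invariant_exists:
  assumes I: "differential_ideal I" and b: "dp_y 1 0 + dp_const b * dp_y 0 1 \<in> I"
    and P0: "P0 \<in> I" "P0 \<in> polys_in (ords s)" "P0 \<noteq> 0"
  obtains P w m0 where "P \<in> I" "P \<in> polys_in (ords s)"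
    "eder b s P = - dp_const (of_nat w * ratfun_d2 b) * P"
    "\<And>m. m \<in> keys P \<Longrightarrow> wt m \<le> w" "lookup P m0 = 1" "wt m0 = w"
proof -
  define S where "S = {P \<in> I. P \<in> polys_in (ords s) \<and> P \<noteq> 0}"
  define W where "W P = Max (wt ` keys P)" for P :: dpoly
  have W: "wt m \<le> W P" if "m \<in> keys P" for m P using that by (simp add: W_def)
  have Wex: "\<exists>m\<in>keys P. wt m = W P" if "P \<noteq> 0" for P
  proof -
    have "W P \<in> wt ` keys P" unfolding W_def using that by (intro Max_in) auto
    thus ?thesis by auto
  qed
  define C where "C P = card {m \<in> keys P. wt m = W P}" for P :: dpoly
  have "P0 \<in> S" using P0 by (simp add: S_def)
  then obtain P1 where P1: "P1 \<in> S" "\<And>P. P \<in> S \<Longrightarrow> W P1 \<le> W P"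
    using ex_has_least_nat[of "\<lambda>P. P \<in> S" P0 W] by blast
  obtain P where P: "P \<in> S" "W P = W P1" "\<And>P'. P' \<in> S \<Longrightarrow> W P' = W P1 \<Longrightarrow> C P \<le> C P'"
    using ex_has_least_nat[of "\<lambda>P. P \<in> S \<and> W P = W P1" P1 C] P1(1) by blast
  define w where "w = W P1"
  have "P \<noteq> 0" using P(1) by (simp add: S_def)
  then obtain m0 where m0: "m0 \<in> keys P" "wt m0 = w" using Wex[of P] P(2) w_def by auto
  define c where "c = inverse (lookup P m0)"
  have c: "c \<noteq> 0" using m0 by (simp add: c_def in_keys_iff)
  define P' where "P' = dp_const c * P"
  have look: "lookup P' m = c * lookup P m" for m by (simp add: P'_def lookup_dp_const_mult)
  have keys: "keys P' = keys P" using c by (auto simp: in_keys_iff look)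
  have P'I: "P' \<in> I" using P(1) diff_ideal_mult[OF I] by (simp add: P'_def S_def)
  have P'p: "P' \<in> polys_in (ords s)" using P(1) by (simp add: P'_def S_def polys_in_mult)
  define R where "R = eder b s P' + dp_const (of_nat w * ratfun_d2 b) * P'"
  have RI: "R \<in> I"
    unfolding R_def by (intro diff_ideal_add[OF I] diff_ideal_mult[OF I] eder_in[OF I b] P'I P'p)
  have Rp: "R \<in> polys_in (ords s)"
    unfolding R_def by (intro polys_in_add polys_in_mult polys_in_const polys_in_eder P'p)
  have wle: "wt m \<le> w" if "m \<in> keys P'" for m using that W[of m P] P(2) by (simp add: keys w_def)
  have Rl: "lookup R m = yder b (lookup P' m) - of_nat (wt m) * ratfun_d2 b * lookup P' m
      + of_nat w * ratfun_d2 b * lookup P' m" if "w \<le> wt m" for m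
    using lookup_eder_top[OF wle that] by (simp add: R_def lookup_add lookup_dp_const_mult)
  have "R = 0"
  proof (rule ccontr)
    assume "R \<noteq> 0"
    hence RS: "R \<in> S" using RI Rp by (simp add: S_def)
    \<comment> \<open>In weight \<open>w\<close> the coefficients of \<open>R\<close> are
      \<open>yder b\<close> of those of \<open>P'\<close>. No new monomial appears, and
      \<open>m0\<close> is lost because its coefficient 1 is constant.\<close>
    have top: "m \<in> keys P' \<and> m \<noteq> m0" if "m \<in> keys R" "w \<le> wt m" for m
    proof -
      have "lookup R m \<noteq> 0" using that(1) by (simp add: in_keys_iff)
      hence 1: "m \<in> keys P'" using Rl[OF that(2)] by (auto simp: in_keys_iff)
      hence "wt m = w" using wle that(2) by force
      hence "lookup R m = yder b (lookup P' m)" using Rl[OF that(2)] by simp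
      moreover have "lookup P' m0 = 1" using m0 by (simp add: look c_def in_keys_iff)
      ultimately have "m \<noteq> m0" using \<open>lookup R m \<noteq> 0\<close> by auto
      with 1 show ?thesis by simp
    qed
    obtain m1 where m1: "m1 \<in> keys R" "wt m1 = W R" using Wex[OF \<open>R \<noteq> 0\<close>] by blast
    have "w \<le> W R" using P1(2)[OF RS] by (simp add: w_def)
    hence "W R = w" using top[of m1] m1 wle[of m1] by simp
    have "{m \<in> keys R. wt m = W R} \<subseteq> {m \<in> keys P. wt m = W P} - {m0}"
    proof
      fix m assume "m \<in> {m \<in> keys R. wt m = W R}"
      thus "m \<in> {m \<in> keys P. wt m = W P} - {m0}"
        using top[of m] \<open>W R = w\<close> P(2) keys by (simp add: w_def)
    qed
    hence "C R \<le> card ({m \<in> keys P. wt m = W P} - {m0})" unfolding C_def by (intro card_mono) auto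
    also have "\<dots> < C P" unfolding C_def using m0 P(2) by (intro card_Diff1_less) (auto simp: w_def)
    finally show False using P(3)[OF RS] \<open>W R = w\<close> by (simp add: w_def)
  qed
  hence "eder b s P' = - dp_const (of_nat w * ratfun_d2 b) * P'"
    by (simp add: R_def eq_neg_iff_add_eq_0)
  moreover have "lookup P' m0 = 1" using m0 by (simp add: look c_def in_keys_iff)
  ultimately show ?thesis using that P'I P'p wle m0(2) by blast
qed

subsection \<open>The lowering derivations\<close>

text \<open>The Witt algebra relation between the vector fields of which these derivations are
  prolongations; the factor 2 clears the denominators left by the factorials. Both sides are
  derivations, so it suffices to compare them on symbols. The coefficient vanishes at
  \<open>j = 1\<close>, so \<open>lower 2\<close> is not obtained in this way.\<close>

lemma lower_commutator:
  assumes "j \<ge> 1"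
  shows "2 * (lower 1 (lower j A) - lower j (lower 1 A)) = of_nat ((j + 2) * (j - 1)) * lower (Suc j) A"
proof -
  have "A \<in> polys_in UNIV" by (simp add: polys_in_def)
  thus ?thesis
  proof (induction A rule: polys_in_induct)
    case (const c)
    show ?case by simp
  next
    case (add A B)
    thus ?case by (simp add: lower.add algebra_simps)
  next
    case (mult A B)
    have "2 * (lower 1 (lower j (A * B)) - lower j (lower 1 (A * B)))
      = 2 * (lower 1 (lower j A) - lower j (lower 1 A)) * B + A * (2 * (lower 1 (lower j B) - lower j (lower 1 B)))"
      by (simp add: lower.mult lower.add algebra_simps)
    also have "\<dots> = of_nat ((j + 2) * (j - 1)) * lower (Suc j) (A * B)"
      unfolding mult by (simp add: lower.mult algebra_simps)
    finally show ?case .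
  next
    case (var i k)
    have nat_id: "2 * ((k choose Suc j) * ((k - j) choose 2)) + (j + 2) * (j - 1) * (k choose Suc (Suc j))
        = 2 * ((k choose 2) * ((k - 1) choose Suc j))"
    proof (cases "Suc j \<le> k")
      case False
      thus ?thesis by (simp add: binomial_eq_0)
    next
      case True
      \<comment> \<open>With this product the three terms of the identity become
        \<open>(k - j) * x\<close>, \<open>(j - 1) * x\<close> and
        \<open>(k - 1) * x\<close>.\<close>
      define x where "x = (k - Suc j) * (k choose Suc j)"
      have x1: "x = k * ((k - 1) choose Suc j)" unfolding x_def by (rule binomial_absorb_comp)
      have x2: "Suc (Suc j) * (k choose Suc (Suc j)) = x"
        using x1 binomial_absorption[of "Suc j" k] by simp
      have c2: "2 * (n choose 2) = n * (n - 1)" for n :: nat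
      proof -
        have "even (n * (n - 1))" by (cases n) auto
        thus ?thesis by (simp add: choose_two)
      qed
      have "2 * ((k choose Suc j) * ((k - j) choose 2)) = (k choose Suc j) * (2 * ((k - j) choose 2))" by simp
      also have "\<dots> = (k - j) * x" unfolding c2 x_def by simp
      finally have 1: "2 * ((k choose Suc j) * ((k - j) choose 2)) = (k - j) * x" .
      have "2 * ((k choose 2) * ((k - 1) choose Suc j)) = (2 * (k choose 2)) * ((k - 1) choose Suc j)" by simp
      also have "\<dots> = (k - 1) * x" unfolding c2 x1 by simp
      finally have 2: "2 * ((k choose 2) * ((k - 1) choose Suc j)) = (k - 1) * x" .
      have "(j + 2) * (j - 1) * (k choose Suc (Suc j)) = (j - 1) * (Suc (Suc j) * (k choose Suc (Suc j)))"
        by (simp only: add_2_eq_Suc' mult_ac)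
      hence 3: "(j + 2) * (j - 1) * (k choose Suc (Suc j)) = (j - 1) * x" unfolding x2 .
      have "(k - j) * x + (j - 1) * x = (k - 1) * x"
        using True assms by (simp add: distrib_right[symmetric])
      thus ?thesis unfolding 1 2 3 .
    qed
    define Y where "Y = dp_y i (k - Suc j)"
    have kj: "k - 1 - j = k - Suc j" "k - j - 1 = k - Suc j" by auto
    have l1: "lower 1 (lower j (dp_y i k)) = of_nat ((k choose Suc j) * ((k - j) choose 2)) * Y"
      unfolding lower_y lower.mult lower_const by (simp add: lower_y dp_const_uminus Y_def kj numeral_2_eq_2 dp_const_of_nat)
    have l2: "lower j (lower 1 (dp_y i k)) = of_nat ((k choose 2) * ((k - 1) choose Suc j)) * Y"
      unfolding lower_y lower.mult lower_const by (simp add: lower_y dp_const_uminus Y_def kj numeral_2_eq_2 dp_const_of_nat)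
    have l3: "lower (Suc j) (dp_y i k) = - of_nat (k choose Suc (Suc j)) * Y"
      by (simp add: lower_y Y_def dp_const_uminus dp_const_of_nat)
    have "of_nat (2 * ((k choose Suc j) * ((k - j) choose 2)) + (j + 2) * (j - 1) * (k choose Suc (Suc j)))
        = (of_nat (2 * ((k choose 2) * ((k - 1) choose Suc j))) :: dpoly)"
      unfolding nat_id ..
    hence id: "2 * of_nat ((k choose Suc j) * ((k - j) choose 2)) - 2 * of_nat ((k choose 2) * ((k - 1) choose Suc j))
        = - of_nat ((j + 2) * (j - 1)) * (of_nat (k choose Suc (Suc j)) :: dpoly)"
      unfolding of_nat_add of_nat_mult[of 2] of_nat_mult[of "(j + 2) * (j - 1)"] of_nat_numeral
      by (simp only: eq_diff_eq[symmetric]) (simp add: algebra_simps)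
    show ?case
      unfolding l1 l2 l3 using arg_cong[OF id, of "\<lambda>t. t * Y"] by (simp add: algebra_simps)
  qed
qed

lemma of_nat_mult_dpoly_eq_0: "of_nat n * A = 0 \<Longrightarrow> n \<noteq> 0 \<Longrightarrow> A = (0 :: dpoly)"
proof (rule poly_mapping_eqI)
  fix m assume "of_nat n * A = 0" "n \<noteq> 0"
  hence "lookup (dp_const (of_nat n) * A) m = 0" by (simp add: dp_const_of_nat)
  thus "lookup A m = lookup 0 m" using \<open>n \<noteq> 0\<close> by (simp add: lookup_dp_const_mult)
qed

text \<open>As \<open>lower j\<close> prolongs a reparametrisation vector field \<open>t\<^bsup>j+1\<^esup> \<partial>\<^sub>t\<close>, those with \<open>j = 1, 2\<close>
  generate all the others.\<close>

lemma lower_eq_0_if: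
  assumes "lower 1 Q = 0" "lower 2 Q = 0" "j \<ge> 1"
  shows "lower j Q = 0"
  using assms(3)
proof (induction j rule: dec_induct)
  case (step j)
  show ?case
  proof (cases "j = 1")
    case True
    thus ?thesis using assms(2) by (simp add: numeral_2_eq_2)
  next
    case False
    have "of_nat ((j + 2) * (j - 1)) * lower (Suc j) Q = 0"
      using lower_commutator[of j Q] step assms(1) by simp
    thus ?thesis by (rule of_nat_mult_dpoly_eq_0) (use step False in auto)
  qed
qed (use assms in simp)

lemma lower_eq_0_ords:
  assumes "A \<in> polys_in (ords s)" "s \<le> j"
  shows "lower j A = 0"
  using assms(1)
proof (induction A rule: polys_in_induct)
  case (var i k)
  thus ?case using assms(2) by (simp add: lower_y binomial_eq_0)
qed (auto simp: lower.add lower.mult)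

lemma lookup_lower:
  "lookup (lower j A) k = (\<Sum>m\<in>keys A. \<Sum>v\<in>keys m.
     (- of_nat (snd v choose Suc j) * of_nat (lookup m v) * lookup A m) when
     m - single v 1 + single (fst v, snd v - j) 1 = k)"
proof -
  have "lower j A = (\<Sum>m\<in>keys A. lower j (single m (lookup A m)))"
    using lower.sum[of j "\<lambda>n. single n (lookup A n)" "keys A"] by (simp only: poly_mapping_sum_single)
  thus ?thesis by (simp only: lower_single lookup_sum lookup_single)
qed

text \<open>If \<open>k \<ge> 2\<close> is the highest order that occurs,
  \<open>lower (k - 1)\<close> annihilates all symbols of lower order and sends the one of order
  \<open>k\<close> to minus the one of order 1. It acts as minus the symbol of order 1 times the
  partial derivative with respect to that of order \<open>k\<close>, and the result is nonzero as
  soon as the latter occurs.\<close>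

lemma polys_in_ords_1_if_lower:
  assumes Q: "Q \<in> polys_in (ords s)" and low: "\<And>j. j \<ge> 1 \<Longrightarrow> lower j Q = 0"
  shows "Q \<in> polys_in (ords 1)"
proof (rule ccontr)
  assume *: "Q \<notin> polys_in (ords 1)"
  define k where "k = Max (snd ` derivs_in Q)"
  have kmax: "snd v \<le> k" if "v \<in> derivs_in Q" for v using that by (simp add: k_def)
  from * obtain v0 where v0: "v0 \<in> derivs_in Q" "v0 \<notin> ords 1" by (auto simp: polys_in_def)
  have fst0: "fst v = 0" if "v \<in> derivs_in Q" for v using Q that by (auto simp: polys_in_def)
  have k2: "k \<ge> 2" using kmax[OF v0(1)] v0 fst0[OF v0(1)] by (cases v0) auto
  have "k \<in> snd ` derivs_in Q" unfolding k_def using v0 by (intro Max_in) auto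
  hence "(0, k) \<in> derivs_in Q" using fst0 by force
  then obtain m where m: "m \<in> keys Q" "(0, k) \<in> keys m" by (auto simp: derivs_in_def)
  define v where "v = (0 :: nat, k)"
  \<comment> \<open>One factor of order \<open>k\<close> is replaced by one of order 1. This is
    injective on monomials containing such a factor, so no cancellation can occur.\<close>
  define sh where "sh n = n - single v 1 + single (0, 1) 1" for n :: dmonom
  have "lookup (lower (k - 1) Q) (sh m)
      = (\<Sum>n\<in>keys Q. if n = m then - of_nat (lookup m v) * lookup Q m else 0)"
    unfolding lookup_lower
  proof (rule sum.cong[OF refl])
    fix n assume n: "n \<in> keys Q"
    have "(\<Sum>u\<in>keys n. (- of_nat (snd u choose Suc (k - 1)) * of_nat (lookup n u) * lookup Q n) when
        n - single u 1 + single (fst u, snd u - (k - 1)) 1 = sh m)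
      = (\<Sum>u\<in>keys n. if u = v then - of_nat (lookup n v) * lookup Q n when sh n = sh m else 0)"
    proof (rule sum.cong[OF refl])
      fix u assume "u \<in> keys n"
      hence u: "u \<in> derivs_in Q" using n by (auto simp: derivs_in_def)
      show "((- of_nat (snd u choose Suc (k - 1)) * of_nat (lookup n u) * lookup Q n) when
          n - single u 1 + single (fst u, snd u - (k - 1)) 1 = sh m)
        = (if u = v then - of_nat (lookup n v) * lookup Q n when sh n = sh m else 0)"
      proof (cases "u = v")
        case True
        thus ?thesis using k2 by (simp add: v_def sh_def)
      next
        case False
        hence "snd u < k" using kmax[OF u] fst0[OF u] by (cases u) (auto simp: v_def)
        hence c0: "snd u choose Suc (k - 1) = 0" using k2 by (intro binomial_eq_0) simp
        show ?thesis using False by (simp only: c0 of_nat_0 minus_zero mult_zero_left zero_when if_False)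
      qed
    qed
    also have "\<dots> = (if v \<in> keys n then - of_nat (lookup n v) * lookup Q n when sh n = sh m else 0)"
      by simp
    also have "\<dots> = (if n = m then - of_nat (lookup m v) * lookup Q m else 0)"
    proof (cases "v \<in> keys n \<and> sh n = sh m")
      case True
      hence "n - single v 1 = m - single v 1" by (simp add: sh_def)
      hence "n - single v 1 + single v 1 = m - single v 1 + single v 1" by simp
      hence "n = m" using True m(2) by (simp only: monom_diff_add v_def)
      thus ?thesis using True by simp
    next
      case False
      thus ?thesis using m(2) by (auto simp: v_def when_def)
    qed
    finally show "(\<Sum>u\<in>keys n. (- of_nat (snd u choose Suc (k - 1)) * of_nat (lookup n u) * lookup Q n) when
        n - single u 1 + single (fst u, snd u - (k - 1)) 1 = sh m) = \<dots>" .
  qed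
  also have "\<dots> = - of_nat (lookup m v) * lookup Q m" using m(1) by simp
  also have "\<dots> \<noteq> 0" using m by (simp add: v_def in_keys_iff)
  finally show False using low[of "k - 1"] k2 by simp
qed

lemma ratfun_const_range_closed:
  "f \<in> range ratfun_const \<Longrightarrow> g \<in> range ratfun_const \<Longrightarrow> f + g \<in> range ratfun_const"
  "f \<in> range ratfun_const \<Longrightarrow> g \<in> range ratfun_const \<Longrightarrow> f * g \<in> range ratfun_const"
  "f \<in> range ratfun_const \<Longrightarrow> - f \<in> range ratfun_const"
  "of_nat n \<in> range ratfun_const" "0 \<in> range ratfun_const"
  by (auto simp flip: ratfun_const_add ratfun_const_mult ratfun_const_uminus ratfun_const_of_nat ratfun_const_0)

lemma ratfun_const_range_sum:
  "(\<And>x. x \<in> S \<Longrightarrow> f x \<in> range ratfun_const) \<Longrightarrow> sum f S \<in> range ratfun_const"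
  by (induction S rule: infinite_finite_induct) (simp_all add: ratfun_const_range_closed del: image_iff)

lemma lookup_lower_const:
  assumes "\<And>m. lookup A m \<in> range ratfun_const"
  shows "lookup (lower j A) k \<in> range ratfun_const"
  unfolding lookup_lower when_def using assms
  by (intro ratfun_const_range_sum) (simp add: ratfun_const_range_closed del: image_iff)

definition wpart :: "nat \<Rightarrow> dpoly \<Rightarrow> dpoly" where
  "wpart w A = (\<Sum>m\<in>{m\<in>keys A. wt m = w}. single m (lookup A m))"

lemma lookup_wpart: "lookup (wpart w A) m = (if wt m = w then lookup A m else 0)"
  by (simp add: wpart_def lookup_sum lookup_single when_def in_keys_iff)

text \<open>The equation is compared in the weights \<open>w\<close> and \<open>w - j\<close>, with \<open>j\<close> the least positive number for
  which a term of weight \<open>w - j\<close> occurs at all.\<close>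

lemma semi_invariant_cases:
  assumes P: "P \<in> polys_in (ords s)" and E: "eder b s P = - dp_const (of_nat w * ratfun_d2 b) * P"
    and le': "\<forall>m\<in>keys P. wt m \<le> w" and m0: "lookup P m0 = 1" "wt m0 = w"
  shows "(\<exists>a. a \<notin> range ratfun_const \<and> yder b a = 0) \<or>
    (1 \<le> s \<and> (\<exists>n a. 0 < n \<and> a \<noteq> 0 \<and> yder b a = - of_nat n * ratfun_d2 b * a)) \<or>
    (2 \<le> s \<and> (\<exists>a. yder b a + ratfun_d2 b * a + d2n 2 b = 0)) \<or>
    (3 \<le> s \<and> (\<exists>a. yder b a + 2 * ratfun_d2 b * a + 2 * d2n 3 b = 0)) \<or>
    (P \<in> polys_in (ords 1) \<and> (\<forall>m\<in>keys P. wt m = w) \<and> (\<forall>m. lookup P m \<in> range ratfun_const))"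
    (is "?C0 \<or> ?C1 \<or> ?C2 \<or> ?C3 \<or> ?C4")
proof (cases "\<forall>m. wt m = w \<longrightarrow> lookup P m \<in> range ratfun_const")
  note le = bspec[OF le']
  case False
  then obtain m where m: "wt m = w" "lookup P m \<notin> range ratfun_const" by blast
  have "lookup (eder b s P) m = - (of_nat w * ratfun_d2 b * lookup P m)"
    by (simp add: E lookup_dp_const_mult)
  moreover have "lookup (eder b s P) m = yder b (lookup P m) - of_nat w * ratfun_d2 b * lookup P m"
    using lookup_eder_top[where A = P and w = w and m = m and b = b and s = s, OF le] by (simp only: m(1) order_refl)
  ultimately have "yder b (lookup P m) - of_nat w * ratfun_d2 b * lookup P m = - (of_nat w * ratfun_d2 b * lookup P m)"
    by (simp only:)
  hence "yder b (lookup P m) = 0" by (simp only: diff_eq_eq left_minus)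
  with m(2) have ?C0 by blast
  thus ?thesis by (rule disjI1)
next
  note le = bspec[OF le']
  case cst: True
  define Q where "Q = wpart w P"
  have lQ: "lookup Q m = (if wt m = w then lookup P m else 0)" for m by (simp add: Q_def lookup_wpart)
  have keysQ: "keys Q \<subseteq> keys P" by (auto simp: in_keys_iff lQ split: if_splits)
  have wQ: "wt m = w" if "m \<in> keys Q" for m using that by (auto simp: in_keys_iff lQ split: if_splits)
  have Qp: "Q \<in> polys_in (ords s)" using P keysQ by (auto simp: polys_in_iff)
  have Qc: "lookup Q m \<in> range ratfun_const" for m
    unfolding lQ using cst ratfun_const_range_closed(5) by (simp del: image_iff)
  define B where "B j \<longleftrightarrow> 1 \<le> j \<and> (lower j Q \<noteq> 0 \<or> (\<exists>m\<in>keys P. wt m + j = w))" for j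
  show ?thesis
  proof (cases "\<exists>j. B j")
    case False
    have wP: "wt m = w" if "m \<in> keys P" for m
    proof (rule ccontr)
      assume "wt m \<noteq> w"
      hence "B (w - wt m)" using le[OF that] unfolding B_def by (intro conjI disjI2 bexI[OF _ that]) auto
      thus False using False by blast
    qed
    \<comment> \<open>Nothing occurs below weight \<open>w\<close>, and all lowering derivations of
      positive index annihilate \<open>P\<close>, so only orders 0 and 1 remain.\<close>
    have "Q = P" by (rule poly_mapping_eqI) (use wP in \<open>auto simp: lQ in_keys_iff\<close>)
    moreover have "lower j Q = 0" if "j \<ge> 1" for j using False that by (auto simp: B_def)
    ultimately have "P \<in> polys_in (ords 1)" using polys_in_ords_1_if_lower[OF Qp] by simp
    hence ?C4 using wP Qc[unfolded \<open>Q = P\<close>] by (intro conjI ballI allI)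
    thus ?thesis by (rule disjI2[OF disjI2[OF disjI2[OF disjI2]]])
  next
    case True
    define j0 where "j0 = (LEAST j. B j)"
    have Bj0: "B j0" unfolding j0_def using True by (rule LeastI_ex)
    have least: "j0 \<le> j" if "B j" for j unfolding j0_def using that by (rule Least_le)
    have j0: "1 \<le> j0" using Bj0 by (simp add: B_def)
    have rest: "wt n + j0 \<le> w" if "n \<in> keys (P - Q)" for n
    proof -
      have n: "n \<in> keys P" "wt n \<noteq> w" using that by (auto simp: in_keys_iff lookup_minus lQ split: if_splits)
      hence "B (w - wt n)" using le[OF n(1)] unfolding B_def by (intro conjI disjI2 bexI[OF _ n(1)]) auto
      thus ?thesis using least[of "w - wt n"] le[OF n(1)] by simp
    qed
    \<comment> \<open>The weights of the remainder \<open>P - Q\<close> are too low for a positive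
      \<open>j\<close> to reach weight \<open>w - j0\<close> from them. On the top part, smaller
      \<open>j\<close> annihilate \<open>Q\<close> by minimality of \<open>j0\<close>, and larger
      \<open>j\<close> land below.\<close>
    have low: "lookup (lower j P) m = (if j = j0 then lookup (lower j0 Q) m else 0)"
      if m: "wt m + j0 = w" and j: "j \<ge> 1" for j m
    proof -
      have "lookup (lower j (P - Q)) m = 0"
        by (rule lookup_lower_eq_0) (use rest m j in fastforce)
      moreover have "lookup (lower j Q) m = 0" if "j \<noteq> j0"
      proof (cases "j < j0")
        case True
        hence "\<not> B j" using least[of j] by auto
        thus ?thesis using j by (simp add: B_def)
      next
        case False
        thus ?thesis using that m wQ by (intro lookup_lower_eq_0) force
      qed
      moreover have "lower j P = lower j Q + lower j (P - Q)" by (simp flip: lower.add)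
      ultimately show ?thesis by (auto simp: lookup_add)
    qed
    have key: "yder b (lookup P m) + of_nat j0 * ratfun_d2 b * lookup P m + d2n (Suc j0) b * lookup (lower j0 Q) m = 0"
      if m: "wt m + j0 = w" for m
    proof -
      define f where "f j = d2n (Suc j) b * lookup (lower j P) m" for j
      have "(\<Sum>j\<le>s. f j) = (\<Sum>j\<in>insert 0 (if j0 \<le> s then {j0} else {}). f j)"
        using low[OF m] by (intro sum.mono_neutral_right) (auto simp: f_def split: if_splits)
      also have "\<dots> = f 0 + (if j0 \<le> s then f j0 else 0)" using j0 by simp
      also have "(if j0 \<le> s then f j0 else 0) = d2n (Suc j0) b * lookup (lower j0 Q) m"
        using low[OF m j0] lower_eq_0_ords[OF Qp, of j0] by (simp add: f_def)
      also have "f 0 = - of_nat (wt m) * ratfun_d2 b * lookup P m"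
        by (simp add: f_def lookup_lower_0)
      finally have "lookup (eder b s P) m = yder b (lookup P m) +
          (- of_nat (wt m) * ratfun_d2 b * lookup P m + d2n (Suc j0) b * lookup (lower j0 Q) m)"
        unfolding lookup_eder f_def by simp
      moreover have "lookup (eder b s P) m = - ((of_nat (wt m) + of_nat j0) * ratfun_d2 b * lookup P m)"
        by (simp add: E lookup_dp_const_mult m[symmetric])
      ultimately show ?thesis by (simp add: algebra_simps add_eq_0_iff2)
    qed
    show ?thesis
    proof (cases "lower j0 Q = 0")
      case True
      then obtain m where m: "m \<in> keys P" "wt m + j0 = w" using Bj0 by (auto simp: B_def)
      have "yder b (lookup P m) = - of_nat j0 * ratfun_d2 b * lookup P m"
        using key[OF m(2)] True by (simp add: eq_neg_iff_add_eq_0)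
      \<comment> \<open>For \<open>s = 0\<close> every monomial would have weight 0, leaving no room
        below \<open>w\<close>.\<close>
      moreover have "1 \<le> s"
      proof (rule ccontr)
        assume "\<not> 1 \<le> s"
        hence "P \<in> polys_in (ords 0)" using P by (auto elim: polys_in_mono)
        moreover have "m0 \<in> keys P" using m0(1) by (simp add: in_keys_iff)
        ultimately have "keys m0 \<subseteq> ords 0" by (simp only: polys_in_iff)
        hence "wt m0 = 0" unfolding wt_def by (intro sum.neutral) auto
        thus False using m0(2) m(2) j0 by simp
      qed
      moreover have "lookup P m \<noteq> 0" using m(1) by (simp add: in_keys_iff)
      ultimately have ?C1 using j0 by (intro conjI exI[of _ j0] exI[of _ "lookup P m"]) auto
      thus ?thesis by (rule disjI2[OF disjI1])
    next
      case False
      then obtain m where m: "m \<in> keys (lower j0 Q)" by (metis keys_eq_empty ex_in_conv)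
      obtain n where "n \<in> keys Q" "wt n = wt m + j0" using wt_lower[OF m] by blast
      hence wm: "wt m + j0 = w" using wQ by simp
      \<comment> \<open>A nonzero image under \<open>lower j0\<close> needs a symbol of order above
        \<open>j0\<close>; this is the bound that keeps the order of the normal form from exceeding
        \<open>s\<close>.\<close>
      have "\<not> s \<le> j0" using lower_eq_0_ords[OF Qp] False by blast
      hence s: "Suc j0 \<le> s" by simp
      have "j0 \<le> 2"
      proof (rule ccontr)
        assume "\<not> j0 \<le> 2"
        hence "\<not> B 1" "\<not> B 2" using least[of 1] least[of 2] by auto
        hence "lower 1 Q = 0" "lower 2 Q = 0" by (auto simp: B_def)
        thus False using lower_eq_0_if[OF _ _ j0] False by blast
      qed
      \<comment> \<open>\<open>Q\<close> has constant coefficients and \<open>lower\<close>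
        multiplies by integers, so this coefficient is a constant that can be divided out.\<close>
      obtain c where c: "lookup (lower j0 Q) m = ratfun_const c"
        using lookup_lower_const[OF Qc, of j0 m] by blast
      have c0: "ratfun_const c \<noteq> 0" using m c by (simp add: in_keys_iff del: ratfun_const_eq_0_iff)
      define a where "a = lookup P m / ratfun_const c"
      have Pm: "lookup P m = ratfun_const c * a" using c0 by (simp add: a_def)
      have "ratfun_const c * (yder b a + of_nat j0 * ratfun_d2 b * a + d2n (Suc j0) b) = 0"
        using key[OF wm] unfolding c Pm by (simp add: yder.mult algebra_simps)
      hence eq: "yder b a + of_nat j0 * ratfun_d2 b * a + d2n (Suc j0) b = 0" using c0 by simp
      from \<open>j0 \<le> 2\<close> j0 consider "j0 = 1" | "j0 = 2" by linarith
      thus ?thesis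
      proof cases
        case 1
        hence ?C2 using eq s by (intro conjI exI[of _ a]) (simp_all add: numeral_2_eq_2)
        thus ?thesis by (rule disjI2[OF disjI2[OF disjI1]])
      next
        case 2
        \<comment> \<open>Doubling the solution matches the normalisation of the third-order
          equation, whose leading term carries the factor 2.\<close>
        have "yder b (2 * a) + 2 * ratfun_d2 b * (2 * a) + 2 * d2n 3 b
            = 2 * (yder b a + of_nat j0 * ratfun_d2 b * a + d2n (Suc j0) b)"
          by (simp add: 2 yder.mult algebra_simps numeral_3_eq_3 numeral_2_eq_2)
        also have "\<dots> = 0" by (simp only: eq mult_zero_right)
        finally have ?C3 using s 2 by (intro conjI exI[of _ "2 * a"]) simp_all
        thus ?thesis by (rule disjI2[OF disjI2[OF disjI2[OF disjI1]]])
      qed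
    qed
  qed
qed

subsection \<open>Substitution of analytic functions\<close>

lemma has_partials_bipoly_eval:
  "has_partials (bipoly_eval p) (bipoly_eval (bipoly_d1 p) z) (bipoly_eval (bipoly_d2 p) z) z"
proof (induction p)
  case 0
  have "bipoly_eval 0 = (\<lambda>_. 0)" by auto
  moreover have "bipoly_d1 0 = 0" "bipoly_d2 0 = 0" by (simp_all add: bipoly_d1_def bipoly_d2_def)
  ultimately show ?case by (simp add: has_partials_const)
next
  case (pCons c p)
  have "has_partials (\<lambda>w. poly c (fst w)) (poly (pderiv c) (fst z) * 1) (poly (pderiv c) (fst z) * 0) z"
    by (intro has_partials_compose has_partials_fst poly_DERIV)
  from has_partials_add[OF this has_partials_mult[OF has_partials_snd pCons.IH]]
  show ?case
    by (simp add: bipoly_eval_pCons[abs_def] bipoly_d1_pCons bipoly_d2_def pderiv_pCons bipoly_eval_pCons add_ac)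
qed

lemma open_bipoly_nonzero: "open {z. bipoly_eval g z \<noteq> 0}"
proof -
  have "open (bipoly_eval g -` (- {0}))"
    by (rule continuous_open_vimage) (auto intro: has_partials_continuous[OF has_partials_bipoly_eval])
  thus ?thesis by (simp add: vimage_def)
qed

lemma ratfun_eval_has_partials:
  assumes "regular_at z f"
  shows "has_partials (ratfun_eval f) (ratfun_eval (ratfun_d1 f) z) (ratfun_eval (ratfun_d2 f) z) z"
    and "regular_at z (ratfun_d1 f)" "regular_at z (ratfun_d2 f)"
proof -
  obtain p q where f: "f = Fract p q" "bipoly_eval q z \<noteq> 0" "q \<noteq> 0" using assms by (rule regular_atE)
  have qz: "bipoly_eval (q ^ 2) z \<noteq> 0" using f by simp
  have 1: "ratfun_d1 f = Fract (bipoly_d1 p * q - p * bipoly_d1 q) (q ^ 2)"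
    using f by (simp add: ratfun_d1_def quotient_rule_Fract ring_derivation_bipoly_d1)
  have 2: "ratfun_d2 f = Fract (bipoly_d2 p * q - p * bipoly_d2 q) (q ^ 2)"
    using f by (simp add: ratfun_d2_def quotient_rule_Fract ring_derivation_bipoly_d2)
  show "regular_at z (ratfun_d1 f)" "regular_at z (ratfun_d2 f)"
    unfolding 1 2 by (rule Fract_eval(1)[OF qz])+
  have "has_partials (\<lambda>w. bipoly_eval p w / bipoly_eval q w)
      (ratfun_eval (ratfun_d1 f) z) (ratfun_eval (ratfun_d2 f) z) z"
    unfolding 1 2 Fract_eval(2)[OF qz] bipoly_eval_simps
    by (rule has_partials_divide[OF has_partials_bipoly_eval has_partials_bipoly_eval f(2)])
  thus "has_partials (ratfun_eval f) (ratfun_eval (ratfun_d1 f) z) (ratfun_eval (ratfun_d2 f) z) z"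
    by (rule has_partials_transform[OF _ open_bipoly_nonzero[of q]]) (use f in \<open>auto simp: Fract_eval(2)\<close>)
qed

definition jet :: "(complex \<times> complex \<Rightarrow> complex) \<Rightarrow> deriv_index \<Rightarrow> complex \<times> complex \<Rightarrow> complex" where
  "jet u v = (partial1 ^^ fst v) ((partial2 ^^ snd v) u)"

definition monom_eval :: "(complex \<times> complex \<Rightarrow> complex) \<Rightarrow> dmonom \<Rightarrow> complex \<times> complex \<Rightarrow> complex" where
  "monom_eval u m z = (\<Prod>v\<in>keys m. jet u v z ^ lookup m v)"

definition dregular :: "complex \<times> complex \<Rightarrow> dpoly \<Rightarrow> bool" where
  "dregular z A \<longleftrightarrow> (\<forall>m. regular_at z (lookup A m))"

lemma dregular_iff: "dregular z A \<longleftrightarrow> z \<notin> dp_sing A"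
proof -
  have "regular_at z (lookup A m) \<longleftrightarrow> (m \<in> keys A \<longrightarrow> regular_at z (lookup A m))" for m
    by (cases "m \<in> keys A") (simp_all add: in_keys_iff)
  thus ?thesis by (auto simp: dregular_def dp_sing_def ratfun_poles_def regular_at_def)
qed

lemma dp_subst_eq: "dp_subst A u z = (\<Sum>m\<in>keys A. ratfun_eval (lookup A m) z * monom_eval u m z)"
  by (simp add: dp_subst_def monom_eval_def jet_def case_prod_unfold)

lemma dp_subst_superset:
  "finite M \<Longrightarrow> keys A \<subseteq> M \<Longrightarrow> dp_subst A u z = (\<Sum>m\<in>M. ratfun_eval (lookup A m) z * monom_eval u m z)"
  unfolding dp_subst_eq by (intro sum.mono_neutral_left) (auto simp: in_keys_iff)

lemma monom_eval_add: "monom_eval u (m + n) z = monom_eval u m z * monom_eval u n z"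
proof -
  have "monom_eval u k z = (\<Prod>v\<in>keys m \<union> keys n. jet u v z ^ lookup k v)" if "keys k \<subseteq> keys m \<union> keys n" for k
    unfolding monom_eval_def using that by (intro prod.mono_neutral_left) (auto simp: in_keys_iff)
  from this[of m] this[of n] this[of "m + n"] show ?thesis
    by (simp add: keys_add_monom lookup_add power_add prod.distrib)
qed

lemma dp_subst_0 [simp]: "dregular z 0" "dp_subst 0 u z = 0"
  by (simp_all add: dregular_def dp_subst_eq)

lemma dp_subst_add:
  assumes "dregular z A" "dregular z B"
  shows "dregular z (A + B)" "dp_subst (A + B) u z = dp_subst A u z + dp_subst B u z"
proof -
  show "dregular z (A + B)" using assms by (simp add: dregular_def lookup_add ratfun_eval_add(1))
  let ?M = "keys A \<union> keys B"
  have "ratfun_eval (lookup (A + B) m) z = ratfun_eval (lookup A m) z + ratfun_eval (lookup B m) z" for m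
    using assms unfolding lookup_add by (intro ratfun_eval_add(2)) (auto simp: dregular_def)
  thus "dp_subst (A + B) u z = dp_subst A u z + dp_subst B u z"
    using dp_subst_superset[of ?M A] dp_subst_superset[of ?M B] dp_subst_superset[of ?M "A + B"]
      Poly_Mapping.keys_add[of A B]
    by (simp add: distrib_right sum.distrib)
qed

lemma dp_subst_sum:
  assumes "\<And>i. i \<in> S \<Longrightarrow> dregular z (f i)"
  shows "dregular z (sum f S) \<and> dp_subst (sum f S) u z = (\<Sum>i\<in>S. dp_subst (f i) u z)"
  using assms by (induction S rule: infinite_finite_induct) (simp_all add: dp_subst_add)

lemma dp_subst_single:
  assumes "regular_at z c"
  shows "dregular z (single m c)" "dp_subst (single m c) u z = ratfun_eval c z * monom_eval u m z"
  using assms dp_subst_superset[of "{m}" "single m c" u z] by (auto simp: dregular_def lookup_single when_def)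

lemma dp_subst_mult:
  assumes "dregular z A" "dregular z B"
  shows "dregular z (A * B)" "dp_subst (A * B) u z = dp_subst A u z * dp_subst B u z"
proof -
  have AB: "A * B = (\<Sum>m\<in>keys A. \<Sum>n\<in>keys B. single (m + n) (lookup A m * lookup B n))"
    by (subst (1 2) poly_mapping_sum_single[symmetric]) (simp add: sum_product mult_single)
  have reg: "regular_at z (lookup A m)" "regular_at z (lookup B n)" for m n
    using assms by (auto simp: dregular_def)
  define f where "f m n = single (m + n) (lookup A m * lookup B n)" for m n
  have s: "dregular z (f m n)" for m n
    unfolding f_def by (rule dp_subst_single(1)[OF ratfun_eval_mult(1)[OF reg]])
  note s1 = dp_subst_sum[of "keys B", OF s]
  note s2 = dp_subst_sum[of "keys A" z "\<lambda>m. sum (f m) (keys B)", OF conjunct1[OF s1]]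
  show "dregular z (A * B)"
    unfolding AB f_def[symmetric] by (rule conjunct1[OF s2])
  have "dp_subst (A * B) u z = (\<Sum>m\<in>keys A. \<Sum>n\<in>keys B. dp_subst (f m n) u z)"
    unfolding AB f_def[symmetric] conjunct2[OF s2] conjunct2[OF s1] ..
  also have "\<dots> = (\<Sum>m\<in>keys A. \<Sum>n\<in>keys B.
      (ratfun_eval (lookup A m) z * monom_eval u m z) * (ratfun_eval (lookup B n) z * monom_eval u n z))"
    unfolding f_def dp_subst_single(2)[OF ratfun_eval_mult(1)[OF reg]] ratfun_eval_mult(2)[OF reg] monom_eval_add
    by (simp only: mult_ac)
  finally show "dp_subst (A * B) u z = dp_subst A u z * dp_subst B u z"
    by (simp add: dp_subst_eq sum_product)
qed

lemma dp_subst_const: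
  assumes "regular_at z c"
  shows "dregular z (dp_const c)" "dp_subst (dp_const c) u z = ratfun_eval c z"
  using dp_subst_single[OF assms, of 0] by (simp_all add: dp_const_def monom_eval_def)

lemma dp_subst_y: "dregular z (dp_y i j)" "dp_subst (dp_y i j) u z = jet u (i, j) z"
  using dp_subst_single[of z 1 "single (i, j) 1"] by (simp_all add: dp_y_def monom_eval_def)

lemma dp_subst_power:
  assumes "dregular z A"
  shows "dregular z (A ^ n) \<and> dp_subst (A ^ n) u z = dp_subst A u z ^ n"
proof (induction n)
  case 0
  show ?case using dp_subst_const[of z 1] by simp
qed (use assms in \<open>simp add: dp_subst_mult\<close>)

lemma dp_subst_diff:
  assumes "dregular z A" "dregular z B"
  shows "dregular z (A - B)" "dp_subst (A - B) u z = dp_subst A u z - dp_subst B u z"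
proof -
  have m: "dregular z (dp_const (- 1))" "dp_subst (dp_const (- 1)) u z = - 1"
    using dp_subst_const[of z "- 1"] ratfun_eval_uminus[of z 1] by simp_all
  have eq: "A - B = A + dp_const (- 1) * B" by (simp add: dp_const_uminus)
  show "dregular z (A - B)" "dp_subst (A - B) u z = dp_subst A u z - dp_subst B u z"
    unfolding eq using assms m by (simp_all add: dp_subst_add dp_subst_mult)
qed

lemma dp_subst_numeral: "dregular z (numeral n)" "dp_subst (numeral n) u z = numeral n"
proof -
  have "(numeral n :: dpoly) = dp_const (numeral n)"
    using dp_const_of_nat[of "numeral n"] by simp
  thus "dregular z (numeral n)" "dp_subst (numeral n) u z = numeral n"
    using dp_subst_const[of z "numeral n"] by simp_all
qed

lemma partial1_cong_open:
  assumes "open \<Omega>" "z \<in> \<Omega>" "\<And>w. w \<in> \<Omega> \<Longrightarrow> u w = v w" "analytic2_on v \<Omega>"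
  shows "partial1 u z = partial1 v z" "partial2 u z = partial2 v z"
  using partial_cong[OF assms(1-3) analytic2_onD[OF assms(4,2)]] by auto

lemma analytic2_on_jet:
  assumes "open \<Omega>" "analytic2_on u \<Omega>"
  shows "analytic2_on (jet u v) \<Omega>"
proof -
  have "analytic2_on ((partial2 ^^ j) u) \<Omega>" for j
    using assms by (induction j) (auto intro: analytic2_on_partial2)
  hence "analytic2_on ((partial1 ^^ i) ((partial2 ^^ j) u)) \<Omega>" for i j
    by (induction i) (auto intro: analytic2_on_partial1 assms)
  thus ?thesis by (simp add: jet_def)
qed

text \<open>\<open>jet\<close> applies the x1-derivatives last, so an additional x2-derivative has
  to be commuted past them one by one.\<close>

lemma has_partials_jet:
  assumes op: "open \<Omega>" and u: "analytic2_on u \<Omega>" and z: "z \<in> \<Omega>"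
  shows "has_partials (jet u (i, j)) (jet u (Suc i, j) z) (jet u (i, Suc j) z) z"
proof -
  have "partial2 (jet u (i, j)) z = jet u (i, Suc j) z" if "z \<in> \<Omega>" for z
    using that
  proof (induction i arbitrary: z)
    case (Suc i)
    have "partial2 (jet u (Suc i, j)) z = partial2 (partial1 (jet u (i, j))) z" by (simp add: jet_def)
    also have "\<dots> = partial1 (partial2 (jet u (i, j))) z"
      by (rule partial_commute[OF op analytic2_on_jet[OF op u] Suc.prems])
    also have "\<dots> = partial1 (jet u (i, Suc j)) z"
      by (rule partial1_cong_open(1)[OF op Suc.prems Suc.IH analytic2_on_jet[OF op u]])
    finally show ?case by (simp add: jet_def)
  qed (simp add: jet_def)
  moreover have "partial1 (jet u (i, j)) z = jet u (Suc i, j) z" by (simp add: jet_def)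
  ultimately show ?thesis using analytic2_onD[OF analytic2_on_jet[OF op u] z] z by metis
qed

text \<open>Substitution turns the formal derivations into the analytic ones. Regularity of the
  derivatives is carried along in \<open>P\<close>, so that products can be treated. The induction
  follows the terms of \<open>A\<close> itself, whose coefficients are regular throughout
  \<open>U\<close>.\<close>

lemma dp_subst_has_partials:
  assumes op: "open U" and u: "analytic2_on u U" and A: "\<And>z. z \<in> U \<Longrightarrow> dregular z A" and z: "z \<in> U"
  shows "dregular z (dp_d1 A)" "dregular z (dp_d2 A)"
    "has_partials (dp_subst A u) (dp_subst (dp_d1 A) u z) (dp_subst (dp_d2 A) u z) z"
proof -
  define P where "P B \<longleftrightarrow> (\<forall>z\<in>U. dregular z B \<and> dregular z (dp_d1 B) \<and> dregular z (dp_d2 B) \<and>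
     has_partials (dp_subst B u) (dp_subst (dp_d1 B) u z) (dp_subst (dp_d2 B) u z) z)" for B
  have Pconst: "P (dp_const c)" if c: "\<And>z. z \<in> U \<Longrightarrow> regular_at z c" for c
    unfolding P_def
  proof (intro ballI conjI)
    fix z assume z: "z \<in> U"
    note r = ratfun_eval_has_partials[OF c[OF z]]
    show "dregular z (dp_const c)" "dregular z (dp_d1 (dp_const c))" "dregular z (dp_d2 (dp_const c))"
      using c[OF z] r by (auto intro: dp_subst_const)
    show "has_partials (dp_subst (dp_const c) u) (dp_subst (dp_d1 (dp_const c)) u z) (dp_subst (dp_d2 (dp_const c)) u z) z"
      using has_partials_transform[OF r(1) op z] c
      by (simp add: dp_subst_const(2)[OF r(2)] dp_subst_const(2)[OF r(3)] dp_subst_const(2)[OF c])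
  qed
  have Py: "P (dp_y i j)" for i j
    unfolding P_def
  proof (intro ballI conjI)
    fix z assume z: "z \<in> U"
    have "dp_subst (dp_y i j) u = jet u (i, j)" by (rule ext) (rule dp_subst_y)
    thus "has_partials (dp_subst (dp_y i j) u) (dp_subst (dp_d1 (dp_y i j)) u z) (dp_subst (dp_d2 (dp_y i j)) u z) z"
      using has_partials_jet[OF op u z] by (simp add: dp_subst_y)
  qed (simp_all add: dp_subst_y)
  have Padd: "P (B + C)" if B: "P B" and C: "P C" for B C
    unfolding P_def
  proof (intro ballI conjI)
    fix z assume z: "z \<in> U"
    show "has_partials (dp_subst (B + C) u) (dp_subst (dp_d1 (B + C)) u z) (dp_subst (dp_d2 (B + C)) u z) z"
      by (rule has_partials_transform[OF _ op z, of "\<lambda>z. dp_subst B u z + dp_subst C u z"])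
        (use B C z has_partials_add in \<open>auto simp: P_def D1.add D2.add dp_subst_add\<close>)
  qed (use B C in \<open>auto simp: P_def D1.add D2.add intro!: dp_subst_add\<close>)
  have Pmult: "P (B * C)" if B: "P B" and C: "P C" for B C
    unfolding P_def
  proof (intro ballI conjI)
    fix z assume z: "z \<in> U"
    have r: "dregular z B" "dregular z C" "dregular z (dp_d1 B)" "dregular z (dp_d1 C)"
      "dregular z (dp_d2 B)" "dregular z (dp_d2 C)"
      using B C z by (auto simp: P_def)
    have "has_partials (\<lambda>z. dp_subst B u z * dp_subst C u z)
        (dp_subst (dp_d1 (B * C)) u z) (dp_subst (dp_d2 (B * C)) u z) z"
      using has_partials_mult[of "dp_subst B u" _ _ z "dp_subst C u"] B C z r
      by (simp add: P_def D1.mult D2.mult dp_subst_add dp_subst_mult)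
    thus "has_partials (dp_subst (B * C) u) (dp_subst (dp_d1 (B * C)) u z) (dp_subst (dp_d2 (B * C)) u z) z"
      by (rule has_partials_transform[OF _ op z]) (use B C in \<open>simp add: P_def dp_subst_mult\<close>)
  qed (use B C in \<open>auto simp: P_def D1.mult D2.mult intro!: dp_subst_add dp_subst_mult\<close>)
  have mono: "P (single m (lookup A m))" for m
  proof (rule single_induct)
    show "P (dp_const (lookup A m))" by (rule Pconst) (use A in \<open>auto simp: dregular_def\<close>)
  qed (intro Pmult Py)
  have "P (\<Sum>m\<in>M. single m (lookup A m))" if "finite M" for M
    using that
  proof induction
    case empty
    show ?case using Pconst[of 0] by simp
  qed (simp add: Padd mono)
  from this[OF finite_keys[of A]] have "P A" by (simp only: poly_mapping_sum_single)
  with z show "dregular z (dp_d1 A)" "dregular z (dp_d2 A)"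
    "has_partials (dp_subst A u) (dp_subst (dp_d1 A) u z) (dp_subst (dp_d2 A) u z) z"
    by (auto simp: P_def)
qed

subsection \<open>The differential ideal of a function\<close>

text \<open>Vanishing is demanded off the zero set of some nonzero polynomial. Poles may cancel in a
  sum, so \<open>A + B\<close> can be regular at points where \<open>A\<close> and \<open>B\<close>
  are not; exceptional sets make closure under the ring operations immediate.\<close>

definition vanish_ideal ::
  "(complex \<times> complex) set \<Rightarrow> (complex \<times> complex \<Rightarrow> complex) \<Rightarrow> dpoly set" where
  "vanish_ideal \<Omega> u = {B. \<exists>g. g \<noteq> 0 \<and>
     (\<forall>z\<in>\<Omega>. bipoly_eval g z \<noteq> 0 \<longrightarrow> dregular z B \<and> dp_subst B u z = 0)}"

lemma common_denominator: "\<exists>g. g \<noteq> 0 \<and> (\<forall>z. bipoly_eval g z \<noteq> 0 \<longrightarrow> dregular z A)"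
proof -
  define g where "g = (\<Prod>m\<in>keys A. snd (quot_of_fract (lookup A m)))"
  have "bipoly_eval g z = (\<Prod>m\<in>keys A. bipoly_eval (snd (quot_of_fract (lookup A m))) z)" for z
  proof -
    have "bipoly_eval (prod f S) z = (\<Prod>x\<in>S. bipoly_eval (f x) z)" for f and S :: "dmonom set"
      by (induction S rule: infinite_finite_induct) auto
    thus ?thesis by (simp add: g_def)
  qed
  hence "dregular z A" if "bipoly_eval g z \<noteq> 0" for z
    using that by (auto simp: dregular_iff dp_sing_def ratfun_poles_def)
  moreover have "g \<noteq> 0" by (simp add: g_def)
  ultimately show ?thesis by blast
qed

lemma vanish_idealI:
  assumes "\<And>z. z \<in> \<Omega> \<Longrightarrow> dregular z B \<Longrightarrow> dp_subst B u z = 0"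
  shows "B \<in> vanish_ideal \<Omega> u"
  using common_denominator[of B] assms unfolding vanish_ideal_def by blast

lemma vanish_ideal_differential:
  assumes op: "open \<Omega>" and u: "analytic2_on u \<Omega>"
  shows "differential_ideal (vanish_ideal \<Omega> u)"
  unfolding differential_ideal_def
proof (intro conjI ballI allI)
  show "0 \<in> vanish_ideal \<Omega> u" by (rule vanish_idealI) simp
next
  fix A B assume "A \<in> vanish_ideal \<Omega> u" "B \<in> vanish_ideal \<Omega> u"
  then obtain g h where g: "g \<noteq> 0" "\<And>z. z \<in> \<Omega> \<Longrightarrow> bipoly_eval g z \<noteq> 0 \<Longrightarrow> dregular z A \<and> dp_subst A u z = 0"
    and h: "h \<noteq> 0" "\<And>z. z \<in> \<Omega> \<Longrightarrow> bipoly_eval h z \<noteq> 0 \<Longrightarrow> dregular z B \<and> dp_subst B u z = 0"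
    unfolding vanish_ideal_def by blast
  have "g * h \<noteq> 0 \<and> (\<forall>z\<in>\<Omega>. bipoly_eval (g * h) z \<noteq> 0 \<longrightarrow> dregular z (A + B) \<and> dp_subst (A + B) u z = 0)"
    using g h by (auto simp: dp_subst_add)
  thus "A + B \<in> vanish_ideal \<Omega> u" unfolding vanish_ideal_def by blast
next
  fix A C assume "A \<in> vanish_ideal \<Omega> u"
  then obtain g where g: "g \<noteq> 0" "\<And>z. z \<in> \<Omega> \<Longrightarrow> bipoly_eval g z \<noteq> 0 \<Longrightarrow> dregular z A \<and> dp_subst A u z = 0"
    unfolding vanish_ideal_def by blast
  obtain h where h: "h \<noteq> 0" "\<And>z. bipoly_eval h z \<noteq> 0 \<Longrightarrow> dregular z C"
    using common_denominator by blast
  have "g * h \<noteq> 0 \<and> (\<forall>z\<in>\<Omega>. bipoly_eval (g * h) z \<noteq> 0 \<longrightarrow> dregular z (C * A) \<and> dp_subst (C * A) u z = 0)"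
    using g h by (auto simp: dp_subst_mult)
  thus "C * A \<in> vanish_ideal \<Omega> u" unfolding vanish_ideal_def by blast
next
  fix A assume "A \<in> vanish_ideal \<Omega> u"
  then obtain g where g: "g \<noteq> 0" "\<And>z. z \<in> \<Omega> \<Longrightarrow> bipoly_eval g z \<noteq> 0 \<Longrightarrow> dregular z A \<and> dp_subst A u z = 0"
    unfolding vanish_ideal_def by blast
  define U where "U = \<Omega> \<inter> {z. bipoly_eval g z \<noteq> 0}"
  have opU: "open U" unfolding U_def by (intro open_Int op open_bipoly_nonzero)
  have uU: "analytic2_on u U" using u by (rule analytic2_on_subset) (simp add: U_def)
  have "dregular z (dp_d1 A) \<and> dp_subst (dp_d1 A) u z = 0 \<and> dregular z (dp_d2 A) \<and> dp_subst (dp_d2 A) u z = 0"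
    if z: "z \<in> U" for z
  proof -
    have reg: "\<And>z. z \<in> U \<Longrightarrow> dregular z A" and 0: "\<And>z. z \<in> U \<Longrightarrow> dp_subst A u z = 0"
      using g by (auto simp: U_def)
    note p = dp_subst_has_partials[OF opU uU reg z]
    have "has_partials (dp_subst A u) 0 0 z"
      by (rule has_partials_transform[OF has_partials_const opU z]) (simp add: 0)
    from has_partials_unique[OF this] has_partials_unique[OF p(3)] p(1,2) show ?thesis by simp
  qed
  thus "dp_d1 A \<in> vanish_ideal \<Omega> u" "dp_d2 A \<in> vanish_ideal \<Omega> u"
    unfolding vanish_ideal_def using g(1) by (auto simp: U_def)
qed

lemma open_dregular: "open {z. dregular z A}"
proof -
  have "{z. dregular z A} = (\<Inter>m\<in>keys A. {z. bipoly_eval (snd (quot_of_fract (lookup A m))) z \<noteq> 0})"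
    by (auto simp: dregular_iff dp_sing_def ratfun_poles_def)
  thus ?thesis by (simp add: open_INT open_bipoly_nonzero)
qed

text \<open>The substituted function is continuous where \<open>B\<close> is regular. If it were
  nonzero at \<open>z\<close>, it would be nonzero on an open set, which the zero set of
  \<open>g\<close> cannot cover.\<close>

lemma vanish_idealD:
  assumes op: "open \<Omega>" and u: "analytic2_on u \<Omega>" and B: "B \<in> vanish_ideal \<Omega> u"
    and z: "z \<in> \<Omega>" "dregular z B"
  shows "dp_subst B u z = 0"
proof (rule ccontr)
  assume nz: "dp_subst B u z \<noteq> 0"
  obtain g where g: "g \<noteq> 0" "\<And>z. z \<in> \<Omega> \<Longrightarrow> bipoly_eval g z \<noteq> 0 \<Longrightarrow> dp_subst B u z = 0"
    using B unfolding vanish_ideal_def by blast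
  define U where "U = \<Omega> \<inter> {z. dregular z B}"
  have opU: "open U" unfolding U_def by (intro open_Int op open_dregular)
  have uU: "analytic2_on u U" using u by (rule analytic2_on_subset) (simp add: U_def)
  have "continuous_on U (dp_subst B u)"
    by (intro continuous_at_imp_continuous_on ballI has_partials_continuous[OF dp_subst_has_partials(3)[OF opU uU]])
      (auto simp: U_def)
  hence "open (U \<inter> dp_subst B u -` (- {0}))"
    using opU by (intro continuous_open_preimage) auto
  moreover have "z \<in> U \<inter> dp_subst B u -` (- {0})" using z nz by (simp add: U_def)
  ultimately obtain w where "w \<in> U \<inter> dp_subst B u -` (- {0})" "bipoly_eval g w \<noteq> 0"
    using bipoly_eval_nonzero_open[OF g(1)] by (metis empty_iff)
  thus False using g(2)[of w] by (auto simp: U_def)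
qed

text \<open>\<omega> is a common zero of both generators, which gives nontriviality and excludes the
  unit ideal; \<open>u\<close> is a zero of the vector field but not of \<open>A\<close>, which
  shows that \<open>A\<close> enlarges the ideal of the vector field.\<close>

lemma expansion_of_solution:
  assumes op: "open \<Omega>" and con: "connected \<Omega>" and ne: "\<Omega> \<noteq> {}"
    and w: "analytic2_on \<omega> \<Omega>" "\<not> \<omega> constant_on \<Omega>"
    and X: "vf_dpoly X1 X2 \<in> vanish_ideal \<Omega> \<omega>" and A: "A \<in> vanish_ideal \<Omega> \<omega>"
    and u: "analytic2_on u \<Omega>" "vf_dpoly X1 X2 \<in> vanish_ideal \<Omega> u" "A \<notin> vanish_ideal \<Omega> u"
  shows "is_expansion X1 X2 (diff_ideal_gen {vf_dpoly X1 X2, A})"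
    "nontrivial (diff_ideal_gen {vf_dpoly X1 X2, A})"
    "diff_ideal_gen {vf_dpoly X1 X2, A} \<noteq> UNIV"
proof -
  let ?X = "vf_dpoly X1 X2"
  have sub: "diff_ideal_gen {?X, A} \<subseteq> vanish_ideal \<Omega> \<omega>"
    using X A by (intro hull_minimal vanish_ideal_differential op w) auto
  have "diff_ideal_gen {?X} \<subseteq> vanish_ideal \<Omega> u"
    using u by (intro hull_minimal vanish_ideal_differential op) auto
  hence "A \<notin> diff_ideal_gen {?X}" using u(3) by auto
  moreover have "A \<in> diff_ideal_gen {?X, A}" by (intro hull_inc) auto
  moreover have "diff_ideal_gen {?X} \<subseteq> diff_ideal_gen {?X, A}" by (intro hull_mono) auto
  ultimately show "is_expansion X1 X2 (diff_ideal_gen {?X, A})"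
    unfolding is_expansion_def using differential_ideal_hull by blast
  have "dp_subst B \<omega> z = 0" if "B \<in> diff_ideal_gen {?X, A}" "z \<in> \<Omega> - dp_sing B" for B z
    using vanish_idealD[OF op w(1) subsetD[OF sub that(1)]] that(2) by (simp add: dregular_iff)
  thus "nontrivial (diff_ideal_gen {?X, A})"
    unfolding nontrivial_def using op con ne w by blast
  obtain z where z: "z \<in> \<Omega>" using ne by blast
  have "dp_const 1 \<notin> vanish_ideal \<Omega> \<omega>"
    using vanish_idealD[OF op w(1) _ z, of "dp_const 1"] dp_subst_const[of z 1] by auto
  thus "diff_ideal_gen {?X, A} \<noteq> UNIV" using sub by blast
qed

subsection \<open>Solvability of the normal forms\<close>

text \<open>Properness is listed separately because the unit ideal counts as nontrivial.\<close>

definition solvable :: "bipoly \<Rightarrow> bipoly \<Rightarrow> dpoly \<Rightarrow> bool" where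
  "solvable X1 X2 A \<longleftrightarrow> is_expansion X1 X2 (diff_ideal_gen {vf_dpoly X1 X2, A}) \<and>
     nontrivial (diff_ideal_gen {vf_dpoly X1 X2, A}) \<and> diff_ideal_gen {vf_dpoly X1 X2, A} \<noteq> UNIV"

lemma solvableI:
  assumes "open \<Omega>" "connected \<Omega>" "\<Omega> \<noteq> {}" "analytic2_on \<omega> \<Omega>" "\<not> \<omega> constant_on \<Omega>"
    "vf_dpoly X1 X2 \<in> vanish_ideal \<Omega> \<omega>" "A \<in> vanish_ideal \<Omega> \<omega>"
    "analytic2_on u \<Omega>" "vf_dpoly X1 X2 \<in> vanish_ideal \<Omega> u" "A \<notin> vanish_ideal \<Omega> u"
  shows "solvable X1 X2 A"
  unfolding solvable_def using expansion_of_solution[OF assms] by (intro conjI)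

definition slope :: "bipoly \<Rightarrow> bipoly \<Rightarrow> ratfun" where
  "slope X1 X2 = to_fract X2 / to_fract X1"

lemma slope_eval:
  assumes "bipoly_eval X1 z \<noteq> 0"
  shows "regular_at z (slope X1 X2)" "ratfun_eval (slope X1 X2) z = bipoly_eval X2 z / bipoly_eval X1 z"
  using ratfun_eval_divide[of z "to_fract X2" "to_fract X1"] assms by (simp_all add: slope_def)

lemma ratfun_iterated_partials:
  assumes op: "open U" and f: "\<And>z. z \<in> U \<Longrightarrow> regular_at z f" and z: "z \<in> U"
  shows "regular_at z (d2n k f)" "(partial2 ^^ k) (ratfun_eval f) z = ratfun_eval (d2n k f) z"
proof -
  have reg: "regular_at z (d2n k f)" if "z \<in> U" for z k
    by (induction k) (use f that ratfun_eval_has_partials(3) in auto)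
  show "regular_at z (d2n k f)" by (rule reg[OF z])
  show "(partial2 ^^ k) (ratfun_eval f) z = ratfun_eval (d2n k f) z"
    using z
  proof (induction k arbitrary: z)
    case (Suc k)
    have "partial2 ((partial2 ^^ k) (ratfun_eval f)) z = ratfun_eval (ratfun_d2 (d2n k f)) z"
      by (rule partial_cong(2)[OF op Suc.prems Suc.IH ratfun_eval_has_partials(1)[OF reg[OF Suc.prems]]])
    thus ?case by simp
  qed simp
qed

lemma analytic2_on_ratfun_eval:
  assumes "\<And>z. z \<in> U \<Longrightarrow> regular_at z f"
  shows "analytic2_on (ratfun_eval f) U"
  by (rule analytic2_onI, rule ratfun_eval_has_partials, rule assms)

lemma dp_subst_vf:
  "dp_subst (vf_dpoly X1 X2) u z = bipoly_eval X1 z * partial1 u z + bipoly_eval X2 z * partial2 u z"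
  by (simp add: vf_dpoly_def dp_subst_add dp_subst_mult dp_subst_const dp_subst_y jet_def)

lemma vf_in_vanish_ideal:
  assumes "\<And>z. z \<in> \<Omega> \<Longrightarrow> bipoly_eval X1 z \<noteq> 0"
    and "\<And>z. z \<in> \<Omega> \<Longrightarrow> partial1 u z = - ratfun_eval (slope X1 X2) z * partial2 u z"
  shows "vf_dpoly X1 X2 \<in> vanish_ideal \<Omega> u"
proof (rule vanish_idealI)
  fix z assume z: "z \<in> \<Omega>"
  show "dp_subst (vf_dpoly X1 X2) u z = 0"
    unfolding dp_subst_vf assms(2)[OF z] slope_eval(2)[OF assms(1)[OF z]] using assms(1)[OF z] by simp
qed

lemma partials_zero: "partial1 (\<lambda>_. 0) = (\<lambda>_. 0)" "partial2 (\<lambda>_. 0) = (\<lambda>_. 0)"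
  using has_partials_unique[OF has_partials_const] by auto

lemma zero_in_vanish_ideal: "vf_dpoly X1 X2 \<in> vanish_ideal \<Omega> (\<lambda>_. 0)"
  by (rule vanish_idealI) (simp add: dp_subst_vf partials_zero)

lemma not_constant_on_partial2:
  assumes op: "open D" and p: "p \<in> D" and nz: "partial2 \<omega> p \<noteq> 0"
  shows "\<not> \<omega> constant_on D"
proof
  assume "\<omega> constant_on D"
  then obtain c where c: "\<And>z. z \<in> D \<Longrightarrow> \<omega> z = c" by (auto simp: constant_on_def)
  from partial_cong(2)[OF op p c has_partials_const] nz show False by simp
qed

lemma regular_base_point:
  assumes "X1 \<noteq> 0" "a \<noteq> 0"
  obtains U p where "open U" "p \<in> U" "\<And>z. z \<in> U \<Longrightarrow> bipoly_eval X1 z \<noteq> 0"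
    "\<And>z. z \<in> U \<Longrightarrow> regular_at z a" "\<And>z. z \<in> U \<Longrightarrow> ratfun_eval a z \<noteq> 0"
proof -
  define g where "g = X1 * (fst (quot_of_fract a) * snd (quot_of_fract a))"
  have "g \<noteq> 0" using assms by (simp add: g_def)
  then obtain p where p: "bipoly_eval g p \<noteq> 0"
    using bipoly_eval_nonzero_open[of g UNIV] by auto
  show ?thesis
  proof (rule that[OF open_bipoly_nonzero[of g]])
    show "p \<in> {z. bipoly_eval g z \<noteq> 0}" using p by simp
  qed (auto simp: g_def regular_at_def ratfun_eval_def)
qed

text \<open>The rational function \<open>a\<close> is itself the first integral sought, and the zero
  function violates the equation because \<open>a\<close> does not vanish at
  \<open>p\<close>.\<close>

lemma solvable_order_0:
  assumes X1: "X1 \<noteq> 0" and a: "a \<notin> range ratfun_const" "yder (slope X1 X2) a = 0"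
  shows "solvable X1 X2 (dp_y 0 0 - dp_const a)"
proof -
  have a0: "a \<noteq> 0" using a(1) ratfun_const_0 by (metis rangeI)
  obtain U p where U: "open U" "p \<in> U" and X1z: "\<And>z. z \<in> U \<Longrightarrow> bipoly_eval X1 z \<noteq> 0"
    and reg: "\<And>z. z \<in> U \<Longrightarrow> regular_at z a" and nz: "\<And>z. z \<in> U \<Longrightarrow> ratfun_eval a z \<noteq> 0"
    using regular_base_point[OF X1 a0] by blast
  obtain r where r: "r > 0" "ball p r \<subseteq> U" using U open_contains_ball by metis
  define D where "D = ball p r"
  have pD: "p \<in> D" using r by (simp add: D_def)
  have DU: "D \<subseteq> U" using r by (simp add: D_def)
  have s: "dp_subst (dp_y 0 0 - dp_const a) u z = u z - ratfun_eval a z" if "z \<in> D" for u z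
    using reg[OF subsetD[OF DU that]] by (simp add: dp_subst_diff dp_subst_y dp_subst_const jet_def)
  have dr: "dregular z (dp_y 0 0 - dp_const a)" if "z \<in> D" for z
    using reg[OF subsetD[OF DU that]] by (simp add: dp_subst_diff dp_subst_y dp_subst_const)
  show ?thesis
  proof (rule solvableI[of D "ratfun_eval a" _ _ _ "\<lambda>_. 0"])
    show an: "analytic2_on (ratfun_eval a) D" using reg DU by (intro analytic2_on_ratfun_eval) auto
    show "\<not> ratfun_eval a constant_on D"
    proof
      assume "ratfun_eval a constant_on D"
      then obtain c where c: "\<And>z. z \<in> D \<Longrightarrow> ratfun_eval a z = c" by (auto simp: constant_on_def)
      have "a - ratfun_const c \<noteq> 0" using a(1) by auto
      hence "fst (quot_of_fract (a - ratfun_const c)) \<noteq> 0" by simp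
      then obtain z where z: "z \<in> D" "bipoly_eval (fst (quot_of_fract (a - ratfun_const c))) z \<noteq> 0"
        using bipoly_eval_nonzero_open[of _ D] pD by (metis D_def empty_iff open_ball)
      have rz: "regular_at z a" by (rule reg[OF subsetD[OF DU z(1)]])
      have rc: "regular_at z (- ratfun_const c)" "ratfun_eval (- ratfun_const c) z = - c"
        by (simp_all add: ratfun_eval_uminus)
      from ratfun_eval_add[OF rz rc(1)] rc(2) c[OF z(1)]
      have "regular_at z (a - ratfun_const c)" "ratfun_eval (a - ratfun_const c) z = 0" by simp_all
      with z(2) show False by (simp add: ratfun_eval_def regular_at_def)
    qed
    show "vf_dpoly X1 X2 \<in> vanish_ideal D (ratfun_eval a)"
    proof (rule vf_in_vanish_ideal)
      fix z assume "z \<in> D"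
      hence z: "z \<in> U" using DU by auto
      show "bipoly_eval X1 z \<noteq> 0" by (rule X1z[OF z])
      note p = ratfun_eval_has_partials[OF reg[OF z]] and sl = slope_eval(1)[OF X1z[OF z], of X2]
      have "ratfun_eval (ratfun_d1 a) z + ratfun_eval (slope X1 X2) z * ratfun_eval (ratfun_d2 a) z
          = ratfun_eval (yder (slope X1 X2) a) z"
        unfolding yder_def using p sl by (simp add: ratfun_eval_add ratfun_eval_mult)
      also have "\<dots> = 0" by (simp add: a(2))
      finally show "partial1 (ratfun_eval a) z = - ratfun_eval (slope X1 X2) z * partial2 (ratfun_eval a) z"
        by (simp add: has_partials_unique[OF p(1)] eq_neg_iff_add_eq_0)
    qed
    show "dp_y 0 0 - dp_const a \<in> vanish_ideal D (ratfun_eval a)"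
      by (rule vanish_idealI) (simp add: s)
    show an0: "analytic2_on (\<lambda>_. 0) D" by (rule analytic2_on_const)
    show "dp_y 0 0 - dp_const a \<notin> vanish_ideal D (\<lambda>_. 0)"
      using vanish_idealD[OF _ an0 _ pD dr[OF pD]] s[OF pD] nz[OF U(2)] by (auto simp: D_def)
    show "vf_dpoly X1 X2 \<in> vanish_ideal D (\<lambda>_. 0)" by (rule zero_in_vanish_ideal)
  qed (use pD in \<open>auto simp: D_def\<close>)
qed

text \<open>The square of a first integral is a first integral again; it serves as a common zero of
  \<open>{X}\<close> that violates the equations of order two and three.\<close>

lemma square_partials:
  assumes op: "open D" and w: "analytic2_on \<omega> D"
  defines "u \<equiv> \<lambda>z. \<omega> z * \<omega> z"
  shows "analytic2_on u D"
    "\<And>z. z \<in> D \<Longrightarrow> partial1 u z = 2 * \<omega> z * partial1 \<omega> z"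
    "\<And>z. z \<in> D \<Longrightarrow> partial2 u z = 2 * \<omega> z * partial2 \<omega> z"
    "\<And>z. z \<in> D \<Longrightarrow> partial2 (partial2 u) z = 2 * partial2 \<omega> z ^ 2 + 2 * \<omega> z * partial2 (partial2 \<omega>) z"
    "\<And>z. z \<in> D \<Longrightarrow> partial2 (partial2 (partial2 u)) z =
       6 * partial2 \<omega> z * partial2 (partial2 \<omega>) z + 2 * \<omega> z * partial2 (partial2 (partial2 \<omega>)) z"
proof -
  note a2 = analytic2_on_partial2[OF op w]
  note a22 = analytic2_on_partial2[OF op a2]
  note h = analytic2_onD[OF w] and h2 = analytic2_onD[OF a2] and h22 = analytic2_onD[OF a22]
  have hu: "has_partials u (2 * \<omega> z * partial1 \<omega> z) (2 * \<omega> z * partial2 \<omega> z) z" if "z \<in> D" for z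
    using has_partials_mult[OF h[OF that] h[OF that]] by (simp add: u_def mult_ac)
  show "analytic2_on u D" by (rule analytic2_onI, rule hu)
  show "partial1 u z = 2 * \<omega> z * partial1 \<omega> z" if "z \<in> D" for z using has_partials_unique[OF hu[OF that]] by simp
  show u2: "partial2 u z = 2 * \<omega> z * partial2 \<omega> z" if "z \<in> D" for z using has_partials_unique[OF hu[OF that]] by simp
  show u22: "partial2 (partial2 u) z = 2 * partial2 \<omega> z ^ 2 + 2 * \<omega> z * partial2 (partial2 \<omega>) z" if "z \<in> D" for z
    using partial_cong(2)[OF op that u2
        has_partials_mult[OF has_partials_mult[OF has_partials_const h[OF that]] h2[OF that]]]
    by (simp add: power2_eq_square algebra_simps)
  show "partial2 (partial2 (partial2 u)) z =
       6 * partial2 \<omega> z * partial2 (partial2 \<omega>) z + 2 * \<omega> z * partial2 (partial2 (partial2 \<omega>)) z" if "z \<in> D" for z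
    using partial_cong(2)[OF op that u22
        has_partials_add[OF has_partials_mult[OF has_partials_const has_partials_power[OF h2[OF that]]]
          has_partials_mult[OF has_partials_mult[OF has_partials_const h[OF that]] h22[OF that]]]]
    by (simp add: algebra_simps)
qed

lemma slope_pde_eval:
  fixes X1 X2 :: bipoly
  assumes U: "open U" and z: "z \<in> U" and X1z: "\<And>z. z \<in> U \<Longrightarrow> bipoly_eval X1 z \<noteq> 0"
  defines "\<beta> \<equiv> ratfun_eval (slope X1 X2)"
  shows "partial2 \<beta> z = ratfun_eval (ratfun_d2 (slope X1 X2)) z"
    "partial2 (partial2 \<beta>) z = ratfun_eval (d2n 2 (slope X1 X2)) z"
    "partial2 (partial2 (partial2 \<beta>)) z = ratfun_eval (d2n 3 (slope X1 X2)) z"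
    "regular_at z (d2n k (slope X1 X2))"
  using ratfun_iterated_partials[OF U slope_eval(1)[OF X1z] z, of 1 X2]
    ratfun_iterated_partials[OF U slope_eval(1)[OF X1z] z, of 2 X2]
    ratfun_iterated_partials[OF U slope_eval(1)[OF X1z] z, of 3 X2]
    ratfun_iterated_partials[OF U slope_eval(1)[OF X1z] z, of k X2]
  by (simp_all add: \<beta>_def numeral_2_eq_2 numeral_3_eq_3)

text \<open>Evaluated at points, the equation for \<open>a\<close> is the integrability condition of
  \<open>affine_solution\<close>; the initial value 1 of \<open>partial2 \<omega>\<close> keeps the
  solution from being constant.\<close>

lemma solvable_order_2:
  assumes X1: "X1 \<noteq> 0"
    and a: "yder (slope X1 X2) a + ratfun_d2 (slope X1 X2) * a + d2n 2 (slope X1 X2) = 0"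
  shows "solvable X1 X2 (dp_y 0 2 - dp_const a * dp_y 0 1)"
proof -
  let ?b = "slope X1 X2"
  \<comment> \<open>The choice of a base point asks for a nonzero rational function, so 1 stands in
    for \<open>a = 0\<close>, which is regular everywhere.\<close>
  define a' where "a' = (if a = 0 then 1 else a)"
  have "a' \<noteq> 0" by (simp add: a'_def)
  then obtain U p where U: "open U" "p \<in> U" and X1z: "\<And>z. z \<in> U \<Longrightarrow> bipoly_eval X1 z \<noteq> 0"
    and "\<And>z. z \<in> U \<Longrightarrow> regular_at z a'"
    using regular_base_point[OF X1] by metis
  hence reg: "regular_at z a" if "z \<in> U" for z using that by (cases "a = 0") (auto simp: a'_def)
  have ab: "(fst p, snd p) \<in> U" using U by simp
  have pde: "partial1 (ratfun_eval a) z + ratfun_eval ?b z * partial2 (ratfun_eval a) z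
      + ratfun_eval a z * partial2 (ratfun_eval ?b) z + partial2 (partial2 (ratfun_eval ?b)) z = 0"
    if z: "z \<in> U" for z
  proof -
    note h = ratfun_eval_has_partials[OF reg[OF z]] and sl = slope_eval(1)[OF X1z[OF z], of X2]
    note sp = slope_pde_eval[OF U(1) z X1z]
    have r2: "regular_at z (ratfun_d2 ?b)" by (rule ratfun_eval_has_partials(3)[OF sl])
    have rz: "regular_at z a" "regular_at z ?b" using reg[OF z] sl by auto
    have "ratfun_eval (yder ?b a + ratfun_d2 ?b * a + d2n 2 ?b) z = 0" by (simp only: a ratfun_eval_0)
    moreover have "ratfun_eval (yder ?b a + ratfun_d2 ?b * a + d2n 2 ?b) z =
       ratfun_eval (ratfun_d1 a) z + ratfun_eval ?b z * ratfun_eval (ratfun_d2 a) z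
       + ratfun_eval (ratfun_d2 ?b) z * ratfun_eval a z + ratfun_eval (d2n 2 ?b) z"
      unfolding yder_def using h(2,3) rz r2 sp(4)[of 2]
      by (simp only: ratfun_eval_add ratfun_eval_mult)
    ultimately show ?thesis by (simp add: has_partials_unique[OF h(1)] sp(1,2) mult_ac)
  qed
  obtain r \<omega> where r: "r > 0" "ball (fst p) r \<times> ball (snd p) r \<subseteq> U"
    and \<omega>: "analytic2_on \<omega> (ball (fst p) r \<times> ball (snd p) r)"
    and \<omega>1: "\<And>z. z \<in> ball (fst p) r \<times> ball (snd p) r \<Longrightarrow> partial1 \<omega> z = - ratfun_eval ?b z * partial2 \<omega> z"
    and \<omega>22: "\<And>z. z \<in> ball (fst p) r \<times> ball (snd p) r \<Longrightarrow> partial2 (partial2 \<omega>) z = ratfun_eval a z * partial2 \<omega> z"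
    and \<omega>p: "partial2 \<omega> (fst p, snd p) = 1"
    using affine_solution[OF U(1) ab analytic2_on_ratfun_eval[OF reg]
        analytic2_on_ratfun_eval[OF slope_eval(1)[OF X1z]] pde, of 1] by blast
  define D where "D = ball (fst p) r \<times> ball (snd p) r"
  have DU: "D \<subseteq> U" and pD: "p \<in> D" and opD: "open D" and conv: "connected D"
    using r by (auto simp: D_def open_Times mem_Times_iff intro!: convex_connected convex_Times)
  note \<omega> = \<omega>[folded D_def] and \<omega>1 = \<omega>1[folded D_def] and \<omega>22 = \<omega>22[folded D_def]
  note sq = square_partials[OF opD \<omega>]
  have dr: "dregular z (dp_y 0 2 - dp_const a * dp_y 0 1)"
    and s: "dp_subst (dp_y 0 2 - dp_const a * dp_y 0 1) u z = partial2 (partial2 u) z - ratfun_eval a z * partial2 u z"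
    if "z \<in> D" for u z
    using reg[OF subsetD[OF DU that]]
    by (simp_all add: dp_subst_diff dp_subst_mult dp_subst_y dp_subst_const jet_def numeral_2_eq_2)
  show ?thesis
  proof (rule solvableI[of D \<omega> _ _ _ "\<lambda>z. \<omega> z * \<omega> z"])
    show "\<not> \<omega> constant_on D"
      by (rule not_constant_on_partial2[OF opD pD]) (use \<omega>p in simp)
    show "vf_dpoly X1 X2 \<in> vanish_ideal D \<omega>"
      by (rule vf_in_vanish_ideal) (use X1z DU \<omega>1 in auto)
    show "dp_y 0 2 - dp_const a * dp_y 0 1 \<in> vanish_ideal D \<omega>"
      by (rule vanish_idealI) (simp only: s \<omega>22 diff_self)
    show "vf_dpoly X1 X2 \<in> vanish_ideal D (\<lambda>z. \<omega> z * \<omega> z)"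
      by (rule vf_in_vanish_ideal) (use X1z DU in auto, simp add: sq(2,3) \<omega>1)
    show "dp_y 0 2 - dp_const a * dp_y 0 1 \<notin> vanish_ideal D (\<lambda>z. \<omega> z * \<omega> z)"
    proof
      \<comment> \<open>By the equation for \<omega>, its square misses the equation by
        \<open>2 * partial2 \<omega> ^ 2\<close>, which is 2 at \<open>p\<close>.\<close>
      assume "dp_y 0 2 - dp_const a * dp_y 0 1 \<in> vanish_ideal D (\<lambda>z. \<omega> z * \<omega> z)"
      from vanish_idealD[OF opD sq(1) this pD dr[OF pD]] show False
        unfolding s[OF pD] sq(3)[OF pD] sq(4)[OF pD] \<omega>22[OF pD] using \<omega>p by (simp add: algebra_simps)
    qed
  qed (use pD opD conv \<omega> sq(1) in auto)
qed

lemma solvable_order_3: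
  assumes X1: "X1 \<noteq> 0"
    and a: "yder (slope X1 X2) a + 2 * ratfun_d2 (slope X1 X2) * a + 2 * d2n 3 (slope X1 X2) = 0"
  shows "solvable X1 X2 (2 * dp_y 0 1 * dp_y 0 3 - 3 * (dp_y 0 2) ^ 2 - dp_const a * (dp_y 0 1) ^ 2)"
    (is "solvable X1 X2 ?A")
proof -
  let ?b = "slope X1 X2"
  define a' where "a' = (if a = 0 then 1 else a)"
  have "a' \<noteq> 0" by (simp add: a'_def)
  then obtain U p where U: "open U" "p \<in> U" and X1z: "\<And>z. z \<in> U \<Longrightarrow> bipoly_eval X1 z \<noteq> 0"
    and "\<And>z. z \<in> U \<Longrightarrow> regular_at z a'"
    using regular_base_point[OF X1] by metis
  hence reg: "regular_at z a" if "z \<in> U" for z using that by (cases "a = 0") (auto simp: a'_def)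
  have ab: "(fst p, snd p) \<in> U" using U by simp
  have pde: "partial1 (ratfun_eval a) z + ratfun_eval ?b z * partial2 (ratfun_eval a) z
      + 2 * ratfun_eval a z * partial2 (ratfun_eval ?b) z + 2 * partial2 (partial2 (partial2 (ratfun_eval ?b))) z = 0"
    if z: "z \<in> U" for z
  proof -
    note h = ratfun_eval_has_partials[OF reg[OF z]] and sl = slope_eval(1)[OF X1z[OF z], of X2]
    note sp = slope_pde_eval[OF U(1) z X1z]
    have r2: "regular_at z (ratfun_d2 ?b)" by (rule ratfun_eval_has_partials(3)[OF sl])
    have rz: "regular_at z a" "regular_at z ?b" using reg[OF z] sl by auto
    have "ratfun_eval (yder ?b a + 2 * ratfun_d2 ?b * a + 2 * d2n 3 ?b) z = 0" by (simp only: a ratfun_eval_0)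
    moreover have "ratfun_eval (yder ?b a + 2 * ratfun_d2 ?b * a + 2 * d2n 3 ?b) z =
       ratfun_eval (ratfun_d1 a) z + ratfun_eval ?b z * ratfun_eval (ratfun_d2 a) z
       + 2 * ratfun_eval (ratfun_d2 ?b) z * ratfun_eval a z + 2 * ratfun_eval (d2n 3 ?b) z"
      unfolding yder_def using h(2,3) rz r2 sp(4)[of 3]
      by (simp only: ratfun_eval_add ratfun_eval_mult ratfun_eval_numeral)
    ultimately show ?thesis by (simp add: has_partials_unique[OF h(1)] sp(1,3) mult_ac)
  qed
  obtain r \<omega> where r: "r > 0" "ball (fst p) r \<times> ball (snd p) r \<subseteq> U"
    and \<omega>: "analytic2_on \<omega> (ball (fst p) r \<times> ball (snd p) r)"
    and \<omega>1: "\<And>z. z \<in> ball (fst p) r \<times> ball (snd p) r \<Longrightarrow> partial1 \<omega> z = - ratfun_eval ?b z * partial2 \<omega> z"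
    and \<omega>3: "\<And>z. z \<in> ball (fst p) r \<times> ball (snd p) r \<Longrightarrow> 2 * partial2 \<omega> z * partial2 (partial2 (partial2 \<omega>)) z
       - 3 * (partial2 (partial2 \<omega>) z) ^ 2 - ratfun_eval a z * (partial2 \<omega> z) ^ 2 = 0"
    and \<omega>p: "partial2 \<omega> (fst p, snd p) \<noteq> 0"
    using schwarz_solution[OF U(1) ab analytic2_on_ratfun_eval[OF reg]
        analytic2_on_ratfun_eval[OF slope_eval(1)[OF X1z]] pde] by blast
  define D where "D = ball (fst p) r \<times> ball (snd p) r"
  have DU: "D \<subseteq> U" and pD: "p \<in> D" and opD: "open D" and conv: "connected D"
    using r by (auto simp: D_def open_Times mem_Times_iff intro!: convex_connected convex_Times)
  note \<omega> = \<omega>[folded D_def] and \<omega>1 = \<omega>1[folded D_def] and \<omega>3 = \<omega>3[folded D_def]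
  note sq = square_partials[OF opD \<omega>]
  have dr: "dregular z ?A"
    and s: "dp_subst ?A u z = 2 * partial2 u z * partial2 (partial2 (partial2 u)) z
       - 3 * (partial2 (partial2 u) z) ^ 2 - ratfun_eval a z * (partial2 u z) ^ 2"
    if "z \<in> D" for u z
    using reg[OF subsetD[OF DU that]]
    by (simp_all add: dp_subst_diff dp_subst_mult dp_subst_y dp_subst_const dp_subst_numeral dp_subst_power
        jet_def numeral_2_eq_2 numeral_3_eq_3)
  show ?thesis
  proof (rule solvableI[of D \<omega> _ _ _ "\<lambda>z. \<omega> z * \<omega> z"])
    show "\<not> \<omega> constant_on D"
      by (rule not_constant_on_partial2[OF opD pD]) (use \<omega>p in simp)
    show "vf_dpoly X1 X2 \<in> vanish_ideal D \<omega>"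
      by (rule vf_in_vanish_ideal) (use X1z DU \<omega>1 in auto)
    show "?A \<in> vanish_ideal D \<omega>"
      by (rule vanish_idealI) (simp only: s \<omega>3)
    show "vf_dpoly X1 X2 \<in> vanish_ideal D (\<lambda>z. \<omega> z * \<omega> z)"
      by (rule vf_in_vanish_ideal) (use X1z DU in auto, simp add: sq(2,3) \<omega>1)
    show "?A \<notin> vanish_ideal D (\<lambda>z. \<omega> z * \<omega> z)"
    proof
      assume "?A \<in> vanish_ideal D (\<lambda>z. \<omega> z * \<omega> z)"
      from vanish_idealD[OF opD sq(1) this pD dr[OF pD]]
      have 0: "2 * (2 * w * w1) * (6 * w1 * w2 + 2 * w * w3) - 3 * (2 * w1 ^ 2 + 2 * w * w2) ^ 2 - c * (2 * w * w1) ^ 2 = 0"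
        if "w = \<omega> p" "w1 = partial2 \<omega> p" "w2 = partial2 (partial2 \<omega>) p"
          "w3 = partial2 (partial2 (partial2 \<omega>)) p" "c = ratfun_eval a p" for w w1 w2 w3 c
        unfolding s[OF pD] sq(3)[OF pD] sq(4)[OF pD] sq(5)[OF pD] that .
      \<comment> \<open>The second bracket on the right vanishes by the equation for \<omega>, so
        the square misses the equation by -12 times the fourth power of
        \<open>partial2 \<omega>\<close>, nonzero at \<open>p\<close>.\<close>
      have id: "2 * (2 * w * w1) * (6 * w1 * w2 + 2 * w * w3) - 3 * (2 * w1 ^ 2 + 2 * w * w2) ^ 2 - c * (2 * w * w1) ^ 2
        = 4 * w ^ 2 * (2 * w1 * w3 - 3 * w2 ^ 2 - c * w1 ^ 2) - 12 * w1 ^ 4" for w w1 w2 w3 c :: complex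
        by (simp add: algebra_simps power2_eq_square power4_eq_xxxx)
      have "partial2 \<omega> p = 0"
        using 0[OF refl refl refl refl refl] unfolding id \<omega>3[OF pD] by simp
      thus False using \<omega>p by simp
    qed
  qed (use pD opD conv \<omega> sq(1) in auto)
qed


text \<open>Differentiating \<open>(\<partial>\<^sub>2 \<omega>)\<^bsup>n\<^esup> = a\<close> reduces this case to the linear equation
  \<open>\<partial>\<^sub>2\<^bsup>2\<^esup> \<omega> = \<alpha> \<partial>\<^sub>2 \<omega>\<close> with \<open>\<alpha> = \<partial>\<^sub>2 a / (n a)\<close>.\<close>

lemma solvable_order_1:
  assumes X1: "X1 \<noteq> 0" and n: "n > 0" and a0: "a \<noteq> 0"
    and a: "yder (slope X1 X2) a = - of_nat n * ratfun_d2 (slope X1 X2) * a"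
  shows "solvable X1 X2 (dp_y 0 1 ^ n - dp_const a)"
proof -
  let ?b = "slope X1 X2"
  obtain U p where U: "open U" "p \<in> U" and X1z: "\<And>z. z \<in> U \<Longrightarrow> bipoly_eval X1 z \<noteq> 0"
    and reg: "\<And>z. z \<in> U \<Longrightarrow> regular_at z a" and nz: "\<And>z. z \<in> U \<Longrightarrow> ratfun_eval a z \<noteq> 0"
    using regular_base_point[OF X1 a0] by blast
  define A \<beta> where "A = ratfun_eval a" and "\<beta> = ratfun_eval ?b"
  have anA: "analytic2_on A U" unfolding A_def by (rule analytic2_on_ratfun_eval[OF reg])
  have anb: "analytic2_on \<beta> U" unfolding \<beta>_def by (rule analytic2_on_ratfun_eval[OF slope_eval(1)[OF X1z]])
  have anA2: "analytic2_on (partial2 A) U" by (rule analytic2_on_partial2[OF U(1) anA])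
  have anb2: "analytic2_on (partial2 \<beta>) U" by (rule analytic2_on_partial2[OF U(1) anb])
  define N :: complex where "N = of_nat n"
  have N: "N \<noteq> 0" using n by (simp add: N_def)
  have A1: "partial1 A z = - N * partial2 \<beta> z * A z - \<beta> z * partial2 A z" if z: "z \<in> U" for z
  proof -
    note h = ratfun_eval_has_partials[OF reg[OF z]] and sl = slope_eval(1)[OF X1z[OF z], of X2]
    note sp = slope_pde_eval[OF U(1) z X1z]
    have r2: "regular_at z (ratfun_d2 ?b)" by (rule ratfun_eval_has_partials(3)[OF sl])
    have rz: "regular_at z a" "regular_at z ?b" using reg[OF z] sl by auto
    have "yder ?b a + of_nat n * ratfun_d2 ?b * a = 0" unfolding a by simp
    hence "ratfun_eval (yder ?b a + of_nat n * ratfun_d2 ?b * a) z = 0" by (simp only: ratfun_eval_0)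
    moreover have "ratfun_eval (yder ?b a + of_nat n * ratfun_d2 ?b * a) z =
       ratfun_eval (ratfun_d1 a) z + ratfun_eval ?b z * ratfun_eval (ratfun_d2 a) z
       + of_nat n * ratfun_eval (ratfun_d2 ?b) z * ratfun_eval a z"
      unfolding yder_def using h(2,3) rz r2
      by (simp only: ratfun_eval_add ratfun_eval_mult ratfun_eval_of_nat)
    ultimately have "partial1 A z + \<beta> z * partial2 A z + N * partial2 \<beta> z * A z = 0"
      by (simp add: has_partials_unique[OF h(1)] sp(1) A_def \<beta>_def N_def)
    thus ?thesis by (simp add: add_eq_0_iff2 eq_diff_eq)
  qed
  have A21: "partial1 (partial2 A) z = - N * (partial2 (partial2 \<beta>) z * A z + partial2 \<beta> z * partial2 A z)
      - partial2 \<beta> z * partial2 A z - \<beta> z * partial2 (partial2 A) z" if z: "z \<in> U" for z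
  proof -
    have "partial1 (partial2 A) z = partial2 (partial1 A) z"
      by (rule partial_commute[OF U(1) anA z, symmetric])
    also have "\<dots> = (0 * partial2 \<beta> z + - N * partial2 (partial2 \<beta>) z) * A z + (- N * partial2 \<beta> z) * partial2 A z
        - (partial2 \<beta> z * partial2 A z + \<beta> z * partial2 (partial2 A) z)"
      by (rule partial_cong(2)[OF U(1) z A1 has_partials_diff[OF
          has_partials_mult[OF has_partials_mult[OF has_partials_const analytic2_onD[OF anb2 z]] analytic2_onD[OF anA z]]
          has_partials_mult[OF analytic2_onD[OF anb z] analytic2_onD[OF anA2 z]]]])
    finally show ?thesis by (simp add: algebra_simps)
  qed
  have Az: "A z \<noteq> 0" if "z \<in> U" for z using nz[OF that] by (simp add: A_def)
  define \<alpha> where "\<alpha> z = partial2 A z / (N * A z)" for z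
  have h\<alpha>: "has_partials \<alpha>
      ((partial1 (partial2 A) z * (N * A z) - partial2 A z * (N * partial1 A z)) / (N * A z) ^ 2)
      ((partial2 (partial2 A) z * (N * A z) - partial2 A z * (N * partial2 A z)) / (N * A z) ^ 2) z"
    if z: "z \<in> U" for z
    using has_partials_divide[OF analytic2_onD[OF anA2 z] has_partials_mult[OF has_partials_const analytic2_onD[OF anA z]], of N]
      Az[OF z] N by (simp add: \<alpha>_def[abs_def])
  have an\<alpha>: "analytic2_on \<alpha> U" by (rule analytic2_onI, rule h\<alpha>)
  \<comment> \<open>This is the x2-derivative of the equation for \<open>a\<close> after division by
    \<open>n * a\<close>, that is, for the logarithm of \<open>a\<close>.\<close>
  have pde: "partial1 \<alpha> z + \<beta> z * partial2 \<alpha> z + \<alpha> z * partial2 \<beta> z + partial2 (partial2 \<beta>) z = 0"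
    if z: "z \<in> U" for z
  proof -
    have "(a21 * (N * x) - a2 * (N * a1)) / (N * x) ^ 2 + b * ((a22 * (N * x) - a2 * (N * a2)) / (N * x) ^ 2)
      + a2 / (N * x) * b2 + b22 = 0"
      if "a1 = - N * b2 * x - b * a2" "a21 = - N * (b22 * x + b2 * a2) - b2 * a2 - b * a22" "x \<noteq> 0"
      for x a1 a2 a21 a22 b b2 b22
    proof -
      define y where "y = N * x"
      have y: "y \<noteq> 0" using N that(3) by (simp add: y_def)
      have "a21 * y - a2 * (N * a1) + b * (a22 * y - a2 * (N * a2)) = - b22 * y ^ 2 - y * (b2 * a2)"
        unfolding that(1,2) y_def by (simp add: algebra_simps power2_eq_square)
      hence "(a21 * y - a2 * (N * a1)) / y ^ 2 + b * ((a22 * y - a2 * (N * a2)) / y ^ 2)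
          = (- b22 * y ^ 2 - y * (b2 * a2)) / y ^ 2"
        by (simp only: times_divide_eq_right add_divide_distrib[symmetric])
      also have "\<dots> = - b22 - b2 * a2 / y" using y by (simp add: diff_divide_distrib power2_eq_square)
      finally show ?thesis unfolding y_def[symmetric] by simp
    qed
    from this[OF A1[OF z] A21[OF z] Az[OF z]] show ?thesis
      unfolding has_partials_unique[OF h\<alpha>[OF z]] by (simp add: \<alpha>_def)
  qed
  \<comment> \<open>An n-th root of the value of \<open>a\<close> at \<open>p\<close>, to be the
    initial value of \<open>partial2 \<omega>\<close>.\<close>
  define c where "c = exp (Ln (A p) / N)"
  have c: "c ^ n = A p"
  proof -
    have "c ^ n = exp (of_nat n * (Ln (A p) / N))" by (simp only: c_def exp_of_nat_mult)
    thus ?thesis using Az[OF U(2)] n by (simp add: N_def)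
  qed
  have c0: "c \<noteq> 0" by (simp add: c_def)
  have ab: "(fst p, snd p) \<in> U" using U by simp
  obtain r \<omega> where r: "r > 0" "ball (fst p) r \<times> ball (snd p) r \<subseteq> U"
    and \<omega>: "analytic2_on \<omega> (ball (fst p) r \<times> ball (snd p) r)"
    and \<omega>1: "\<And>z. z \<in> ball (fst p) r \<times> ball (snd p) r \<Longrightarrow> partial1 \<omega> z = - \<beta> z * partial2 \<omega> z"
    and \<omega>22: "\<And>z. z \<in> ball (fst p) r \<times> ball (snd p) r \<Longrightarrow> partial2 (partial2 \<omega>) z = \<alpha> z * partial2 \<omega> z"
    and \<omega>p: "partial2 \<omega> (fst p, snd p) = c"
    using affine_solution[OF U(1) ab an\<alpha> anb pde, of c] by blast
  define D where "D = ball (fst p) r \<times> ball (snd p) r"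
  have DU: "D \<subseteq> U" and pD: "p \<in> D" and opD: "open D" and convD: "convex D"
    using r by (auto simp: D_def open_Times mem_Times_iff intro!: convex_Times)
  have conv: "connected D" using convD by (rule convex_connected)
  note \<omega> = \<omega>[folded D_def] and \<omega>1 = \<omega>1[folded D_def] and \<omega>22 = \<omega>22[folded D_def]
  have an2: "analytic2_on (partial2 \<omega>) D" by (rule analytic2_on_partial2[OF opD \<omega>])
  \<comment> \<open>The linear equation fixes \<open>partial2 \<omega> ^ n\<close> up to a factor:
    its quotient by \<open>A\<close> has zero gradient, hence is constant on the convex set
    \<open>D\<close>, and the choice of \<open>c\<close> makes it 1.\<close>
  have h0: "has_partials (\<lambda>z. partial2 \<omega> z ^ n / A z) 0 0 z" if z: "z \<in> D" for z
  proof -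
    have zU: "z \<in> U" using DU z by auto
    have \<omega>21: "partial1 (partial2 \<omega>) z = - (partial2 \<beta> z + \<beta> z * \<alpha> z) * partial2 \<omega> z"
    proof -
      have "partial1 (partial2 \<omega>) z = partial2 (partial1 \<omega>) z"
        by (rule partial_commute[OF opD \<omega> z, symmetric])
      also have "\<dots> = (- partial2 \<beta> z) * partial2 \<omega> z + - \<beta> z * partial2 (partial2 \<omega>) z"
        by (rule partial_cong(2)[OF opD z \<omega>1 has_partials_mult[OF has_partials_uminus[OF analytic2_onD[OF anb zU]] analytic2_onD[OF an2 z]]])
      finally show ?thesis by (simp add: \<omega>22[OF z] algebra_simps)
    qed
    have \<alpha>A: "\<alpha> z * N * A z = partial2 A z" using N Az[OF zU] by (simp add: \<alpha>_def)
    have pw: "N * partial2 \<omega> z ^ (n - 1) * (t * partial2 \<omega> z) * A z = t * N * A z * partial2 \<omega> z ^ n" for t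
      using n by (cases n) (simp_all add: mult_ac)
    have "N * partial2 \<omega> z ^ (n - 1) * partial1 (partial2 \<omega>) z * A z - partial2 \<omega> z ^ n * partial1 A z = 0"
      unfolding \<omega>21 pw A1[OF zU] \<alpha>A[symmetric] by (simp add: algebra_simps)
    moreover have "N * partial2 \<omega> z ^ (n - 1) * partial2 (partial2 \<omega>) z * A z - partial2 \<omega> z ^ n * partial2 A z = 0"
      unfolding \<omega>22[OF z] pw \<alpha>A[symmetric] by (simp add: algebra_simps)
    ultimately show ?thesis
      using has_partials_divide[OF has_partials_power[OF analytic2_onD[OF an2 z], of n] analytic2_onD[OF analytic2_on_subset[OF anA DU] z] Az[OF zU]]
      by (simp only: N_def[symmetric] div_0)
  qed
  have "\<exists>k. \<forall>z\<in>D. partial2 \<omega> z ^ n / A z = k"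
    using h0 by (intro has_derivative_zero_constant[OF convD])
      (auto simp: has_partials_def intro: has_derivative_at_withinI)
  then obtain k where k: "\<And>z. z \<in> D \<Longrightarrow> partial2 \<omega> z ^ n / A z = k" by blast
  have "k = 1" using k[OF pD] \<omega>p c Az[OF U(2)] by simp
  hence \<omega>n: "partial2 \<omega> z ^ n = A z" if "z \<in> D" for z
    using k[OF that] Az[OF subsetD[OF DU that]] by simp
  have dr: "dregular z (dp_y 0 1 ^ n - dp_const a)"
    and s: "dp_subst (dp_y 0 1 ^ n - dp_const a) u z = partial2 u z ^ n - A z"
    if "z \<in> D" for u z
    using reg[OF subsetD[OF DU that]]
    by (simp_all add: dp_subst_diff dp_subst_power dp_subst_y dp_subst_const jet_def A_def)
  show ?thesis
  proof (rule solvableI[of D \<omega> _ _ _ "\<lambda>_. 0"])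
    show "\<not> \<omega> constant_on D"
      by (rule not_constant_on_partial2[OF opD pD]) (use \<omega>p c0 in simp)
    show "vf_dpoly X1 X2 \<in> vanish_ideal D \<omega>"
      by (rule vf_in_vanish_ideal) (use X1z DU \<omega>1 in \<open>auto simp: \<beta>_def\<close>)
    show "dp_y 0 1 ^ n - dp_const a \<in> vanish_ideal D \<omega>"
      by (rule vanish_idealI) (simp only: s \<omega>n diff_self)
    show an0: "analytic2_on (\<lambda>_. 0) D" by (rule analytic2_on_const)
    show "dp_y 0 1 ^ n - dp_const a \<notin> vanish_ideal D (\<lambda>_. 0)"
    proof
      assume "dp_y 0 1 ^ n - dp_const a \<in> vanish_ideal D (\<lambda>_. 0)"
      from vanish_idealD[OF opD an0 this pD dr[OF pD]]
      have "0 - A p = 0" unfolding s[OF pD] partials_zero zero_power[OF n] .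
      thus False using Az[OF U(2)] by simp
    qed
    show "vf_dpoly X1 X2 \<in> vanish_ideal D (\<lambda>_. 0)" by (rule zero_in_vanish_ideal)
  qed (use pD opD conv \<omega> in auto)
qed

subsection \<open>Ranks\<close>

lemma leader:
  assumes "derivs_in A \<noteq> {}"
  shows "leader A \<in> derivs_in A" "\<And>w. w \<in> derivs_in A \<Longrightarrow> w \<noteq> leader A \<Longrightarrow> higher_deriv (leader A) w"
proof -
  have "\<exists>v\<in>F. \<forall>w\<in>F. w \<noteq> v \<longrightarrow> higher_deriv v w" if "finite F" "F \<noteq> {}" for F
    using that
  proof (induction F rule: finite_ne_induct)
    case (insert x F)
    then obtain v where v: "v \<in> F" "\<And>w. w \<in> F \<Longrightarrow> w \<noteq> v \<Longrightarrow> higher_deriv v w" by blast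
    have "v \<noteq> x" using insert(3) v(1) by auto
    hence "higher_deriv v x \<or> higher_deriv x v"
      unfolding higher_deriv_def using prod_eq_iff[of v x] by linarith
    moreover have "higher_deriv x w" if "higher_deriv x v" "w \<in> F" for w
      using v(2)[OF that(2)] that(1) unfolding higher_deriv_def by (cases "w = v") auto
    ultimately show ?case using v by (metis insert_iff)
  qed simp
  from this[OF finite_derivs_in assms] obtain v where
    v: "v \<in> derivs_in A \<and> (\<forall>w\<in>derivs_in A. w \<noteq> v \<longrightarrow> higher_deriv v w)" by blast
  have "leader A = v"
    unfolding leader_def
  proof (rule the_equality)
    show "v \<in> derivs_in A \<and> (\<forall>w\<in>derivs_in A. w \<noteq> v \<longrightarrow> higher_deriv v w)" by (fact v)
    fix v' assume v': "v' \<in> derivs_in A \<and> (\<forall>w\<in>derivs_in A. w \<noteq> v' \<longrightarrow> higher_deriv v' w)"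
    show "v' = v"
    proof (rule ccontr)
      assume "v' \<noteq> v"
      hence "higher_deriv v v'" "higher_deriv v' v" using v v' by auto
      thus False by (auto simp: higher_deriv_def)
    qed
  qed
  with v show "leader A \<in> derivs_in A" "\<And>w. w \<in> derivs_in A \<Longrightarrow> w \<noteq> leader A \<Longrightarrow> higher_deriv (leader A) w"
    by auto
qed

text \<open>Ranks embed into a lexicographic product of natural numbers, which is
  well-founded.\<close>

lemma lowest_rank_exists:
  assumes "B \<in> \<Lambda>" "B \<noteq> 0"
  shows "\<exists>A. lowest_rank_in \<Lambda> A"
proof -
  \<comment> \<open>\<open>Suc\<close> separates the elements of K, which get the least rank, from
    polynomials whose leader has no x1-derivative.\<close>
  define rk where "rk A = (if derivs_in A = {} then (0, 0, 0)
     else (Suc (fst (leader A)), snd (leader A), deg_in (leader A) A))" for A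
  have rk: "(rk B, rk A) \<in> less_than <*lex*> less_than <*lex*> less_than" if "higher_rank A B" for A B
    using that by (auto simp: higher_rank_def rk_def higher_deriv_def)
  have "wf (less_than <*lex*> less_than <*lex*> less_than)" by (intro wf_lex_prod wf_less_than)
  hence "wf (inv_image (less_than <*lex*> less_than <*lex*> less_than) rk)" by (rule wf_inv_image)
  from wfE_min[OF this, of B "\<Lambda> - {0}"] assms
  obtain A where A: "A \<in> \<Lambda> - {0}"
    "\<And>C. (C, A) \<in> inv_image (less_than <*lex*> less_than <*lex*> less_than) rk \<Longrightarrow> C \<notin> \<Lambda> - {0}"
    by auto
  hence "lowest_rank_in \<Lambda> A"
    unfolding lowest_rank_in_def using rk by (auto simp: in_inv_image)
  thus ?thesis ..
qed

lemma derivs_in_empty: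
  assumes "derivs_in A = {}"
  shows "A = dp_const (lookup A 0)"
proof -
  have "keys m = {}" if "m \<in> keys A" for m
    using assms that by (simp add: derivs_in_def)
  hence m: "m = 0" if "m \<in> keys A" for m
    using that by simp
  show ?thesis
  proof (rule poly_mapping_eqI)
    fix m show "lookup A m = lookup (dp_const (lookup A 0)) m"
      using m[of m] by (cases "m = 0") (auto simp: dp_const_def lookup_single in_keys_iff)
  qed
qed

text \<open>Every symbol with an x1-derivative ranks above all pure x2-derivatives. Since
  \<open>P\<close> contains only the latter, an element of lowest rank cannot have a higher leader,
  and then all its symbols are pure as well.\<close>

lemma expansion_ord_finite:
  assumes \<Lambda>: "differential_ideal \<Lambda>" "\<Lambda> \<noteq> UNIV" and A: "lowest_rank_in \<Lambda> A"
    and P: "P \<in> \<Lambda>" "P \<noteq> 0" "P \<in> polys_in (ords r)"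
  shows "derivs_in A \<noteq> {}" "A \<in> polys_in (ords (snd (leader A)))" "snd (leader A) \<le> r"
proof -
  have A': "A \<in> \<Lambda>" "A \<noteq> 0" "\<And>B. B \<in> \<Lambda> \<Longrightarrow> B \<noteq> 0 \<Longrightarrow> \<not> higher_rank A B"
    using A by (auto simp: lowest_rank_in_def)
  show ne: "derivs_in A \<noteq> {}"
  proof
    assume e: "derivs_in A = {}"
    from derivs_in_empty[OF this] have "dp_const (lookup A 0) \<in> \<Lambda>" using A'(1) by simp
    moreover have "lookup A 0 \<noteq> 0" using derivs_in_empty[OF e] A'(2) by auto
    ultimately show False using diff_ideal_const_UNIV[OF \<Lambda>(1)] \<Lambda>(2) by blast
  qed
  have "\<not> higher_rank A P" by (rule A'(3)[OF P(1,2)])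
  hence Pne: "derivs_in P \<noteq> {}" and nh: "\<not> higher_deriv (leader A) (leader P)"
    using ne by (auto simp: higher_rank_def)
  have lP: "leader P \<in> ords r" using leader(1)[OF Pne] P(3) by (auto simp: polys_in_def)
  have l: "fst (leader A) = 0" "snd (leader A) \<le> r"
    using nh lP unfolding higher_deriv_def by auto
  show "snd (leader A) \<le> r" by (rule l)
  have "v \<in> ords (snd (leader A))" if "v \<in> derivs_in A" for v
  proof (cases "v = leader A")
    case True
    thus ?thesis using l(1) by (simp add: mem_Times_iff)
  next
    case False
    from leader(2)[OF ne that False] show ?thesis using l(1) by (auto simp: higher_deriv_def mem_Times_iff)
  qed
  thus "A \<in> polys_in (ords (snd (leader A)))" by (auto simp: polys_in_def)
qed

lemma slope_vf:
  assumes I: "differential_ideal I" and X1: "X1 \<noteq> 0" and X: "vf_dpoly X1 X2 \<in> I"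
  shows "dp_y 1 0 + dp_const (slope X1 X2) * dp_y 0 1 \<in> I"
proof -
  have nz: "to_fract X1 \<noteq> 0" using X1 by simp
  have "dp_const (inverse (to_fract X1)) * vf_dpoly X1 X2 =
     dp_const (inverse (to_fract X1) * to_fract X1) * dp_y 1 0 + dp_const (inverse (to_fract X1) * to_fract X2) * dp_y 0 1"
    by (simp only: vf_dpoly_def distrib_left mult.assoc dp_const_mult)
  also have "inverse (to_fract X1) * to_fract X1 = 1" using nz by simp
  also have "inverse (to_fract X1) * to_fract X2 = slope X1 X2" by (simp add: slope_def divide_inverse mult.commute)
  finally have "dp_const (inverse (to_fract X1)) * vf_dpoly X1 X2 = dp_y 1 0 + dp_const (slope X1 X2) * dp_y 0 1"
    by simp
  thus ?thesis using diff_ideal_mult[OF I X, of "dp_const (inverse (to_fract X1))"] by simp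
qed

text \<open>If \<open>A\<close> were zero, it would add nothing to the ideal of the vector field,
  contrary to strict inclusion. So \<open>A\<close> is a competitor for the lowest rank and bounds
  the order.\<close>

lemma expansion_ord_solvable:
  assumes "solvable X1 X2 A" "A \<in> polys_in (ords r)"
  shows "expansion_ord (diff_ideal_gen {vf_dpoly X1 X2, A}) \<le> enat r"
proof -
  let ?\<Lambda> = "diff_ideal_gen {vf_dpoly X1 X2, A}"
  have ex: "is_expansion X1 X2 ?\<Lambda>" and ne: "?\<Lambda> \<noteq> UNIV" using assms(1) by (auto simp: solvable_def)
  have A: "A \<in> ?\<Lambda>" by (intro hull_inc) auto
  have "A \<noteq> 0"
  proof
    assume "A = 0"
    hence "{vf_dpoly X1 X2, A} \<subseteq> diff_ideal_gen {vf_dpoly X1 X2}"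
      using diff_ideal_0[OF differential_ideal_hull] hull_inc[of "vf_dpoly X1 X2" "{vf_dpoly X1 X2}"] by auto
    hence "?\<Lambda> \<subseteq> diff_ideal_gen {vf_dpoly X1 X2}" by (rule hull_minimal) (rule differential_ideal_hull)
    thus False using ex by (auto simp: is_expansion_def)
  qed
  define B where "B = (SOME B. lowest_rank_in ?\<Lambda> B)"
  have "lowest_rank_in ?\<Lambda> B"
    unfolding B_def by (rule someI_ex) (rule lowest_rank_exists[OF A \<open>A \<noteq> 0\<close>])
  from expansion_ord_finite[OF differential_ideal_hull ne this A \<open>A \<noteq> 0\<close> assms(2)]
  show ?thesis by (simp add: expansion_ord_def B_def[symmetric])
qed

subsection \<open>Equations with constant coefficients\<close>

lemma constant_if_partials_0:
  assumes "open \<Omega>" "connected \<Omega>" "\<And>z. z \<in> \<Omega> \<Longrightarrow> has_partials \<omega> 0 0 z"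
  shows "\<omega> constant_on \<Omega>"
proof (rule has_derivative_zero_connected_constant_on[OF assms(2,1) finite.emptyI])
  show "continuous_on \<Omega> \<omega>"
    using assms(3) by (intro continuous_at_imp_continuous_on ballI has_partials_continuous)
  show "\<forall>x\<in>\<Omega> - {}. (\<omega> has_derivative (\<lambda>h. 0)) (at x within \<Omega>)"
    using assms(3) by (auto simp: has_partials_def intro: has_derivative_at_withinI)
qed

text \<open>Where the derivative does not vanish, \<omega> takes only finitely many values, the
  roots of \<open>f\<close>. A continuous function with finite range is constant on a ball,
  contradicting the nonzero derivative.\<close>

lemma partial2_eq_0_if_algebraic:
  assumes op: "open \<Omega>" and \<omega>: "analytic2_on \<omega> \<Omega>" and f: "f \<noteq> 0"
    and 0: "\<And>z. z \<in> \<Omega> \<Longrightarrow> poly f (\<omega> z) * partial2 \<omega> z ^ w = 0" and z: "z \<in> \<Omega>"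
  shows "partial2 \<omega> z = 0"
proof (rule ccontr)
  assume nz: "partial2 \<omega> z \<noteq> 0"
  have "open (\<Omega> \<inter> partial2 \<omega> -` (- {0}))"
    by (rule continuous_open_preimage[OF analytic2_on_continuous[OF analytic2_on_partial2[OF op \<omega>]] op]) auto
  moreover have "z \<in> \<Omega> \<inter> partial2 \<omega> -` (- {0})" using z nz by simp
  ultimately obtain r where r: "r > 0" "ball z r \<subseteq> \<Omega> \<inter> partial2 \<omega> -` (- {0})"
    using open_contains_ball by metis
  have "poly f (\<omega> y) = 0" if "y \<in> ball z r" for y
    using 0[of y] subsetD[OF r(2) that] by auto
  hence "\<omega> ` ball z r \<subseteq> {t. poly f t = 0}" by auto
  hence "finite (\<omega> ` ball z r)" using poly_roots_finite[OF f] finite_subset by blast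
  moreover have "continuous_on (ball z r) \<omega>"
    using analytic2_on_continuous[OF \<omega>] r(2) continuous_on_subset by blast
  ultimately have "\<omega> constant_on ball z r"
    by (intro continuous_finite_range_constant) auto
  thus False using not_constant_on_partial2[of "ball z r" z \<omega>] r(1) nz by auto
qed

text \<open>A monomial of weight \<open>w\<close> in orders 0 and 1 contains exactly the power
  \<open>w\<close> of the symbol of order 1, so \<open>P\<close> is that power times a polynomial
  \<open>f\<close> in \<open>y\<close> with constant coefficients. This forces
  \<open>partial2 \<omega> = 0\<close>, and the vector field then forces
  \<open>partial1 \<omega> = 0\<close>.\<close>

lemma nontrivial_imp_not_algebraic:
  assumes X1: "X1 \<noteq> 0" and nt: "nontrivial \<Lambda>" "\<Lambda> \<noteq> UNIV" and X: "vf_dpoly X1 X2 \<in> \<Lambda>" and P: "P \<in> \<Lambda>"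
    and P1: "P \<in> polys_in (ords 1)" and wP: "\<And>m. m \<in> keys P \<Longrightarrow> wt m = w"
    and c: "\<And>m. lookup P m \<in> range ratfun_const" and m0: "m0 \<in> keys P"
  shows False
proof -
  obtain \<Omega> \<omega> where \<Omega>: "open \<Omega>" "connected \<Omega>" and \<omega>: "analytic2_on \<omega> \<Omega>" "\<not> \<omega> constant_on \<Omega>"
    and van: "\<And>A z. A \<in> \<Lambda> \<Longrightarrow> z \<in> \<Omega> \<Longrightarrow> dregular z A \<Longrightarrow> dp_subst A \<omega> z = 0"
    using nt unfolding nontrivial_def by (auto simp: dregular_iff)
  define cc where "cc m = (SOME t. lookup P m = ratfun_const t)" for m
  have cc: "lookup P m = ratfun_const (cc m)" for m
    unfolding cc_def by (rule someI_ex) (use c[of m] in auto)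
  define f where "f = (\<Sum>m\<in>keys P. monom (cc m) (lookup m (0, 0)))"
  have wt1: "wt m = lookup m (0, 1)" and k1: "keys m \<subseteq> {(0, 0), (0, 1)}" if "m \<in> keys P" for m
  proof -
    show k: "keys m \<subseteq> {(0, 0), (0, 1)}"
      using P1 that by (auto simp: polys_in_iff atMost_Suc le_Suc_eq dest!: bspec subsetD)
    show "wt m = lookup m (0, 1)" using wt_superset[OF _ k] by simp
  qed
  have inj: "m = m'" if "m \<in> keys P" "m' \<in> keys P" "lookup m (0, 0) = lookup m' (0, 0)" for m m'
  proof (rule poly_mapping_eqI)
    fix v show "lookup m v = lookup m' v"
    proof (cases "v \<in> {(0, 0), (0, 1)}")
      case True
      thus ?thesis using that wt1[OF that(1)] wt1[OF that(2)] wP[OF that(1)] wP[OF that(2)] by auto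
    next
      case False
      hence "v \<notin> keys m" "v \<notin> keys m'" using k1 that by blast+
      thus ?thesis by (simp add: in_keys_iff)
    qed
  qed
  have "coeff f (lookup m0 (0, 0)) = (\<Sum>m\<in>keys P. if m = m0 then cc m0 else 0)"
    unfolding f_def coeff_sum by (intro sum.cong refl) (use inj m0 in \<open>auto simp: coeff_monom\<close>)
  also have "\<dots> = cc m0" using m0 by simp
  finally have "f \<noteq> 0" using m0 cc[of m0] by (auto simp: in_keys_iff)
  have eval: "poly f (\<omega> z) * partial2 \<omega> z ^ w = 0" if z: "z \<in> \<Omega>" for z
  proof -
    have "dregular z P" unfolding dregular_def cc by simp
    from van[OF P z this] have "0 = dp_subst P \<omega> z" by simp
    also have "\<dots> = (\<Sum>m\<in>keys P. cc m * \<omega> z ^ lookup m (0, 0) * partial2 \<omega> z ^ w)"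
      unfolding dp_subst_eq
    proof (intro sum.cong refl)
      fix m assume m: "m \<in> keys P"
      have "monom_eval \<omega> m z = (\<Prod>v\<in>{(0, 0), (0, 1)}. jet \<omega> v z ^ lookup m v)"
        unfolding monom_eval_def using k1[OF m] by (intro prod.mono_neutral_left) (auto simp: in_keys_iff)
      also have "\<dots> = \<omega> z ^ lookup m (0, 0) * partial2 \<omega> z ^ w"
        using wt1[OF m] wP[OF m] by (simp add: jet_def)
      finally show "ratfun_eval (lookup P m) z * monom_eval \<omega> m z = cc m * \<omega> z ^ lookup m (0, 0) * partial2 \<omega> z ^ w"
        by (simp add: cc)
    qed
    also have "\<dots> = poly f (\<omega> z) * partial2 \<omega> z ^ w"
      by (simp add: f_def poly_sum poly_monom sum_distrib_right)
    finally show ?thesis by simp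
  qed
  have 2: "partial2 \<omega> z = 0" if "z \<in> \<Omega>" for z
    using partial2_eq_0_if_algebraic[OF \<Omega>(1) \<omega>(1) \<open>f \<noteq> 0\<close> eval that] .
  have 1: "partial1 \<omega> z = 0" if z: "z \<in> \<Omega>" for z
  proof (rule ccontr)
    assume nz: "partial1 \<omega> z \<noteq> 0"
    have "open (\<Omega> \<inter> partial1 \<omega> -` (- {0}))"
      by (rule continuous_open_preimage[OF analytic2_on_continuous[OF analytic2_on_partial1[OF \<Omega>(1) \<omega>(1)]] \<Omega>(1)]) auto
    moreover have "z \<in> \<Omega> \<inter> partial1 \<omega> -` (- {0})" using z nz by simp
    ultimately obtain y where y: "y \<in> \<Omega> \<inter> partial1 \<omega> -` (- {0})" "bipoly_eval X1 y \<noteq> 0"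
      using bipoly_eval_nonzero_open[OF X1] by (metis empty_iff)
    have "dregular y (vf_dpoly X1 X2)"
      by (simp add: vf_dpoly_def dp_subst_add dp_subst_mult dp_subst_const dp_subst_y)
    hence "bipoly_eval X1 y * partial1 \<omega> y + bipoly_eval X2 y * partial2 \<omega> y = 0"
      using van[OF X, of y] y(1) by (simp add: dp_subst_vf)
    thus False using y 2[of y] by simp
  qed
  have "\<omega> constant_on \<Omega>"
    using constant_if_partials_0[OF \<Omega>] analytic2_onD[OF \<omega>(1)] 1 2 by metis
  thus False using \<omega>(2) by simp
qed

section \<open>From an arbitrary expansion to a normal form\<close>

definition normal_form :: "nat \<Rightarrow> dpoly \<Rightarrow> bool" where
  "normal_form r A \<longleftrightarrow>
     (r = 0 \<and> (\<exists>a. a \<notin> range ratfun_const \<and> A = dp_y 0 0 - dp_const a)) \<or>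
     (r = 1 \<and> (\<exists>n a. n > 0 \<and> A = dp_y 0 1 ^ n - dp_const a)) \<or>
     (r = 2 \<and> (\<exists>a. A = dp_y 0 2 - dp_const a * dp_y 0 1)) \<or>
     (r = 3 \<and> (\<exists>a. A = 2 * dp_y 0 1 * dp_y 0 3 - 3 * (dp_y 0 2) ^ 2 - dp_const a * (dp_y 0 1) ^ 2))"

lemma polys_in_power: "A \<in> polys_in V \<Longrightarrow> A ^ n \<in> polys_in V"
proof (induction n)
  case 0
  show ?case using polys_in_const[of 1] by simp
qed (auto intro: polys_in_mult)

lemma polys_in_numeral: "numeral n \<in> polys_in V"
  by (metis polys_in_const dp_const_of_nat of_nat_numeral)

lemma normal_form_polys_in: "normal_form r A \<Longrightarrow> A \<in> polys_in (ords r)"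
  unfolding normal_form_def
  by (elim disjE conjE exE; hypsubst; intro polys_in_diff polys_in_mult polys_in_power polys_in_y polys_in_const polys_in_numeral) auto

text \<open>An element of lowest rank fixes the order \<open>s\<close>, and the semi-invariant built
  from it has order at most \<open>s\<close>. In each of the first four cases the normal form then
  has order at most \<open>s\<close>; the last case contradicts nontriviality.\<close>

lemma expansion_imp_normal_form:
  assumes X1: "X1 \<noteq> 0" and ex: "is_expansion X1 X2 \<Lambda>" and nt: "nontrivial \<Lambda>" and fin: "expansion_ord \<Lambda> \<noteq> \<infinity>"
  obtains r A where "enat r \<le> expansion_ord \<Lambda>" "normal_form r A" "solvable X1 X2 A"
proof -
  let ?X = "vf_dpoly X1 X2" and ?b = "slope X1 X2"
  have I: "differential_ideal \<Lambda>" and sub: "diff_ideal_gen {?X} \<subset> \<Lambda>" using ex by (auto simp: is_expansion_def)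
  have "?X \<in> diff_ideal_gen {?X}" by (intro hull_inc) auto
  hence X: "?X \<in> \<Lambda>" using sub by auto
  have b: "dp_y 1 0 + dp_const ?b * dp_y 0 1 \<in> \<Lambda>" by (rule slope_vf[OF I X1 X])
  have bX: "dp_y 1 0 + dp_const ?b * dp_y 0 1 \<in> diff_ideal_gen {?X}"
    by (rule slope_vf[OF differential_ideal_hull X1]) fact
  obtain B where B: "B \<in> \<Lambda>" "B \<notin> diff_ideal_gen {?X}" using sub by blast
  \<comment> \<open>The reduction is carried out modulo \<open>{X}\<close> and not modulo \<Lambda>,
    so that the remainder of an element outside \<open>{X}\<close> is nonzero.\<close>
  obtain B' where B': "B' \<in> polys_in ({0} \<times> UNIV)" "B - B' \<in> diff_ideal_gen {?X}"
    using reduce_to_ords[OF differential_ideal_hull bX, of B] by blast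
  have "B - (B - B') \<in> \<Lambda>" by (rule diff_ideal_diff[OF I B(1) subsetD[OF psubset_imp_subset[OF sub] B'(2)]])
  hence B'\<Lambda>: "B' \<in> \<Lambda>" by simp
  have B'0: "B' \<noteq> 0" using B(2) B'(2) by auto
  define A where "A = (SOME A. lowest_rank_in \<Lambda> A)"
  have A: "lowest_rank_in \<Lambda> A"
    unfolding A_def by (rule someI_ex) (rule lowest_rank_exists[OF B'\<Lambda> B'0])
  have ord: "expansion_ord \<Lambda> = (if derivs_in A = {} then \<infinity> else enat (snd (leader A)))"
    by (simp add: expansion_ord_def A_def)
  hence neA: "derivs_in A \<noteq> {}" using fin by auto
  have "\<Lambda> \<noteq> UNIV"
  proof
    assume "\<Lambda> = UNIV"
    moreover have "derivs_in (1 :: dpoly) = {}" by (simp add: derivs_in_def)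
    hence "higher_rank A 1" using neA by (simp add: higher_rank_def)
    ultimately show False using A by (auto simp: lowest_rank_in_def)
  qed
  obtain k where k: "B' \<in> polys_in (ords k)" using polys_in_ordsE[OF B'(1)] by blast
  define s where "s = snd (leader A)"
  have As: "A \<in> polys_in (ords s)"
    unfolding s_def by (rule expansion_ord_finite(2)[OF I \<open>\<Lambda> \<noteq> UNIV\<close> A B'\<Lambda> B'0 k])
  have os: "expansion_ord \<Lambda> = enat s" using ord neA by (simp add: s_def)
  have "A \<in> \<Lambda>" "A \<noteq> 0" using A by (auto simp: lowest_rank_in_def)
  from semi_invariant_exists[OF I b this(1) As this(2)]
  obtain P w m0 where P: "P \<in> \<Lambda>" "P \<in> polys_in (ords s)"
    "eder ?b s P = - dp_const (of_nat w * ratfun_d2 ?b) * P"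
    "\<And>m. m \<in> keys P \<Longrightarrow> wt m \<le> w" "lookup P m0 = 1" "wt m0 = w" by metis
  have "\<forall>m\<in>keys P. wt m \<le> w" using P(4) by blast
  from semi_invariant_cases[OF P(2,3) this P(5,6)] show ?thesis
  proof (elim disjE conjE exE)
    fix a assume h: "a \<notin> range ratfun_const" "yder ?b a = 0"
    show ?thesis
    proof (rule that)
      show "enat 0 \<le> expansion_ord \<Lambda>" using h by (simp add: os)
      show "normal_form 0 (dp_y 0 0 - dp_const a)"
        using h by (auto simp: normal_form_def)
      show "solvable X1 X2 (dp_y 0 0 - dp_const a)"
        by (rule solvable_order_0[OF X1]) (use h in auto)
    qed
  next
    fix n a assume h: "1 \<le> s" "0 < n" "a \<noteq> 0" "yder ?b a = - of_nat n * ratfun_d2 ?b * a"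
    show ?thesis
    proof (rule that)
      show "enat 1 \<le> expansion_ord \<Lambda>" using h by (simp add: os)
      show "normal_form 1 (dp_y 0 1 ^ n - dp_const a)"
        using h by (auto simp: normal_form_def)
      show "solvable X1 X2 (dp_y 0 1 ^ n - dp_const a)"
        by (rule solvable_order_1[OF X1]) (use h in auto)
    qed
  next
    fix a assume h: "2 \<le> s" "yder ?b a + ratfun_d2 ?b * a + d2n 2 ?b = 0"
    show ?thesis
    proof (rule that)
      show "enat 2 \<le> expansion_ord \<Lambda>" using h by (simp add: os)
      show "normal_form 2 (dp_y 0 2 - dp_const a * dp_y 0 1)"
        using h by (auto simp: normal_form_def)
      show "solvable X1 X2 (dp_y 0 2 - dp_const a * dp_y 0 1)"
        by (rule solvable_order_2[OF X1]) (use h in auto)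
    qed
  next
    fix a assume h: "3 \<le> s" "yder ?b a + 2 * ratfun_d2 ?b * a + 2 * d2n 3 ?b = 0"
    show ?thesis
    proof (rule that)
      show "enat 3 \<le> expansion_ord \<Lambda>" using h by (simp add: os)
      show "normal_form 3 (2 * dp_y 0 1 * dp_y 0 3 - 3 * (dp_y 0 2) ^ 2 - dp_const a * (dp_y 0 1) ^ 2)"
        using h by (auto simp: normal_form_def)
      show "solvable X1 X2 (2 * dp_y 0 1 * dp_y 0 3 - 3 * (dp_y 0 2) ^ 2 - dp_const a * (dp_y 0 1) ^ 2)"
        by (rule solvable_order_3[OF X1]) (use h in auto)
    qed
  next
    assume "P \<in> polys_in (ords 1)" "\<forall>m\<in>keys P. wt m = w" "\<forall>m. lookup P m \<in> range ratfun_const"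
    hence False
      by (intro nontrivial_imp_not_algebraic[OF X1 nt \<open>\<Lambda> \<noteq> UNIV\<close> X P(1), of w m0])
        (use P(5) in \<open>auto simp: in_keys_iff\<close>)
    thus ?thesis ..
  qed
qed

text \<open>The infimum of a nonempty set of extended naturals is attained. An expansion of least
  order yields a normal form with some index \<open>r\<close> at most that order, and the expansion
  generated by it has order at most \<open>r\<close>. Minimality forces equality throughout, so the
  index of the normal form is the order of the operator.\<close>

theorem theorem5:
  fixes X1 X2 :: "complex poly poly"
  assumes "X1 \<noteq> 0"
  shows "((0 \<le> operator_ord X1 X2 \<and> operator_ord X1 X2 \<le> 3) \<or> operator_ord X1 X2 = \<infinity>) \<and>
    (0 \<le> operator_ord X1 X2 \<and> operator_ord X1 X2 \<le> 3 \<longrightarrow>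
      (\<exists>A. essential_expansion X1 X2 (diff_ideal_gen {vf_dpoly X1 X2, A}) \<and>
        (operator_ord X1 X2 = 0 \<longrightarrow>
          (\<exists>a. a \<notin> range ratfun_const \<and> A = dp_y 0 0 - dp_const a)) \<and>
        (operator_ord X1 X2 = 1 \<longrightarrow>
          (\<exists>(n::nat) a. n > 0 \<and> A = dp_y 0 1 ^ n - dp_const a)) \<and>
        (operator_ord X1 X2 = 2 \<longrightarrow>
          (\<exists>a. A = dp_y 0 2 - dp_const a * dp_y 0 1)) \<and>
        (operator_ord X1 X2 = 3 \<longrightarrow>
          (\<exists>a. A = 2 * dp_y 0 1 * dp_y 0 3 - 3 * (dp_y 0 2) ^ 2 - dp_const a * (dp_y 0 1) ^ 2))))"
proof (cases "operator_ord X1 X2 = \<infinity>")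
  case True
  thus ?thesis by simp
next
  case False
  define S where "S = expansion_ord ` {\<Lambda>. is_expansion X1 X2 \<Lambda> \<and> nontrivial \<Lambda>}"
  have ord: "operator_ord X1 X2 = Inf S" by (simp add: operator_ord_def S_def)
  hence "S \<noteq> {}" using False by (auto simp: Inf_enat_def)
  hence "Inf S \<in> S" unfolding Inf_enat_def by (auto intro: LeastI)
  then obtain \<Lambda> where \<Lambda>: "is_expansion X1 X2 \<Lambda>" "nontrivial \<Lambda>" "expansion_ord \<Lambda> = operator_ord X1 X2"
    unfolding ord by (auto simp: S_def)
  obtain r A where r: "enat r \<le> expansion_ord \<Lambda>" and nf: "normal_form r A" and sol: "solvable X1 X2 A"
    using expansion_imp_normal_form[OF assms \<Lambda>(1,2)] \<Lambda>(3) False by metis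
  let ?L = "diff_ideal_gen {vf_dpoly X1 X2, A}"
  have "expansion_ord ?L \<in> S" using sol by (auto simp: S_def solvable_def)
  hence "operator_ord X1 X2 \<le> expansion_ord ?L" unfolding ord by (rule Inf_lower)
  moreover have "expansion_ord ?L \<le> enat r"
    by (rule expansion_ord_solvable[OF sol normal_form_polys_in[OF nf]])
  ultimately have eq: "operator_ord X1 X2 = enat r" "expansion_ord ?L = operator_ord X1 X2"
    using r \<Lambda>(3) by auto
  have ess: "essential_expansion X1 X2 ?L"
    using sol eq(2) by (simp add: essential_expansion_def solvable_def)
  have r3: "r \<le> 3" using nf by (auto simp: normal_form_def)
  have en: "(enat r = 0) = (r = 0)" "(enat r = 1) = (r = 1)" "(enat r = 2) = (r = 2)" "(enat r = 3) = (r = 3)"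
    "(enat r \<le> 3) = (r \<le> 3)"
    by (simp_all add: zero_enat_def one_enat_def numeral_eq_enat)
  show ?thesis
    unfolding eq(1) en
    by (intro conjI impI disjI1 exI[of _ A] ess r3) (use nf in \<open>auto simp: normal_form_def\<close>)
qed

end
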